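(* Let $\mathcal{A}$ be a unital $C^*$-algebra, $\mathcal{B}$ a finite factor and $\phi:\mathcal{A}\to\mathcal{B}$ a positive unital linear map. Then, for every convex function $f:I\to\mathbb{R}$ defined on some open interval $I\subseteq\mathbb{R}$, and for every self-adjoint element $a\in\mathcal{A}$ whose spectrum is contained in $I$, $$f(\phi(a))\preccurlyeq\phi(f(a)),$$ i.e. $f(\phi(a))$ is submajorized by $\phi(f(a))$ in $\mathcal{B}$.
   Context: A linear map between $C^*$-algebras is positive if it maps positive elements to positive elements. Functions of self-adjoint elements are defined by continuous functional calculus. Submajorization: let $\mathcal{B}$ be a finite factor (a von Neumann algebra) with normalized trace $\mathrm{tr}$. For a self-adjoint $c\in\mathcal{B}$ let $E_c[(\gamma,\infty)]=\chi_{(\gamma,\infty)}(c)$ be its spectral projection and, for $t\in[0,1)$, put $$e_c(t)=\inf\{\gamma\in\mathbb{R}:\ \mathrm{tr}(E_c[(\gamma,\infty)])\leq t\}.$$ For self-adjoint $x,y\in\mathcal{B}$, $x\preccurlyeq y$ ($x$ is submajorized by $y$) means that $\int_0^\alpha e_x(t)\,dt\leq\int_0^\alpha e_y(t)\,dt$ for every $\alpha\in[0,1]$. *)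

theory Defs
  imports "HOL-Analysis.Analysis"
begin

section \<open>Complex normed spaces, Hilbert spaces and unital C*-algebras\<close>

class complex_vec = real_vector +
  fixes scaleC :: "complex \<Rightarrow> 'a \<Rightarrow> 'a"  (infixr "*\<^sub>C" 75)
  assumes scaleC_add_right: "c *\<^sub>C (x + y) = c *\<^sub>C x + c *\<^sub>C y"
    and scaleC_add_left: "(c + d) *\<^sub>C x = c *\<^sub>C x + d *\<^sub>C x"
    and scaleC_scaleC: "c *\<^sub>C (d *\<^sub>C x) = (c * d) *\<^sub>C x"
    and scaleC_of_real: "complex_of_real r *\<^sub>C x = r *\<^sub>R x"

class complex_normed_vec = complex_vec + real_normed_vector +
  assumes norm_scaleC: "norm (c *\<^sub>C x) = cmod c * norm x"

text \<open>The inner product is linear in the first argument.\<close>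

class complex_hilbert_space = complex_normed_vec + banach +
  fixes cinner :: "'a \<Rightarrow> 'a \<Rightarrow> complex"
  assumes cinner_commute: "cinner x y = cnj (cinner y x)"
    and cinner_add_left: "cinner (x + y) z = cinner x z + cinner y z"
    and cinner_scaleC_left: "cinner (c *\<^sub>C x) y = c * cinner x y"
    and cinner_norm: "cinner x x = complex_of_real ((norm x)\<^sup>2)"

class unital_cstar_algebra = complex_normed_vec + real_normed_algebra_1 + banach +
  fixes star :: "'a \<Rightarrow> 'a"
  assumes scaleC_mult_left: "(c *\<^sub>C x) * y = c *\<^sub>C (x * y)"
    and scaleC_mult_right: "x * (c *\<^sub>C y) = c *\<^sub>C (x * y)"
    and star_add: "star (x + y) = star x + star y"
    and star_scaleC: "star (c *\<^sub>C x) = cnj c *\<^sub>C star x"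
    and star_mult: "star (x * y) = star y * star x"
    and star_star: "star (star x) = x"
    and cstar_identity: "norm (star x * x) = (norm x)\<^sup>2"

definition complex_linear :: "('a::complex_vec \<Rightarrow> 'b::complex_vec) \<Rightarrow> bool" where
  "complex_linear T \<longleftrightarrow>
     (\<forall>x y. T (x + y) = T x + T y) \<and> (\<forall>c x. T (c *\<^sub>C x) = c *\<^sub>C T x)"


section \<open>Spectrum, positivity and continuous functional calculus\<close>

definition spectrum :: "'a::unital_cstar_algebra \<Rightarrow> complex set" where
  "spectrum a = {l. \<not> (\<exists>b. (a - l *\<^sub>C 1) * b = 1 \<and> b * (a - l *\<^sub>C 1) = 1)}"

definition selfadjoint :: "'a::unital_cstar_algebra \<Rightarrow> bool" where
  "selfadjoint a \<longleftrightarrow> star a = a"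

definition positive :: "'a::unital_cstar_algebra \<Rightarrow> bool" where
  "positive a \<longleftrightarrow> selfadjoint a \<and> spectrum a \<subseteq> complex_of_real ` {0..}"

definition positive_map :: "('a::unital_cstar_algebra \<Rightarrow> 'b::unital_cstar_algebra) \<Rightarrow> bool" where
  "positive_map \<phi> \<longleftrightarrow> (\<forall>a. positive a \<longrightarrow> positive (\<phi> a))"

text \<open>
  The continuous functional calculus of \<open>a\<close> is the unital *-homomorphism from the continuous
  functions on the spectrum of \<open>a\<close> to the algebra that sends the identity function to \<open>a\<close>.
  Functions on the spectrum are represented by total functions, so the values of \<open>\<Psi>\<close> may only
  depend on the restriction to the spectrum.
\<close>

definition functional_calculus ::
  "'a::unital_cstar_algebra \<Rightarrow> ((complex \<Rightarrow> complex) \<Rightarrow> 'a) \<Rightarrow> bool" where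
  "functional_calculus a \<Psi> \<longleftrightarrow>
     \<Psi> (\<lambda>z. 1) = 1 \<and> \<Psi> (\<lambda>z. z) = a \<and>
     (\<forall>f. continuous_on (spectrum a) f \<longrightarrow>
        (\<forall>c. \<Psi> (\<lambda>z. c * f z) = c *\<^sub>C \<Psi> f) \<and>
        \<Psi> (\<lambda>z. cnj (f z)) = star (\<Psi> f) \<and>
        (\<forall>g. continuous_on (spectrum a) g \<longrightarrow>
           \<Psi> (\<lambda>z. f z + g z) = \<Psi> f + \<Psi> g \<and>
           \<Psi> (\<lambda>z. f z * g z) = \<Psi> f * \<Psi> g \<and>
           ((\<forall>z\<in>spectrum a. f z = g z) \<longrightarrow> \<Psi> f = \<Psi> g)))"

text \<open>
  For self-adjoint \<open>a\<close> the map \<open>\<Psi>\<close> exists and is uniquely determined on the functions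
  that are continuous on the spectrum, so the choice below is immaterial for these functions.
  A real function \<open>f\<close> is read as the function \<open>z \<mapsto> f (Re z)\<close> on the spectrum, which is real.
\<close>

definition cfc :: "(real \<Rightarrow> real) \<Rightarrow> 'a::unital_cstar_algebra \<Rightarrow> 'a" where
  "cfc f a = (SOME \<Psi>. functional_calculus a \<Psi>) (\<lambda>z. complex_of_real (f (Re z)))"


section \<open>Von Neumann algebras and finite factors\<close>

definition commutant ::
  "('h::complex_hilbert_space \<Rightarrow> 'h) set \<Rightarrow> ('h \<Rightarrow> 'h) set" where
  "commutant M = {T. complex_linear T \<and> bounded_linear T \<and> (\<forall>S\<in>M. T \<circ> S = S \<circ> T)}"

text \<open>
  A von Neumann algebra is a C*-algebra \<open>'b\<close> together with a faithful unital *-representation \<open>\<pi>\<close>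
  on a Hilbert space \<open>'h\<close> whose image equals its bicommutant; that is, the elements of \<open>'b\<close>
  are identified with operators through \<open>\<pi>\<close>. Boundedness and linearity of each \<open>\<pi> x\<close> is part of
  the bicommutant condition, and \<open>\<pi>\<close> is automatically isometric.
\<close>

definition von_neumann_algebra ::
  "('b::unital_cstar_algebra \<Rightarrow> 'h::complex_hilbert_space \<Rightarrow> 'h) \<Rightarrow> bool" where
  "von_neumann_algebra \<pi> \<longleftrightarrow>
     (\<forall>x y \<xi>. \<pi> (x + y) \<xi> = \<pi> x \<xi> + \<pi> y \<xi>) \<and>
     (\<forall>c x \<xi>. \<pi> (c *\<^sub>C x) \<xi> = c *\<^sub>C \<pi> x \<xi>) \<and>
     (\<forall>x y. \<pi> (x * y) = \<pi> x \<circ> \<pi> y) \<and>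
     \<pi> 1 = id \<and>
     (\<forall>x \<xi> \<eta>. cinner (\<pi> x \<xi>) \<eta> = cinner \<xi> (\<pi> (star x) \<eta>)) \<and>
     inj \<pi> \<and>
     range \<pi> = commutant (commutant (range \<pi>))"

text \<open>
  A factor has trivial centre. It is finite if the identity is a finite projection, that is,
  not Murray-von Neumann equivalent to a proper subprojection.
\<close>

definition finite_factor ::
  "('b::unital_cstar_algebra \<Rightarrow> 'h::complex_hilbert_space \<Rightarrow> 'h) \<Rightarrow> bool" where
  "finite_factor \<pi> \<longleftrightarrow>
     von_neumann_algebra \<pi> \<and>
     (\<forall>z::'b. (\<forall>x. z * x = x * z) \<longrightarrow> (\<exists>c. z = c *\<^sub>C 1)) \<and>
     (\<forall>v::'b. star v * v = 1 \<longrightarrow> v * star v = 1)"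

text \<open>
  On a finite factor there is exactly one tracial state; faithfulness and normality are automatic.
\<close>

definition normalized_trace :: "('b::unital_cstar_algebra \<Rightarrow> complex) \<Rightarrow> bool" where
  "normalized_trace tr \<longleftrightarrow>
     (\<forall>x y. tr (x + y) = tr x + tr y) \<and>
     (\<forall>c x. tr (c *\<^sub>C x) = c * tr x) \<and>
     (\<forall>x. positive x \<longrightarrow> tr x \<in> complex_of_real ` {0..}) \<and>
     (\<forall>x y. tr (x * y) = tr (y * x)) \<and>
     tr 1 = 1"


section \<open>Spectral measures and submajorization\<close>

definition projection :: "'b::unital_cstar_algebra \<Rightarrow> bool" where
  "projection p \<longleftrightarrow> star p = p \<and> p * p = p"

definition projection_valued_measure ::
  "('b::unital_cstar_algebra \<Rightarrow> 'h::complex_hilbert_space \<Rightarrow> 'h) \<Rightarrow> (real set \<Rightarrow> 'b) \<Rightarrow> bool" where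
  "projection_valued_measure \<pi> E \<longleftrightarrow>
     (\<forall>X\<in>sets borel. projection (E X)) \<and>
     E UNIV = 1 \<and>
     (\<forall>X\<in>sets borel. \<forall>Y\<in>sets borel. E (X \<inter> Y) = E X * E Y) \<and>
     (\<forall>X::nat \<Rightarrow> real set. range X \<subseteq> sets borel \<longrightarrow> disjoint_family X \<longrightarrow>
        (\<forall>\<xi>. (\<lambda>n. \<pi> (E (X n)) \<xi>) sums \<pi> (E (\<Union>n. X n)) \<xi>))"

text \<open>
  The scalar measure \<open>X \<mapsto> \<langle>\<pi> (E X) \<xi>, \<xi>\<rangle>\<close>; the inner product equals \<open>\<parallel>\<pi> (E X) \<xi>\<parallel>\<^sup>2\<close>,
  as \<open>E X\<close> is a projection.
\<close>

definition scalar_measure ::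
  "('b::unital_cstar_algebra \<Rightarrow> 'h::complex_hilbert_space \<Rightarrow> 'h) \<Rightarrow> (real set \<Rightarrow> 'b) \<Rightarrow> 'h
     \<Rightarrow> real measure" where
  "scalar_measure \<pi> E \<xi> = measure_of UNIV (sets borel) (\<lambda>X. ennreal ((norm (\<pi> (E X) \<xi>))\<^sup>2))"

text \<open>\<open>c\<close> is the integral of the identity function with respect to \<open>E\<close>, in the weak sense.\<close>

definition spectral_measure_of ::
  "('b::unital_cstar_algebra \<Rightarrow> 'h::complex_hilbert_space \<Rightarrow> 'h) \<Rightarrow> 'b \<Rightarrow> (real set \<Rightarrow> 'b) \<Rightarrow> bool" where
  "spectral_measure_of \<pi> c E \<longleftrightarrow>
     projection_valued_measure \<pi> E \<and>
     (\<forall>\<xi>. integrable (scalar_measure \<pi> E \<xi>) (\<lambda>s. s) \<and>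
          cinner (\<pi> c \<xi>) \<xi> = complex_of_real (\<integral>s. s \<partial>scalar_measure \<pi> E \<xi>))"

text \<open>
  By the spectral theorem, the spectral measure of a self-adjoint element exists and is unique on
  the Borel sets; the choice only concerns the irrelevant values on other sets.
\<close>

definition spectral_projection ::
  "('b::unital_cstar_algebra \<Rightarrow> 'h::complex_hilbert_space \<Rightarrow> 'h) \<Rightarrow> 'b \<Rightarrow> real set \<Rightarrow> 'b" where
  "spectral_projection \<pi> c = (SOME E. spectral_measure_of \<pi> c E)"

text \<open>
  The value of a trace on a projection is real, so \<open>Re\<close> loses nothing. Only \<open>t \<in> [0,1)\<close> is
  meaningful: at \<open>t = 1\<close> the set is unbounded below.
\<close>

definition spectral_scale ::
  "('b::unital_cstar_algebra \<Rightarrow> 'h::complex_hilbert_space \<Rightarrow> 'h) \<Rightarrow> ('b \<Rightarrow> complex) \<Rightarrow> 'b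
     \<Rightarrow> real \<Rightarrow> real" where
  "spectral_scale \<pi> tr c t = Inf {\<gamma>. Re (tr (spectral_projection \<pi> c {\<gamma><..})) \<le> t}"

text \<open>
  The half-open domain of integration excludes the point \<open>t = 1\<close> when \<open>\<alpha> = 1\<close>.
\<close>

definition submajorized ::
  "('b::unital_cstar_algebra \<Rightarrow> 'h::complex_hilbert_space \<Rightarrow> 'h) \<Rightarrow> ('b \<Rightarrow> complex) \<Rightarrow> 'b \<Rightarrow> 'b
     \<Rightarrow> bool" where
  "submajorized \<pi> tr x y \<longleftrightarrow>
     (\<forall>\<alpha>\<in>{0..1}. integral {0..<\<alpha>} (spectral_scale \<pi> tr x)
                  \<le> integral {0..<\<alpha>} (spectral_scale \<pi> tr y))"

end

theory Submission
  imports Defs "HOL-Computational_Algebra.Fundamental_Theorem_Algebra"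
begin

text \<open>
  Write \<open>b = \<phi>(a)\<close>, \<open>x = f(b)\<close>, \<open>y = \<phi>(f(a))\<close>. Each tangent line \<open>L\<close> of \<open>f\<close> gives
  \<open>L(b) = \<phi>(L(a)) \<le> y\<close>. Localizing with a partition of unity \<open>\<theta>\<^sub>i(b)\<close> whose members live where
  a tangent line is close to \<open>f\<close> yields \<open>tr(x h) \<le> tr(y h)\<close> for every positive \<open>h\<close> commuting with \<open>b\<close>.
  Taking for \<open>h\<close> a continuous approximation of the spectral projection of \<open>x\<close> on \<open>(\<gamma>, \<infinity>)\<close> gives
  \<open>tr((x - \<gamma>)\<^sub>+) \<le> tr((y - \<gamma>)\<^sub>+)\<close> for all \<open>\<gamma>\<close>, which is equivalent to submajorization because
  \<open>tr((c - \<gamma>)\<^sub>+) = \<integral>\<^sub>0\<^sup>1 (e\<^sub>c(t) - \<gamma>)\<^sub>+ dt\<close>. The last identity compares two additive interval functions with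
  the same Riemann sums of \<open>\<gamma> \<mapsto> tr(E\<^sub>c[(\<gamma>,\<infinity>)])\<close>.
\<close>

section \<open>Unital C*-algebras\<close>

text \<open>The operator inequality \<open>f(\<phi>(a)) \<le> \<phi>(f(a))\<close> fails in general,
  since \<open>f\<close> is convex but not operator convex. The map \<open>\<phi>\<close> is not
  multiplicative, so only affine functions of \<open>a\<close> are carried over to functions of
  \<open>b\<close>; and \<open>y\<close> does not commute with \<open>b\<close>, so the tangent
  inequalities cannot be glued at the level of operators. The trace removes this second obstacle
  because it is nonnegative on a product of two positive elements even when they do not commute.
  Another difficulty is that the spectral scale refers to a spectral measure picked by choice. Its
  projections are reached through the continuous functions \<open>ramp r s\<close>, where
  \<open>ramp r s t\<close> is the integral over \<open>\<gamma>\<close> from \<open>r\<close> to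
  \<open>s\<close> of the indicator of \<open>t > \<gamma>\<close>. For every spectral measure
  \<open>E\<close> of \<open>c\<close> they satisfy \<open>(s - r) E(s,\<infinity>) \<le> ramp r s
  (c) \<le> (s - r) E(r,\<infinity>)\<close>, and they are additive in the interval. If
  \<open>N\<close> is at least the norm of \<open>c\<close>, then \<open>ramp \<gamma> N\<close> at
  \<open>c\<close> is the element \<open>(c - \<gamma>)\<^sub>+\<close>.\<close>

lemma scaleC_one: "1 *\<^sub>C x = (x::'a::complex_vec)"
  using scaleC_of_real[of 1 x] by simp

lemma scaleC_zero_left: "0 *\<^sub>C x = (0::'a::complex_vec)"
  using scaleC_of_real[of 0 x] by simp

lemma scaleC_zero_right: "c *\<^sub>C (0::'a::complex_vec) = 0"
  using scaleC_add_right[of c 0 0] by simp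

lemma scaleC_minus_left: "(- c) *\<^sub>C x = - (c *\<^sub>C (x::'a::complex_vec))"
  by (metis add.right_inverse add_eq_0_iff scaleC_add_left scaleC_zero_left)

lemma scaleC_minus_right: "c *\<^sub>C (- x) = - (c *\<^sub>C (x::'a::complex_vec))"
  by (metis add.right_inverse add_eq_0_iff scaleC_add_right scaleC_zero_right)

lemma scaleC_diff_right: "c *\<^sub>C (x - y) = c *\<^sub>C x - c *\<^sub>C (y::'a::complex_vec)"
  using scaleC_add_right[of c x "- y"] by (simp add: scaleC_minus_right)

lemma scaleC_diff_left: "(c - d) *\<^sub>C x = c *\<^sub>C x - d *\<^sub>C (x::'a::complex_vec)"
  using scaleC_add_left[of c "- d" x] by (simp add: scaleC_minus_left)

lemma tendsto_scaleC:
  assumes "(f \<longlongrightarrow> (x::'a::complex_normed_vec)) F"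
  shows "((\<lambda>n. c *\<^sub>C f n) \<longlongrightarrow> c *\<^sub>C x) F"
proof -
  have "((\<lambda>n. cmod c * norm (f n - x)) \<longlongrightarrow> cmod c * 0) F"
    by (intro tendsto_mult_left tendsto_norm_zero LIM_zero assms)
  then have "((\<lambda>n. norm (c *\<^sub>C f n - c *\<^sub>C x)) \<longlongrightarrow> 0) F"
    by (simp add: scaleC_diff_right[symmetric] norm_scaleC)
  then show ?thesis
    by (rule LIM_zero_cancel[OF tendsto_norm_zero_cancel])
qed

context
  fixes x y :: "'a::unital_cstar_algebra"
begin

lemma star_zero: "star (0::'a) = 0"
  using star_add[of "0::'a" 0] by simp

lemma star_minus: "star (- x) = - star x"
  by (metis add.right_inverse add_eq_0_iff star_add star_zero)

lemma star_diff: "star (x - y) = star x - star y"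
  using star_add[of x "- y"] star_minus by (metis add_uminus_conv_diff scaleC_minus_left scaleC_one star_scaleC complex_cnj_minus complex_cnj_one)

lemma star_one: "star (1::'a) = 1"
  by (metis mult.right_neutral star_mult star_star)

lemma star_scaleR: "star (r *\<^sub>R x) = r *\<^sub>R star x"
  using star_scaleC[of "complex_of_real r" x] by (simp add: scaleC_of_real)

lemma norm_star: "norm (star x) = norm x"
proof -
  have le: "norm z \<le> norm (star z)" for z :: 'a
  proof (cases "z = 0")
    case False
    have "norm z * norm z \<le> norm (star z) * norm z"
      using cstar_identity[of z] norm_mult_ineq[of "star z" z] by (simp add: power2_eq_square)
    then show ?thesis using False by (simp add: mult_le_cancel_right)
  qed simp
  show ?thesis using le[of x] le[of "star x"] by (simp add: star_star)
qed

end

lemma tendsto_star: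
  assumes "(f \<longlongrightarrow> (x::'a::unital_cstar_algebra)) F"
  shows "((\<lambda>n. star (f n)) \<longlongrightarrow> star x) F"
proof -
  have "((\<lambda>n. norm (star (f n) - star x)) \<longlongrightarrow> 0) F"
    using tendsto_norm_zero[OF LIM_zero[OF assms]] by (simp add: star_diff[symmetric] norm_star)
  then show ?thesis
    by (rule LIM_zero_cancel[OF tendsto_norm_zero_cancel])
qed

lemma selfadjointI: "star a = a \<Longrightarrow> selfadjoint a"
  and selfadjointD: "selfadjoint a \<Longrightarrow> star a = a"
  by (simp_all add: selfadjoint_def)

lemma selfadjoint_zero: "selfadjoint 0"
  and selfadjoint_one: "selfadjoint 1"
  by (simp_all add: selfadjoint_def star_zero star_one)

lemma selfadjoint_add: "selfadjoint a \<Longrightarrow> selfadjoint b \<Longrightarrow> selfadjoint (a + b)"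
  and selfadjoint_diff: "selfadjoint a \<Longrightarrow> selfadjoint b \<Longrightarrow> selfadjoint (a - b)"
  and selfadjoint_scaleR: "selfadjoint a \<Longrightarrow> selfadjoint (r *\<^sub>R a)"
  and selfadjoint_mult: "selfadjoint a \<Longrightarrow> selfadjoint b \<Longrightarrow> a * b = b * a \<Longrightarrow> selfadjoint (a * b)"
  and selfadjoint_star_mult: "selfadjoint (star c * c)"
  by (simp_all add: selfadjoint_def star_add star_diff star_scaleR star_mult star_star)

lemma selfadjoint_square: "selfadjoint a \<Longrightarrow> selfadjoint (a * a)"
  by (rule selfadjoint_mult) simp_all

lemma selfadjoint_sandwich: "selfadjoint a \<Longrightarrow> selfadjoint b \<Longrightarrow> selfadjoint (a * b * a)"
  by (simp add: selfadjoint_def star_mult mult.assoc)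

lemma selfadjoint_limit:
  assumes "f \<longlonglongrightarrow> x" and "\<And>n. selfadjoint (f n)"
  shows "selfadjoint x"
proof -
  have "(\<lambda>n. star (f n)) \<longlonglongrightarrow> star x" using assms(1) by (rule tendsto_star)
  then have "f \<longlonglongrightarrow> star x" using assms(2) by (simp add: selfadjoint_def)
  then have "star x = x" using assms(1) by (rule LIMSEQ_unique)
  then show ?thesis by (rule selfadjointI)
qed

lemma norm_selfadjoint_square: "selfadjoint a \<Longrightarrow> norm (a * a) = (norm a)\<^sup>2"
  using cstar_identity[of a] by (simp add: selfadjoint_def)

text \<open>The element \<open>z = x + i y\<close> has real part \<open>x\<close>, so
  \<open>norm x \<le> norm z\<close>, and commutation makes \<open>star z * z\<close> equal to
  \<open>x * x + y * y\<close>; the C*-identity does the rest. This stands in for monotonicity of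
  the norm on positive elements at a stage where no order is available.\<close>

lemma norm_le_norm_sum_squares:
  fixes x y :: "'a::unital_cstar_algebra"
  assumes "selfadjoint x" "selfadjoint y" "x * y = y * x"
  shows "(norm x)\<^sup>2 \<le> norm (x * x + y * y)"
proof -
  let ?z = "x + \<i> *\<^sub>C y"
  have sz: "star ?z = x - \<i> *\<^sub>C y"
    using assms by (simp add: star_add star_scaleC selfadjointD scaleC_minus_left)
  have "star ?z * ?z = x * x + y * y"
    by (simp add: sz algebra_simps scaleC_mult_left scaleC_mult_right assms(3) scaleC_scaleC
        scaleC_diff_right scaleC_minus_left scaleC_one)
  then have z: "(norm ?z)\<^sup>2 = norm (x * x + y * y)"
    using cstar_identity[of ?z] by simp
  have "2 *\<^sub>R x = ?z + star ?z" by (simp add: sz scaleR_2)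
  then have "2 * norm x \<le> norm ?z + norm (star ?z)"
    using norm_triangle_ineq[of ?z "star ?z"] by (metis abs_numeral norm_scaleR)
  then have "norm x \<le> norm ?z" by (simp add: norm_star)
  then show ?thesis using z power_mono[of "norm x" "norm ?z" 2] by simp
qed

subsection \<open>Invertible elements\<close>

definition ring_inv :: "'a::ring_1 \<Rightarrow> bool" where
  "ring_inv x \<longleftrightarrow> (\<exists>y. x * y = 1 \<and> y * x = 1)"

lemma not_in_spectrum_iff: "l \<notin> spectrum a \<longleftrightarrow> ring_inv (a - l *\<^sub>C 1)"
  by (simp add: spectrum_def ring_inv_def)

lemma ring_inv_mult: "ring_inv x \<Longrightarrow> ring_inv y \<Longrightarrow> ring_inv (x * y)"
proof -
  assume "ring_inv x" "ring_inv y"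
  then obtain u v where "x * u = 1" "u * x = 1" "y * v = 1" "v * y = 1" by (auto simp: ring_inv_def)
  then have "x * y * (v * u) = 1 \<and> v * u * (x * y) = 1"
    by (metis (no_types, lifting) mult.assoc mult.right_neutral)
  then show ?thesis by (auto simp: ring_inv_def)
qed

text \<open>With \<open>u\<close> the inverse of the product, \<open>y * u\<close> is a right
  inverse and \<open>u * y\<close> a left inverse of \<open>x\<close>, so the two coincide.\<close>

lemma ring_inv_commuting_factor:
  assumes "ring_inv (x * y)" "x * y = y * x"
  shows "ring_inv x"
proof -
  obtain u where u: "x * y * u = 1" "u * (x * y) = 1" using assms by (auto simp: ring_inv_def)
  have "x * (y * u) = 1" using u by (simp add: mult.assoc)
  moreover have l: "(u * y) * x = 1" using u assms by (simp add: mult.assoc)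
  moreover have "y * u = u * y" using calculation by (metis mult.assoc mult.left_neutral mult.right_neutral)
  ultimately show ?thesis by (auto simp: ring_inv_def)
qed

lemma ring_inv_scaleC:
  fixes x :: "'a::unital_cstar_algebra"
  assumes "ring_inv x" "c \<noteq> 0"
  shows "ring_inv (c *\<^sub>C x)"
proof -
  obtain y where "x * y = 1" "y * x = 1" using assms(1) by (auto simp: ring_inv_def)
  then have "(c *\<^sub>C x) * (inverse c *\<^sub>C y) = 1 \<and> (inverse c *\<^sub>C y) * (c *\<^sub>C x) = 1"
    using assms(2) by (simp add: scaleC_mult_left scaleC_mult_right scaleC_scaleC scaleC_one)
  then show ?thesis by (auto simp: ring_inv_def)
qed

lemma ring_inv_one_minus:
  fixes x :: "'a::unital_cstar_algebra"
  assumes "norm x < 1"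
  shows "ring_inv (1 - x)"
proof -
  have sm: "summable (\<lambda>n. x ^ n)"
    using assms by (rule complete_algebra_summable_geometric)
  let ?s = "\<Sum>n. x ^ n"
  have a: "(\<lambda>n. x * x ^ n) sums (?s - 1)"
    using summable_sums[OF sm] sums_Suc_iff[of "\<lambda>n. x ^ n" "?s - 1"] by simp
  have "(\<lambda>n. x * x ^ n) sums (x * ?s)" "(\<lambda>n. x ^ n * x) sums (?s * x)"
    using summable_sums[OF sm] by (intro sums_mult sums_mult2; simp)+
  then have "x * ?s = ?s - 1" "?s * x = ?s - 1"
    using a by (auto simp: power_commutes dest: sums_unique2)
  then have "(1 - x) * ?s = 1" "?s * (1 - x) = 1" by (simp_all add: algebra_simps)
  then show ?thesis by (auto simp: ring_inv_def)
qed

subsection \<open>Square roots of \<open>1 - x\<close>\<close>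

text \<open>The iterates \<open>y \<mapsto> (x + y\<^sup>2) / 2\<close> starting from \<open>0\<close> are dominated by the same real
  iteration with \<open>x = 1\<close>, which is increasing and bounded by \<open>1\<close>.\<close>

lemma sqrt_one_minus:
  fixes x :: "'a::unital_cstar_algebra"
  assumes sa: "selfadjoint x" and x1: "norm x \<le> 1"
  obtains s where "selfadjoint s" "s * s = 1 - x" "\<And>z. z * x = x * z \<Longrightarrow> z * s = s * z"
proof -
  define y where "y = rec_nat (0::'a) (\<lambda>_ v. (1/2) *\<^sub>R (x + v * v))"
  define r where "r = rec_nat (0::real) (\<lambda>_ v. (1 + v * v) / 2)"
  have y_rec: "y 0 = 0" "y (Suc n) = (1/2) *\<^sub>R (x + y n * y n)" for n by (simp_all add: y_def)
  have r_rec: "r 0 = 0" "r (Suc n) = (1 + r n * r n) / 2" for n by (simp_all add: r_def)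
  have r01: "0 \<le> r n \<and> r n \<le> 1" for n
    by (induction n) (auto simp: r_rec mult_le_one)
  have r_inc: "r n \<le> r (Suc n)" for n
  proof -
    have "0 \<le> (r n - 1) * (r n - 1)" by simp
    then show ?thesis by (simp add: r_rec algebra_simps)
  qed
  have y_sa: "selfadjoint (y n)" for n
    by (induction n) (simp_all add: y_rec selfadjoint_zero selfadjoint_add selfadjoint_scaleR selfadjoint_square sa)
  have y_comm: "z * y n = y n * z" if "z * x = x * z" for z n
  proof (induction n)
    case (Suc n)
    have "z * (y n * y n) = y n * y n * z" using Suc by (metis mult.assoc)
    then show ?case by (simp add: y_rec algebra_simps that)
  qed (simp add: y_rec)
  have y_le: "norm (y n) \<le> r n" for n
  proof (induction n)
    case (Suc n)
    have "norm (y n * y n) \<le> r n * r n"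
      using norm_mult_ineq[of "y n" "y n"] mult_mono[OF Suc Suc] r01[of n] by simp
    then show ?case using norm_triangle_ineq[of x "y n * y n"] x1 by (simp add: y_rec r_rec)
  qed (simp add: y_rec r_rec)
  have y_step: "norm (y (Suc n) - y n) \<le> r (Suc n) - r n" for n
  proof (induction n)
    case 0
    then show ?case using y_le[of 1] by (simp add: y_rec r_rec)
  next
    case (Suc n)
    \<comment> \<open>All iterates commute, so the difference of two squares factors; the real
      iteration obeys the same factored recursion with equality.\<close>
    have "y n * x = x * y n" using y_comm[of x n] by simp
    then have comm: "y n * y (Suc n) = y (Suc n) * y n" by (rule y_comm)
    have "y (Suc (Suc n)) - y (Suc n) = (1/2) *\<^sub>R (y (Suc n) * y (Suc n) - y n * y n)"
      unfolding y_rec(2)[of "Suc n"] by (subst (3) y_rec(2)) (simp add: algebra_simps)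
    also have "\<dots> = (1/2) *\<^sub>R ((y (Suc n) + y n) * (y (Suc n) - y n))"
      using comm by (simp add: algebra_simps)
    finally have eq: "y (Suc (Suc n)) - y (Suc n) = (1/2) *\<^sub>R ((y (Suc n) + y n) * (y (Suc n) - y n))" .
    have a: "norm (y (Suc n) + y n) \<le> r (Suc n) + r n"
      using norm_triangle_ineq[of "y (Suc n)" "y n"] y_le[of "Suc n"] y_le[of n] by linarith
    have "norm ((y (Suc n) + y n) * (y (Suc n) - y n)) \<le> (r (Suc n) + r n) * (r (Suc n) - r n)"
      using norm_mult_ineq[of "y (Suc n) + y n" "y (Suc n) - y n"] mult_mono[OF a Suc] r01[of n] r01[of "Suc n"]
      by (meson add_nonneg_nonneg norm_ge_zero order_trans)
    also have "\<dots> = 2 * (r (Suc (Suc n)) - r (Suc n))"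
      unfolding r_rec(2)[of "Suc n"] using r_rec(2)[of n] by (simp add: algebra_simps)
    finally show ?case by (simp add: eq)
  qed
  have y_dist: "norm (y (n + k) - y n) \<le> r (n + k) - r n" for n k
  proof (induction k)
    case (Suc k)
    then show ?case
      using norm_triangle_ineq[of "y (Suc (n + k)) - y (n + k)" "y (n + k) - y n"] y_step[of "n + k"] by simp
  qed simp
  have "Cauchy r"
    using r_inc r01 by (intro convergent_Cauchy Bseq_mono_convergent BseqI'[of r 1])
      (auto intro: incseq_SucI[THEN incseqD])
  then have "Cauchy y"
  proof -
    have "\<exists>M. \<forall>m\<ge>M. \<forall>n\<ge>M. norm (y m - y n) < e" if e: "e > 0" for e
    proof -
      obtain M where M: "\<And>m n. m \<ge> M \<Longrightarrow> n \<ge> M \<Longrightarrow> norm (r m - r n) < e"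
        using CauchyD[of r e] \<open>Cauchy r\<close> e by blast
      have "norm (y m - y n) < e" if "m \<ge> M" "n \<ge> m" for m n
        using y_dist[of m "n - m"] M[of n m] that by (simp add: norm_minus_commute)
      then show ?thesis by (metis nle_le norm_minus_commute)
    qed
    then show ?thesis by (intro CauchyI) auto
  qed
  then obtain Y where Y: "y \<longlonglongrightarrow> Y" by (auto simp: Cauchy_convergent_iff convergent_def)
  have "(\<lambda>n. y (Suc n)) \<longlonglongrightarrow> (1/2) *\<^sub>R (x + Y * Y)"
    unfolding y_rec by (intro tendsto_intros Y)
  \<comment> \<open>The fixed point equation \<open>2 Y = x + Y * Y\<close> says exactly that
    \<open>1 - Y\<close> squares to \<open>1 - x\<close>.\<close>
  then have Y_eq: "Y = (1/2) *\<^sub>R (x + Y * Y)"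
    using LIMSEQ_unique LIMSEQ_Suc[OF Y] by blast
  have "2 *\<^sub>R Y = x + Y * Y" by (subst Y_eq) simp
  then have sq: "(1 - Y) * (1 - Y) = 1 - x" by (simp add: algebra_simps scaleR_2)
  have Y_sa: "selfadjoint Y" using Y y_sa by (rule selfadjoint_limit)
  have Y_comm: "z * Y = Y * z" if "z * x = x * z" for z
  proof -
    have "(\<lambda>n. z * y n) \<longlonglongrightarrow> z * Y" by (rule tendsto_mult_left[OF Y])
    then have "(\<lambda>n. y n * z) \<longlonglongrightarrow> z * Y" by (simp only: y_comm[OF that])
    moreover have "(\<lambda>n. y n * z) \<longlonglongrightarrow> Y * z" by (rule tendsto_mult_right[OF Y])
    ultimately show ?thesis by (rule LIMSEQ_unique)
  qed
  show ?thesis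
  proof (rule that[OF _ sq])
    show "selfadjoint (1 - Y)" by (intro selfadjoint_diff selfadjoint_one Y_sa)
    show "z * (1 - Y) = (1 - Y) * z" if "z * x = x * z" for z
      using Y_comm[OF that] by (simp add: right_diff_distrib left_diff_distrib)
  qed
qed

text \<open>Write \<open>1 - b * b = s * s\<close> with \<open>s\<close> commuting with
  \<open>b\<close>. Then \<open>s * s + b * b = 1\<close> bounds \<open>norm s\<close>, hence
  \<open>norm (s * s)\<close>.\<close>

lemma norm_one_minus_square_le:
  fixes b :: "'a::unital_cstar_algebra"
  assumes "selfadjoint b" "norm b \<le> 1"
  shows "norm (1 - b * b) \<le> 1"
proof -
  have "norm (b * b) \<le> 1"
    using norm_selfadjoint_square[OF assms(1)] assms(2) by (simp add: power_le_one)
  then obtain s where s: "selfadjoint s" "s * s = 1 - b * b" "\<And>z. z * (b * b) = b * b * z \<Longrightarrow> z * s = s * z"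
    using sqrt_one_minus selfadjoint_square[OF assms(1)] by metis
  have "b * s = s * b" by (rule s(3)) (simp add: mult.assoc)
  then have "(norm s)\<^sup>2 \<le> norm (s * s + b * b)"
    using s(1) assms(1) by (intro norm_le_norm_sum_squares) auto
  then show ?thesis using s(2) norm_selfadjoint_square[OF s(1)] by simp
qed

text \<open>With \<open>N = (norm c)\<^sup>2\<close> the element is \<open>(1 + N)\<close> times
  \<open>1 - (N - c * c) / (1 + N)\<close>. The previous bound, scaled by \<open>N\<close>, gives
  \<open>norm (N - c * c) \<le> N\<close>, so the Neumann series applies.\<close>

lemma ring_inv_one_plus_square:
  fixes c :: "'a::unital_cstar_algebra"
  assumes "selfadjoint c"
  shows "ring_inv (1 + c * c)"
proof -
  define N where "N = (norm c)\<^sup>2"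
  have "norm (N *\<^sub>R 1 - c * c) \<le> N"
  proof (cases "c = 0")
    case False
    define d where "d = (1 / norm c) *\<^sub>R c"
    have "norm (1 - d * d) \<le> 1"
      using assms by (intro norm_one_minus_square_le) (auto simp: d_def selfadjoint_scaleR)
    moreover have "N *\<^sub>R 1 - c * c = N *\<^sub>R (1 - d * d)"
      using False by (simp add: d_def N_def scaleR_diff_right power2_eq_square)
    ultimately show ?thesis by (simp add: N_def mult_left_le)
  qed (simp add: N_def)
  moreover have N0: "0 \<le> N" by (simp add: N_def)
  ultimately have "norm ((1 / (1 + N)) *\<^sub>R (N *\<^sub>R 1 - c * c)) < 1"
    by simp
  then have "ring_inv (1 - (1 / (1 + N)) *\<^sub>R (N *\<^sub>R 1 - c * c))" by (rule ring_inv_one_minus)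
  then have "ring_inv (complex_of_real (1 + N) *\<^sub>C (1 - (1 / (1 + N)) *\<^sub>R (N *\<^sub>R 1 - c * c)))"
  proof (rule ring_inv_scaleC)
    show "complex_of_real (1 + N) \<noteq> 0" using N0 of_real_eq_0_iff by (metis add_nonneg_eq_0_iff zero_le_one zero_neq_one)
  qed
  moreover have "complex_of_real (1 + N) *\<^sub>C (1 - (1 / (1 + N)) *\<^sub>R (N *\<^sub>R 1 - c * c)) = 1 + c * c"
    unfolding scaleC_of_real using N0 by (simp add: scaleR_diff_right) (simp add: algebra_simps)
  ultimately show ?thesis by simp
qed

subsection \<open>The spectrum of a self-adjoint element\<close>

text \<open>An affine change of variable moves a nonreal \<open>l\<close> to \<open>\<i>\<close>,
  and \<open>c - \<i>\<close> is a commuting factor of the invertible element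
  \<open>1 + c * c\<close>.\<close>

lemma spectrum_selfadjoint_real:
  assumes "selfadjoint b" "l \<in> spectrum b"
  shows "l = complex_of_real (Re l)"
proof (rule ccontr)
  assume "l \<noteq> complex_of_real (Re l)"
  then have t: "Im l \<noteq> 0" by (simp add: complex_eq_iff)
  define c where "c = (1 / Im l) *\<^sub>R (b - Re l *\<^sub>R 1)"
  have "selfadjoint c"
    unfolding c_def by (intro selfadjoint_scaleR selfadjoint_diff assms selfadjoint_one)
  then have "ring_inv (1 + c * c)" by (rule ring_inv_one_plus_square)
  moreover have "(c - \<i> *\<^sub>C 1) * (c + \<i> *\<^sub>C 1) = 1 + c * c" "(c + \<i> *\<^sub>C 1) * (c - \<i> *\<^sub>C 1) = 1 + c * c"
    by (simp_all add: algebra_simps scaleC_mult_left scaleC_mult_right scaleC_scaleC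
        scaleC_diff_right scaleC_add_right scaleC_minus_left scaleC_one)
  ultimately have "ring_inv (c - \<i> *\<^sub>C 1)"
    by (metis ring_inv_commuting_factor)
  then have "ring_inv (complex_of_real (Im l) *\<^sub>C (c - \<i> *\<^sub>C 1))"
    using t by (intro ring_inv_scaleC) auto
  moreover have "complex_of_real (Im l) *\<^sub>C (c - \<i> *\<^sub>C 1) = b - l *\<^sub>C 1"
  proof -
    have "l *\<^sub>C (1::'a) = complex_of_real (Re l) *\<^sub>C 1 + (complex_of_real (Im l) * \<i>) *\<^sub>C 1"
      using complex_eq[of l] by (simp add: scaleC_add_left[symmetric] mult.commute)
    moreover have "complex_of_real (Im l) *\<^sub>C c = b - complex_of_real (Re l) *\<^sub>C 1"
      using t by (simp add: c_def scaleC_of_real)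
    ultimately show ?thesis by (simp add: scaleC_diff_right scaleC_scaleC)
  qed
  ultimately show False using assms(2) not_in_spectrum_iff by metis
qed

text \<open>An invertible \<open>1 - b * b\<close> should dominate a constant \<open>k > 0\<close>.
  The order is replaced by square roots: with \<open>d\<close> the inverse,
  \<open>k = 1 / norm d\<close>, \<open>s * s = 1 - b * b\<close> and
  \<open>w * w = 1 - k d\<close>, all commuting, one gets
  \<open>b * b + (s * w) * (s * w) = 1 - k\<close>, whence
  \<open>(norm b)\<^sup>2 \<le> 1 - k\<close>.\<close>

lemma norm_less_one_if_ring_inv:
  fixes b :: "'a::unital_cstar_algebra"
  assumes b: "selfadjoint b" "norm b \<le> 1" and inv: "ring_inv (1 - b * b)"
  shows "norm b < 1"
proof -
  have "norm (b * b) \<le> 1"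
    using norm_selfadjoint_square[OF b(1)] b(2) by (simp add: power_le_one)
  then obtain s where s: "selfadjoint s" "s * s = 1 - b * b" "\<And>z. z * (b * b) = b * b * z \<Longrightarrow> z * s = s * z"
    using sqrt_one_minus selfadjoint_square[OF b(1)] by metis
  obtain d where d: "(1 - b * b) * d = 1" "d * (1 - b * b) = 1" using inv by (auto simp: ring_inv_def)
  have d_comm: "z * d = d * z" if "z * (b * b) = b * b * z" for z
  proof -
    have "(1 - b * b) * z = z * (1 - b * b)" using that by (simp add: algebra_simps)
    then have "(d * (1 - b * b)) * (z * d) = (d * z) * ((1 - b * b) * d)" by (metis mult.assoc)
    then show ?thesis using d by simp
  qed
  have sd: "selfadjoint d"
  proof (rule selfadjointI)
    have "star d * (1 - b * b) = 1" using arg_cong[OF d(1), of star]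
      by (simp add: star_mult star_diff star_one selfadjointD[OF b(1)])
    then show "star d = d" using d by (metis mult.assoc mult.left_neutral mult.right_neutral)
  qed
  have d0: "norm d > 0" using d by fastforce
  define k where "k = 1 / norm d"
  have k0: "k > 0" using d0 by (simp add: k_def)
  have kd: "norm (k *\<^sub>R d) \<le> 1" using d0 by (simp add: k_def)
  obtain w where w: "selfadjoint w" "w * w = 1 - k *\<^sub>R d" "\<And>z. z * (k *\<^sub>R d) = k *\<^sub>R d * z \<Longrightarrow> z * w = w * z"
    using sqrt_one_minus[OF selfadjoint_scaleR[OF sd] kd] by blast
  have bs: "b * s = s * b" by (rule s(3)) (simp add: mult.assoc)
  have sbb: "s * (b * b) = b * b * s" using bs by (metis mult.assoc)
  have sw: "s * w = w * s" using d_comm[OF sbb] by (intro w(3)) simp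
  have bw: "b * w = w * b" using d_comm[of b] by (intro w(3)) (simp add: mult.assoc)
  have "(s * w) * (s * w) = (s * s) * (w * w)" using sw by (metis mult.assoc)
  also have "\<dots> = 1 - b * b - k *\<^sub>R 1"
    unfolding s w by (simp add: right_diff_distrib d)
  finally have "b * b + (s * w) * (s * w) = (1 - k) *\<^sub>R 1" by (simp add: scaleR_diff_left)
  moreover have "(norm b)\<^sup>2 \<le> norm (b * b + (s * w) * (s * w))"
  proof (rule norm_le_norm_sum_squares)
    show "b * (s * w) = s * w * b" using bs bw by (metis mult.assoc)
    show "selfadjoint (s * w)" using s(1) w(1) sw by (rule selfadjoint_mult)
  qed (rule b(1))
  ultimately have le: "(norm b)\<^sup>2 \<le> \<bar>1 - k\<bar>" by simp
  \<comment> \<open>This yields \<open>k \<le> 1\<close>, so the absolute value of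
    \<open>1 - k\<close> in the bound is \<open>1 - k\<close> itself and lies below 1.\<close>
  have "1 \<le> norm (1 - b * b) * norm d" using norm_mult_ineq[of "1 - b * b" d] d by simp
  also have "\<dots> \<le> 1 * norm d"
    using norm_one_minus_square_le[OF b] by (intro mult_right_mono) auto
  finally have "k \<le> 1" using d0 by (simp add: k_def)
  then have "(norm b)\<^sup>2 < 1" using le k0 by simp
  then show ?thesis by (simp add: abs_square_less_1)
qed

text \<open>After normalization to \<open>norm c = 1\<close>, the element \<open>1 - c * c\<close>
  is not invertible, and it factors into \<open>c - 1\<close> and \<open>c + 1\<close> up to sign.
  So \<open>norm b\<close> or \<open>- norm b\<close> is a spectral value; in particular the
  spectrum is nonempty.\<close>

lemma spectral_radius_selfadjoint:
  assumes sa: "selfadjoint b"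
  obtains l where "l \<in> spectrum b" "cmod l = norm b"
proof (cases "b = 0")
  case True
  have "\<not> ring_inv (b - 0 *\<^sub>C 1)" using True by (simp add: ring_inv_def scaleC_zero_left)
  then have "0 \<in> spectrum b" using not_in_spectrum_iff by blast
  then show ?thesis using that True by simp
next
  case False
  define c where "c = (1 / norm b) *\<^sub>R b"
  have c: "selfadjoint c" "norm c = 1" using False sa by (auto simp: c_def selfadjoint_scaleR)
  have "\<not> ring_inv (1 - c * c)" using norm_less_one_if_ring_inv[OF c(1)] c(2) by auto
  moreover have "1 - c * c = (c - 1) * ((-1) *\<^sub>C (c + 1))"
    by (simp add: algebra_simps scaleC_mult_left scaleC_mult_right scaleC_minus_left scaleC_one)
  ultimately have "\<not> ring_inv (c - 1) \<or> \<not> ring_inv (c + 1)"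
    using ring_inv_mult ring_inv_scaleC by (metis neg_equal_0_iff_equal zero_neq_one)
  moreover have "c - 1 = complex_of_real (1 / norm b) *\<^sub>C (b - complex_of_real (norm b) *\<^sub>C 1)"
      "c + 1 = complex_of_real (1 / norm b) *\<^sub>C (b - complex_of_real (- norm b) *\<^sub>C 1)"
    unfolding scaleC_of_real using False by (simp_all add: c_def scaleR_diff_right scaleR_add_right)
  ultimately have "\<not> ring_inv (b - complex_of_real (norm b) *\<^sub>C 1) \<or> \<not> ring_inv (b - complex_of_real (- norm b) *\<^sub>C 1)"
    using ring_inv_scaleC[of _ "complex_of_real (1 / norm b)"] False by fastforce
  then show ?thesis using that[of "complex_of_real (norm b)"] that[of "complex_of_real (- norm b)"]
    by (auto simp: not_in_spectrum_iff[symmetric] simp del: of_real_minus)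
qed

lemma spectrum_bounded:
  fixes a :: "'a::unital_cstar_algebra"
  assumes "l \<in> spectrum a"
  shows "cmod l \<le> norm a"
proof (rule ccontr)
  assume "\<not> cmod l \<le> norm a"
  then have l: "cmod l > norm a" "l \<noteq> 0" using norm_ge_zero[of a] by auto
  then have "norm (inverse l *\<^sub>C a) < 1"
    by (simp add: norm_scaleC norm_inverse norm_divide field_simps)
  then have "ring_inv (1 - inverse l *\<^sub>C a)" by (rule ring_inv_one_minus)
  then have "ring_inv ((- l) *\<^sub>C (1 - inverse l *\<^sub>C a))" using l by (intro ring_inv_scaleC) auto
  moreover have "(- l) *\<^sub>C (1 - inverse l *\<^sub>C a) = a - l *\<^sub>C 1"
    using l by (simp add: scaleC_diff_right scaleC_minus_left scaleC_scaleC scaleC_one)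
  ultimately show False using assms not_in_spectrum_iff by metis
qed

lemma spectrum_closed: "closed (spectrum (a::'a::unital_cstar_algebra))"
proof -
  have "open (- spectrum a)"
    unfolding open_dist
  proof
    fix l assume "l \<in> - spectrum a"
    then have "ring_inv (a - l *\<^sub>C 1)" using not_in_spectrum_iff by blast
    then obtain d where d: "(a - l *\<^sub>C 1) * d = 1" "d * (a - l *\<^sub>C 1) = 1" by (auto simp: ring_inv_def)
    have d0: "norm d > 0" using d by fastforce
    show "\<exists>e>0. \<forall>m. dist m l < e \<longrightarrow> m \<in> - spectrum a"
    proof (intro exI[of _ "1 / norm d"] conjI allI impI)
      fix m assume "dist m l < 1 / norm d"
      then have "norm ((m - l) *\<^sub>C d) < 1" using d0 by (simp add: norm_scaleC dist_norm field_simps)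
      then have "ring_inv (1 - (m - l) *\<^sub>C d)" by (rule ring_inv_one_minus)
      moreover have "ring_inv (a - l *\<^sub>C 1)" using d by (auto simp: ring_inv_def)
      ultimately have "ring_inv ((a - l *\<^sub>C 1) * (1 - (m - l) *\<^sub>C d))" by (simp add: ring_inv_mult)
      moreover have "(a - l *\<^sub>C 1) * (1 - (m - l) *\<^sub>C d) = a - m *\<^sub>C 1"
        using d by (simp add: right_diff_distrib scaleC_mult_right scaleC_diff_left)
      ultimately show "m \<in> - spectrum a" by (simp add: not_in_spectrum_iff)
    qed (use d0 in auto)
  qed
  then show ?thesis by (simp add: closed_def)
qed

lemma spectrum_compact: "compact (spectrum (a::'a::unital_cstar_algebra))"
proof -
  have "bounded (spectrum a)" unfolding bounded_iff using spectrum_bounded by blast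
  then show ?thesis by (simp add: compact_eq_bounded_closed spectrum_closed)
qed

subsection \<open>Polynomial functional calculus\<close>

definition peval :: "complex poly \<Rightarrow> 'a \<Rightarrow> 'a::unital_cstar_algebra" where
  "peval p a = fold_coeffs (\<lambda>c b. c *\<^sub>C 1 + a * b) p 0"

lemma peval_0: "peval 0 a = 0"
  by (simp add: peval_def)

lemma peval_pCons: "peval (pCons c p) a = c *\<^sub>C 1 + a * peval p a"
  by (cases "p = 0 \<and> c = 0") (auto simp: peval_def scaleC_zero_left)

lemma peval_add: "peval (p + q) a = peval p a + peval q a"
  by (induction p q rule: poly_induct2) (simp_all add: peval_0 peval_pCons scaleC_add_left algebra_simps)

lemma peval_smult: "peval (smult c p) a = c *\<^sub>C peval p a"
  by (induction p) (simp_all add: peval_0 peval_pCons scaleC_zero_right scaleC_add_right scaleC_scaleC scaleC_mult_right)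

lemma peval_minus: "peval (- p) a = - peval p a"
  using peval_smult[of "- 1" p a] by (simp add: scaleC_minus_left scaleC_one)

lemma peval_diff: "peval (p - q) a = peval p a - peval q a"
  using peval_add[of p "- q" a] by (simp add: peval_minus)

lemma peval_mult: "peval (p * q) a = peval p a * peval q a"
proof (induction p)
  case (pCons c p)
  then show ?case
    by (simp add: peval_add peval_smult peval_pCons scaleC_zero_left distrib_right scaleC_mult_left mult.assoc)
qed (simp add: peval_0)

lemma peval_const: "peval [:c:] a = c *\<^sub>C 1"
  by (simp add: peval_pCons peval_0)

lemma peval_linear: "peval [:- z, 1:] a = a - z *\<^sub>C 1"
  by (simp add: peval_pCons peval_0 scaleC_minus_left scaleC_one)

lemma peval_id: "peval [:0, 1:] a = a"
  by (simp add: peval_pCons peval_0 scaleC_zero_left scaleC_one)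

lemma peval_comm:
  assumes "z * a = a * z"
  shows "z * peval p a = peval p a * z"
proof (induction p)
  case (pCons c p)
  have "z * (a * peval p a) = a * peval p a * z" using pCons(2) assms by (metis mult.assoc)
  then show ?case by (simp add: peval_pCons distrib_left distrib_right scaleC_mult_left scaleC_mult_right)
qed (simp add: peval_0)

lemma star_peval:
  assumes "selfadjoint a"
  shows "star (peval p a) = peval (map_poly cnj p) a"
proof (induction p)
  case (pCons c p)
  have "star (a * peval p a) = a * peval (map_poly cnj p) a"
    using pCons(2) peval_comm[of a a "map_poly cnj p"] selfadjointD[OF assms] by (simp add: star_mult)
  then show ?case by (simp add: peval_pCons map_poly_pCons star_add star_scaleC star_one)
qed (simp add: peval_0 star_zero)

lemma poly_map_poly_cnj: "poly (map_poly cnj p) (cnj z) = cnj (poly p z)"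
  by (induction p) (simp_all add: map_poly_pCons)

text \<open>Split \<open>q\<close> into linear factors over the complex numbers: if every factor
  \<open>a - z\<close> belonging to a root \<open>z\<close> were invertible, so would be
  \<open>q(a)\<close>. This is the half of the spectral mapping theorem that bounds the spectrum of
  \<open>q(a)\<close>.\<close>

lemma peval_not_ring_inv:
  assumes "q \<noteq> 0" "\<not> ring_inv (peval q a)"
  shows "\<exists>z \<in> spectrum a. poly q z = 0"
  using assms
proof (induction "degree q" arbitrary: q)
  case 0
  then obtain c where c: "q = [:c:]" by (metis degree_eq_zeroE)
  then have "ring_inv (peval q a)"
    using 0 ring_inv_scaleC[of "1::'a" c] by (auto simp: peval_const ring_inv_def)
  then show ?case using 0 by simp
next
  case (Suc n)
  obtain z where z: "poly q z = 0"
    using fundamental_theorem_of_algebra[of q] constant_degree[of q] Suc(2) by auto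
  then obtain r where r: "q = [:- z, 1:] * r" by (metis dvdE poly_eq_0_iff_dvd)
  have "r \<noteq> 0" using Suc r by auto
  then have "degree r = n" using Suc(2) r degree_mult_eq[of "[:- z, 1:]" r] by (simp del: mult_pCons_left)
  show ?case
  proof (cases "z \<in> spectrum a")
    case False
    then have "\<not> ring_inv (peval r a)"
      using Suc(4) ring_inv_mult unfolding r peval_mult peval_linear not_in_spectrum_iff by blast
    then show ?thesis using Suc(1)[of r] \<open>r \<noteq> 0\<close> \<open>degree r = n\<close> r by auto
  qed (use z in blast)
qed

lemma spectrum_peval:
  assumes "selfadjoint a" "m \<in> spectrum (peval p a)"
  shows "\<exists>z \<in> spectrum a. m = poly p z"
proof (cases "p = [:m:]")
  case True
  \<comment> \<open>The difference \<open>p - [:m:]\<close> vanishes here, so any spectral point of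
    \<open>a\<close> serves; only nonemptiness of the spectrum is at stake.\<close>
  then show ?thesis using spectral_radius_selfadjoint[OF assms(1)] by auto
next
  case False
  have "peval p a - m *\<^sub>C 1 = peval (p - [:m:]) a" by (simp add: peval_diff peval_const)
  then have "\<exists>z \<in> spectrum a. poly (p - [:m:]) z = 0"
    using assms(2) False not_in_spectrum_iff[of m "peval p a"] by (intro peval_not_ring_inv) auto
  then show ?thesis by auto
qed

text \<open>By the C*-identity \<open>(norm b)\<^sup>2\<close> is the norm of the self-adjoint
  \<open>star b * b\<close>, hence the modulus of one of its spectral values, and spectral mapping
  identifies that modulus as \<open>(cmod (poly p z))\<^sup>2\<close> for some \<open>z\<close> in
  the spectrum of \<open>a\<close>. This estimate extends the polynomial calculus to continuous
  functions.\<close>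

lemma norm_peval_le:
  assumes sa: "selfadjoint a" and le: "\<And>z. z \<in> spectrum a \<Longrightarrow> cmod (poly p z) \<le> K"
  shows "norm (peval p a) \<le> K"
proof -
  let ?b = "peval p a" and ?q = "map_poly cnj p * p"
  have "star ?b * ?b = peval ?q a" by (simp add: star_peval[OF sa] peval_mult)
  moreover obtain l where l: "l \<in> spectrum (star ?b * ?b)" "cmod l = norm (star ?b * ?b)"
    using spectral_radius_selfadjoint[OF selfadjoint_star_mult] by blast
  ultimately obtain z where z: "z \<in> spectrum a" "l = poly ?q z"
    using spectrum_peval[OF sa] by metis
  have "cnj z = z" using spectrum_selfadjoint_real[OF sa z(1)] by (metis complex_cnj_complex_of_real)
  then have "poly (map_poly cnj p) z = cnj (poly p z)" using poly_map_poly_cnj[of p z] by simp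
  then have "cmod l = (cmod (poly p z))\<^sup>2" using z by (simp add: norm_mult power2_eq_square)
  then have "(norm ?b)\<^sup>2 = (cmod (poly p z))\<^sup>2" using l by (simp add: cstar_identity)
  then show ?thesis using le[OF z(1)] by simp
qed

subsection \<open>Continuous functional calculus\<close>

lemma real_poly_approximation:
  fixes f :: "real \<Rightarrow> real"
  assumes "compact S" "continuous_on S f" "0 < e"
  obtains p :: "complex poly" where "\<And>x. x \<in> S \<Longrightarrow> cmod (complex_of_real (f x) - poly p (complex_of_real x)) < e"
proof -
  obtain g where g: "real_polynomial_function g" "\<And>x. x \<in> S \<Longrightarrow> \<bar>f x - g x\<bar> < e"
    using Stone_Weierstrass_real_polynomial_function[OF assms] by blast
  then obtain c n where c: "g = (\<lambda>x. \<Sum>i\<le>n. c i * x ^ i)" using real_polynomial_function_iff_sum by blast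
  define p where "p = (\<Sum>i\<le>n. monom (complex_of_real (c i)) i)"
  have "poly p (complex_of_real x) = complex_of_real (g x)" for x
    by (simp add: p_def c poly_sum poly_monom)
  then have "cmod (complex_of_real (f x) - poly p (complex_of_real x)) = \<bar>f x - g x\<bar>" for x
    by (metis norm_of_real of_real_diff)
  then show ?thesis using g(2) by (intro that[of p]) simp
qed

lemma poly_approximation_on_spectrum:
  assumes sa: "selfadjoint (a::'a::unital_cstar_algebra)" and f: "continuous_on (spectrum a) f" and e: "0 < e"
  obtains p where "\<And>z. z \<in> spectrum a \<Longrightarrow> cmod (f z - poly p z) < e"
proof -
  define S where "S = Re ` spectrum a"
  have S: "compact S" unfolding S_def
    by (intro compact_continuous_image spectrum_compact continuous_intros)
  have z: "complex_of_real (Re z) = z" if "z \<in> spectrum a" for z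
    using spectrum_selfadjoint_real[OF sa that] by simp
  have "complex_of_real ` S \<subseteq> spectrum a" using z by (auto simp: S_def)
  then have "continuous_on S (\<lambda>x. f (complex_of_real x))"
    by (intro continuous_on_compose2[OF f] continuous_intros)
  then have "continuous_on S (\<lambda>x. Re (f (complex_of_real x)))" "continuous_on S (\<lambda>x. Im (f (complex_of_real x)))"
    by (intro continuous_intros; simp)+
  then obtain p q where
    p: "\<And>x. x \<in> S \<Longrightarrow> cmod (complex_of_real (Re (f (complex_of_real x))) - poly p (complex_of_real x)) < e / 2" and
    q: "\<And>x. x \<in> S \<Longrightarrow> cmod (complex_of_real (Im (f (complex_of_real x))) - poly q (complex_of_real x)) < e / 2"
    using real_poly_approximation[OF S] e by (metis half_gt_zero)
  show ?thesis
  proof (rule that[of "p + smult \<i> q"])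
    fix w assume w: "w \<in> spectrum a"
    then have "Re w \<in> S" by (simp add: S_def)
    then have le: "cmod (complex_of_real (Re (f w)) - poly p w) < e / 2" "cmod (complex_of_real (Im (f w)) - poly q w) < e / 2"
      using p[of "Re w"] q[of "Re w"] z[OF w] by auto
    have "f w - (poly p w + \<i> * poly q w)
        = (complex_of_real (Re (f w)) - poly p w) + \<i> * (complex_of_real (Im (f w)) - poly q w)"
      by (subst complex_eq[of "f w"]) (simp add: algebra_simps)
    then have "cmod (f w - (poly p w + \<i> * poly q w))
        \<le> cmod (complex_of_real (Re (f w)) - poly p w) + cmod (complex_of_real (Im (f w)) - poly q w)"
      using norm_triangle_ineq[of "complex_of_real (Re (f w)) - poly p w" "\<i> * (complex_of_real (Im (f w)) - poly q w)"]
      by (simp only: norm_mult) simp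
    then show "cmod (f w - poly (p + smult \<i> q) w) < e" using le by simp
  qed
qed

text \<open>The calculus is first encoded as a relation between \<open>f\<close> and
  \<open>b\<close>: identities are obtained by combining approximating sequences, and become
  equations through uniqueness of the limit.\<close>

definition poly_limit :: "'a::unital_cstar_algebra \<Rightarrow> (complex \<Rightarrow> complex) \<Rightarrow> 'a \<Rightarrow> bool" where
  "poly_limit a f b \<longleftrightarrow> (\<exists>p. uniform_limit (spectrum a) (\<lambda>n. poly (p n)) f sequentially \<and>
     (\<lambda>n. peval (p n) a) \<longlonglongrightarrow> b)"

lemma poly_limitI:
  assumes "uniform_limit (spectrum a) (\<lambda>n. poly (p n)) f sequentially" "(\<lambda>n. peval (p n) a) \<longlonglongrightarrow> b"
  shows "poly_limit a f b"
  using assms by (auto simp: poly_limit_def)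

text \<open>The norm bound for polynomials passes to the limit. The case \<open>K = 0\<close> makes
  the relation single-valued.\<close>

lemma poly_limit_norm_diff_le:
  assumes sa: "selfadjoint a" and "poly_limit a f b" "poly_limit a g c"
    and le: "\<And>z. z \<in> spectrum a \<Longrightarrow> cmod (f z - g z) \<le> K"
  shows "norm (b - c) \<le> K"
proof -
  obtain p q where p: "uniform_limit (spectrum a) (\<lambda>n. poly (p n)) f sequentially" "(\<lambda>n. peval (p n) a) \<longlonglongrightarrow> b"
    and q: "uniform_limit (spectrum a) (\<lambda>n. poly (q n)) g sequentially" "(\<lambda>n. peval (q n) a) \<longlonglongrightarrow> c"
    using assms by (auto simp: poly_limit_def)
  have "norm (b - c) \<le> K + e" if "e > 0" for e
  proof -
    have "uniform_limit (spectrum a) (\<lambda>n z. poly (p n) z - poly (q n) z) (\<lambda>z. f z - g z) sequentially"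
      by (intro uniform_limit_minus p q)
    then have "eventually (\<lambda>n. \<forall>z\<in>spectrum a. dist (poly (p n) z - poly (q n) z) (f z - g z) < e) sequentially"
      using that by (simp add: uniform_limit_iff)
    then have "eventually (\<lambda>n. norm (peval (p n) a - peval (q n) a) \<le> K + e) sequentially"
    proof eventually_elim
      case (elim n)
      have "cmod (poly (p n - q n) z) \<le> K + e" if "z \<in> spectrum a" for z
        using norm_triangle_sub[of "poly (p n) z - poly (q n) z" "f z - g z"] elim le[OF that] that
        by (fastforce simp: dist_norm)
      then show ?case using norm_peval_le[OF sa] by (metis peval_diff)
    qed
    moreover have "(\<lambda>n. norm (peval (p n) a - peval (q n) a)) \<longlonglongrightarrow> norm (b - c)"
      by (intro tendsto_intros p q)
    ultimately show ?thesis by (intro tendsto_upperbound) auto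
  qed
  then show ?thesis by (rule field_le_epsilon)
qed

lemma poly_limit_unique:
  assumes "selfadjoint a" "poly_limit a f b" "poly_limit a g c" "\<And>z. z \<in> spectrum a \<Longrightarrow> f z = g z"
  shows "b = c"
  using poly_limit_norm_diff_le[OF assms(1-3), of 0] assms(4) by simp

lemma poly_limit_poly: "poly_limit a (poly p) (peval p a)"
  unfolding poly_limit_def by (rule exI[of _ "\<lambda>_. p"]) (simp add: uniform_limit_const)

lemma poly_limit_exists:
  assumes sa: "selfadjoint a" and f: "continuous_on (spectrum a) f"
  shows "\<exists>b. poly_limit a f b"
proof -
  have "\<exists>p. \<forall>z\<in>spectrum a. cmod (f z - poly p z) < inverse (Suc n)" for n
    using poly_approximation_on_spectrum[OF assms, of "inverse (Suc n)"] by (metis inverse_positive_iff_positive of_nat_0_less_iff zero_less_Suc)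
  then obtain p where p: "\<And>n z. z \<in> spectrum a \<Longrightarrow> cmod (f z - poly (p n) z) < inverse (Suc n)" by metis
  have ul: "uniform_limit (spectrum a) (\<lambda>n. poly (p n)) f sequentially"
    unfolding uniform_limit_iff
  proof (intro allI impI)
    fix e :: real assume "e > 0"
    then obtain N where N: "inverse (Suc N) < e" using reals_Archimedean by blast
    show "\<forall>\<^sub>F n in sequentially. \<forall>x\<in>spectrum a. dist (poly (p n) x) (f x) < e"
      using eventually_ge_at_top[of N]
    proof eventually_elim
      case (elim n)
      have "inverse (real (Suc n)) \<le> inverse (real (Suc N))" using elim by (simp add: field_simps)
      then have "cmod (f z - poly (p n) z) < e" if "z \<in> spectrum a" for z
        using p[OF that, of n] N by linarith
      then show ?case by (simp add: dist_norm norm_minus_commute)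
    qed
  qed
  have "Cauchy (\<lambda>n. peval (p n) a)"
  proof (rule metric_CauchyI)
    fix e :: real assume "e > 0"
    then obtain N where N: "\<And>n z. n \<ge> N \<Longrightarrow> z \<in> spectrum a \<Longrightarrow> dist (poly (p n) z) (f z) < e / 3"
      using ul unfolding uniform_limit_iff eventually_sequentially by (metis divide_pos_pos zero_less_numeral)
    have "dist (peval (p m) a) (peval (p n) a) < e" if "m \<ge> N" "n \<ge> N" for m n
    proof -
      have "cmod (poly (p m - p n) z) \<le> 2 * (e / 3)" if "z \<in> spectrum a" for z
        using dist_triangle2[of "poly (p m) z" "poly (p n) z" "f z"] N[OF \<open>m \<ge> N\<close> that] N[OF \<open>n \<ge> N\<close> that]
        by (simp add: dist_norm)
      then have "norm (peval (p m - p n) a) \<le> 2 * (e / 3)" by (rule norm_peval_le[OF sa])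
      then show ?thesis using \<open>e > 0\<close> by (simp add: dist_norm peval_diff)
    qed
    then show "\<exists>M. \<forall>m\<ge>M. \<forall>n\<ge>M. dist (peval (p m) a) (peval (p n) a) < e" by blast
  qed
  then show ?thesis using ul by (auto simp: poly_limit_def Cauchy_convergent_iff convergent_def)
qed

lemma continuous_bounded_on_spectrum:
  assumes "continuous_on (spectrum a) f"
  shows "bounded (f ` spectrum (a::'a::unital_cstar_algebra))"
  by (intro compact_imp_bounded compact_continuous_image spectrum_compact assms)

lemma poly_limit_add:
  assumes "poly_limit a f b" "poly_limit a g c"
  shows "poly_limit a (\<lambda>z. f z + g z) (b + c)"
proof -
  obtain p q where p: "uniform_limit (spectrum a) (\<lambda>n. poly (p n)) f sequentially" "(\<lambda>n. peval (p n) a) \<longlonglongrightarrow> b"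
    and q: "uniform_limit (spectrum a) (\<lambda>n. poly (q n)) g sequentially" "(\<lambda>n. peval (q n) a) \<longlonglongrightarrow> c"
    using assms by (auto simp: poly_limit_def)
  have "uniform_limit (spectrum a) (\<lambda>n. poly (p n + q n)) (\<lambda>z. f z + g z) sequentially"
    using uniform_limit_add[OF p(1) q(1)] by (simp add: poly_add[abs_def])
  moreover have "(\<lambda>n. peval (p n + q n) a) \<longlonglongrightarrow> b + c"
    unfolding peval_add by (intro tendsto_intros p q)
  ultimately show ?thesis by (rule poly_limitI)
qed

lemma poly_limit_mult:
  assumes "poly_limit a f b" "poly_limit a g c" and fg: "continuous_on (spectrum a) f" "continuous_on (spectrum a) g"
  shows "poly_limit a (\<lambda>z. f z * g z) (b * c)"
proof -
  obtain p q where p: "uniform_limit (spectrum a) (\<lambda>n. poly (p n)) f sequentially" "(\<lambda>n. peval (p n) a) \<longlonglongrightarrow> b"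
    and q: "uniform_limit (spectrum a) (\<lambda>n. poly (q n)) g sequentially" "(\<lambda>n. peval (q n) a) \<longlonglongrightarrow> c"
    using assms by (auto simp: poly_limit_def)
  have "uniform_limit (spectrum a) (\<lambda>n z. poly (p n) z * poly (q n) z) (\<lambda>z. f z * g z) sequentially"
    using uniform_lim_mult[OF p(1) q(1)] continuous_bounded_on_spectrum fg by blast
  then have "uniform_limit (spectrum a) (\<lambda>n. poly (p n * q n)) (\<lambda>z. f z * g z) sequentially"
    by (simp add: poly_mult[abs_def])
  moreover have "(\<lambda>n. peval (p n * q n) a) \<longlonglongrightarrow> b * c"
    unfolding peval_mult by (intro tendsto_intros p q)
  ultimately show ?thesis by (rule poly_limitI)
qed

lemma poly_limit_star:
  assumes sa: "selfadjoint a" and "poly_limit a f b"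
  shows "poly_limit a (\<lambda>z. cnj (f z)) (star b)"
proof -
  obtain p where p: "uniform_limit (spectrum a) (\<lambda>n. poly (p n)) f sequentially" "(\<lambda>n. peval (p n) a) \<longlonglongrightarrow> b"
    using assms by (auto simp: poly_limit_def)
  have real: "cnj z = z" if "z \<in> spectrum a" for z
    using spectrum_selfadjoint_real[OF sa that] by (metis complex_cnj_complex_of_real)
  have "dist (poly (map_poly cnj r) z) (cnj (f z)) = dist (poly r z) (f z)" if "z \<in> spectrum a" for r z
    using poly_map_poly_cnj[of r z] real[OF that] by (metis complex_cnj_diff complex_mod_cnj dist_norm)
  then have "uniform_limit (spectrum a) (\<lambda>n. poly (map_poly cnj (p n))) (\<lambda>z. cnj (f z)) sequentially"
    using p(1) unfolding uniform_limit_iff by simp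
  moreover have "(\<lambda>n. peval (map_poly cnj (p n)) a) \<longlonglongrightarrow> star b"
    unfolding star_peval[OF sa, symmetric] by (intro tendsto_star p)
  ultimately show ?thesis by (rule poly_limitI)
qed

lemma functional_calculus_exists:
  assumes sa: "selfadjoint a"
  shows "\<exists>\<Psi>. functional_calculus a \<Psi>"
proof -
  define \<Psi> where "\<Psi> f = (SOME b. poly_limit a f b)" for f
  have lim: "poly_limit a f (\<Psi> f)" if "continuous_on (spectrum a) f" for f
    unfolding \<Psi>_def using poly_limit_exists[OF sa that] by (rule someI_ex)
  have eq: "\<Psi> f = b" if "continuous_on (spectrum a) f" "poly_limit a f b" for f b
    using poly_limit_unique[OF sa lim that(2)] that(1) by simp
  have poly: "\<Psi> (poly p) = peval p a" for p
    by (intro eq poly_limit_poly) (auto intro!: continuous_intros)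
  have cont: "continuous_on (spectrum a) (\<lambda>z. cnj (f z))" if "continuous_on (spectrum a) f" for f :: "complex \<Rightarrow> complex"
    using that by (intro continuous_intros)
  have "functional_calculus a \<Psi>"
    unfolding functional_calculus_def
  proof (intro conjI allI impI)
    show "\<Psi> (\<lambda>z. 1) = 1" using poly[of "[:1:]"] by (simp add: peval_const scaleC_one poly_pCons[abs_def])
    show "\<Psi> (\<lambda>z. z) = a" using poly[of "[:0, 1:]"] by (simp add: peval_id poly_pCons[abs_def])
    fix f :: "complex \<Rightarrow> complex" assume f: "continuous_on (spectrum a) f"
    show "\<Psi> (\<lambda>z. c * f z) = c *\<^sub>C \<Psi> f" for c
      using poly_limit_mult[OF poly_limit_poly[of a "[:c:]"] lim[OF f]] f
      by (intro eq) (auto simp: peval_const scaleC_mult_left intro!: continuous_intros)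
    show "\<Psi> (\<lambda>z. cnj (f z)) = star (\<Psi> f)"
      using poly_limit_star[OF sa lim[OF f]] cont[OF f] by (intro eq)
    fix g :: "complex \<Rightarrow> complex" assume g: "continuous_on (spectrum a) g"
    show "\<Psi> (\<lambda>z. f z + g z) = \<Psi> f + \<Psi> g"
      by (intro eq poly_limit_add lim f g continuous_intros)
    show "\<Psi> (\<lambda>z. f z * g z) = \<Psi> f * \<Psi> g"
      by (intro eq poly_limit_mult lim f g continuous_intros)
    show "\<Psi> f = \<Psi> g" if "\<forall>z\<in>spectrum a. f z = g z"
      using poly_limit_unique[OF sa lim[OF f] lim[OF g]] that by blast
  qed
  then show ?thesis by blast
qed

lemma
  assumes fc: "functional_calculus a \<Psi>"
  shows functional_calculus_one: "\<Psi> (\<lambda>z. 1) = 1"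
    and functional_calculus_id: "\<Psi> (\<lambda>z. z) = a"
    and functional_calculus_scale: "continuous_on (spectrum a) f \<Longrightarrow> \<Psi> (\<lambda>z. c * f z) = c *\<^sub>C \<Psi> f"
    and functional_calculus_star: "continuous_on (spectrum a) f \<Longrightarrow> \<Psi> (\<lambda>z. cnj (f z)) = star (\<Psi> f)"
    and functional_calculus_add: "continuous_on (spectrum a) f \<Longrightarrow> continuous_on (spectrum a) g \<Longrightarrow>
      \<Psi> (\<lambda>z. f z + g z) = \<Psi> f + \<Psi> g"
    and functional_calculus_mult: "continuous_on (spectrum a) f \<Longrightarrow> continuous_on (spectrum a) g \<Longrightarrow>
      \<Psi> (\<lambda>z. f z * g z) = \<Psi> f * \<Psi> g"
    and functional_calculus_cong: "continuous_on (spectrum a) f \<Longrightarrow> continuous_on (spectrum a) g \<Longrightarrow>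
      (\<And>z. z \<in> spectrum a \<Longrightarrow> f z = g z) \<Longrightarrow> \<Psi> f = \<Psi> g"
  using fc unfolding functional_calculus_def by blast+

lemma functional_calculus_const:
  assumes "functional_calculus a \<Psi>"
  shows "\<Psi> (\<lambda>z. c) = c *\<^sub>C 1"
  using functional_calculus_scale[OF assms, of "\<lambda>z. 1" c] functional_calculus_one[OF assms]
  by (simp add: continuous_on_const)

text \<open>If \<open>f\<close> misses \<open>m\<close> on the spectrum, then
  \<open>1 / (f - m)\<close> is continuous there and its image under \<open>\<Psi>\<close> inverts
  \<open>\<Psi> f - m\<close>.\<close>

lemma functional_calculus_spectrum:
  assumes fc: "functional_calculus a \<Psi>" and f: "continuous_on (spectrum a) f" and m: "m \<in> spectrum (\<Psi> f)"
  shows "\<exists>z \<in> spectrum a. m = f z"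
proof (rule ccontr)
  assume "\<not> ?thesis"
  then have nz: "f z + (- m) \<noteq> 0" if "z \<in> spectrum a" for z using that by auto
  let ?g = "\<lambda>z. f z + (- m)" and ?h = "\<lambda>z. inverse (f z + (- m))"
  have g: "continuous_on (spectrum a) ?g" by (intro continuous_intros f)
  have h: "continuous_on (spectrum a) ?h" using nz by (intro continuous_intros f) auto
  have "\<Psi> ?g = \<Psi> f + \<Psi> (\<lambda>z. - m)"
    using functional_calculus_add[OF fc f continuous_on_const] .
  then have eq: "\<Psi> ?g = \<Psi> f - m *\<^sub>C 1" by (simp add: functional_calculus_const[OF fc] scaleC_minus_left)
  have "\<Psi> (\<lambda>z. ?g z * ?h z) = \<Psi> (\<lambda>z. 1)" "\<Psi> (\<lambda>z. ?h z * ?g z) = \<Psi> (\<lambda>z. 1)"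
    using nz by (intro functional_calculus_cong[OF fc] continuous_on_mult g h continuous_on_const; simp)+
  then have "\<Psi> ?g * \<Psi> ?h = 1" "\<Psi> ?h * \<Psi> ?g = 1"
    unfolding functional_calculus_mult[OF fc g h] functional_calculus_mult[OF fc h g]
    by (simp_all add: functional_calculus_one[OF fc])
  then have "ring_inv (\<Psi> f - m *\<^sub>C 1)" unfolding eq ring_inv_def by blast
  then show False using m not_in_spectrum_iff by blast
qed

text \<open>The argument for polynomials is repeated for an arbitrary \<open>\<Psi>\<close>:
  \<open>cfc\<close> selects a calculus by choice, and continuity is not among the defining clauses,
  so it has to be derived from the algebraic ones.\<close>

lemma functional_calculus_norm_le:
  assumes fc: "functional_calculus a \<Psi>" and f: "continuous_on (spectrum a) f"
    and le: "\<And>z. z \<in> spectrum a \<Longrightarrow> cmod (f z) \<le> K"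
  shows "norm (\<Psi> f) \<le> K"
proof -
  have cf: "continuous_on (spectrum a) (\<lambda>z. cnj (f z))" by (intro continuous_intros f)
  have cff: "continuous_on (spectrum a) (\<lambda>z. cnj (f z) * f z)" by (intro continuous_intros f)
  have eq: "star (\<Psi> f) * \<Psi> f = \<Psi> (\<lambda>z. cnj (f z) * f z)"
    by (simp add: functional_calculus_mult[OF fc cf f] functional_calculus_star[OF fc f])
  obtain l where l: "l \<in> spectrum (star (\<Psi> f) * \<Psi> f)" "cmod l = norm (star (\<Psi> f) * \<Psi> f)"
    using spectral_radius_selfadjoint[OF selfadjoint_star_mult] by blast
  then obtain z where z: "z \<in> spectrum a" "l = cnj (f z) * f z"
    unfolding eq using functional_calculus_spectrum[OF fc cff] by blast
  have "(norm (\<Psi> f))\<^sup>2 = (cmod (f z))\<^sup>2"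
    using l(2) z(2) by (simp add: cstar_identity norm_mult power2_eq_square)
  then show ?thesis using le[OF z(1)] by simp
qed

lemma functional_calculus_poly:
  assumes fc: "functional_calculus a \<Psi>"
  shows "\<Psi> (poly p) = peval p a"
proof (induction p)
  case 0
  then show ?case
    using functional_calculus_const[OF fc, of 0] by (simp add: peval_0 scaleC_zero_left poly_0[abs_def])
next
  case (pCons c p)
  have p: "continuous_on (spectrum a) (poly p)" by (auto intro!: continuous_intros)
  have "\<Psi> (\<lambda>z. c + z * poly p z) = \<Psi> (\<lambda>z. c) + \<Psi> (\<lambda>z. z * poly p z)"
    by (intro functional_calculus_add[OF fc] continuous_on_const continuous_on_mult continuous_on_id p)
  also have "\<dots> = c *\<^sub>C 1 + a * peval p a"
    by (simp add: functional_calculus_const[OF fc] functional_calculus_mult[OF fc continuous_on_id p]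
        functional_calculus_id[OF fc] pCons)
  finally show ?case by (simp add: peval_pCons poly_pCons[abs_def])
qed

text \<open>By the norm bound every functional calculus is continuous, hence determined by its values on polynomials.\<close>

lemma functional_calculus_poly_limit:
  assumes fc: "functional_calculus a \<Psi>" and sa: "selfadjoint a" and f: "continuous_on (spectrum a) f"
  shows "poly_limit a f (\<Psi> f)"
proof -
  obtain b where "poly_limit a f b" using poly_limit_exists[OF sa f] by blast
  then obtain p where p: "uniform_limit (spectrum a) (\<lambda>n. poly (p n)) f sequentially" "(\<lambda>n. peval (p n) a) \<longlonglongrightarrow> b"
    by (auto simp: poly_limit_def)
  have "(\<lambda>n. peval (p n) a) \<longlonglongrightarrow> \<Psi> f"
  proof (rule tendstoI)
    fix e :: real assume "e > 0"
    then have "\<forall>\<^sub>F n in sequentially. \<forall>z\<in>spectrum a. dist (poly (p n) z) (f z) < e / 2"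
      using p(1) unfolding uniform_limit_iff by (auto dest: spec[of _ "e / 2"])
    then show "\<forall>\<^sub>F n in sequentially. dist (peval (p n) a) (\<Psi> f) < e"
    proof eventually_elim
      case (elim n)
      let ?q = "\<lambda>z. - 1 * f z"
      have q: "continuous_on (spectrum a) ?q" "continuous_on (spectrum a) (poly (p n))"
        by (auto intro!: continuous_intros f)
      have "\<Psi> ?q = (- 1) *\<^sub>C \<Psi> f" by (rule functional_calculus_scale[OF fc f])
      moreover have "\<Psi> (\<lambda>z. poly (p n) z + ?q z) = \<Psi> (poly (p n)) + \<Psi> ?q"
        by (rule functional_calculus_add[OF fc q(2,1)])
      moreover have "norm (\<Psi> (\<lambda>z. poly (p n) z + ?q z)) \<le> e / 2"
        using elim by (intro functional_calculus_norm_le[OF fc] continuous_on_add q) (auto simp: dist_norm intro: less_imp_le)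
      ultimately have "norm (peval (p n) a - \<Psi> f) \<le> e / 2"
        by (simp only: functional_calculus_poly[OF fc] scaleC_minus_left scaleC_one add_uminus_conv_diff)
      then show ?case using \<open>e > 0\<close> by (simp add: dist_norm)
    qed
  qed
  then show ?thesis using p(1) by (intro poly_limitI)
qed

section \<open>Functional calculus for real functions\<close>

definition real_spectrum :: "'a::unital_cstar_algebra \<Rightarrow> real set" where
  "real_spectrum a = Re ` spectrum a"

lemma real_spectrum_iff:
  assumes "selfadjoint a"
  shows "t \<in> real_spectrum a \<longleftrightarrow> complex_of_real t \<in> spectrum a"
  unfolding real_spectrum_def using spectrum_selfadjoint_real[OF assms] by (metis Re_complex_of_real image_iff)

lemma abs_real_spectrum_le: "t \<in> real_spectrum a \<Longrightarrow> \<bar>t\<bar> \<le> norm a"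
  unfolding real_spectrum_def using spectrum_bounded abs_Re_le_cmod by (metis imageE order_trans)

lemma real_spectrum_compact: "compact (real_spectrum a)"
  unfolding real_spectrum_def
  by (intro compact_continuous_image spectrum_compact continuous_intros)

context
  fixes a :: "'a::unital_cstar_algebra"
  assumes sa: "selfadjoint a"
begin

lemma continuous_on_spectrum:
  assumes "continuous_on (real_spectrum a) f"
  shows "continuous_on (spectrum a) (\<lambda>z. complex_of_real (f (Re z)))"
  using assms unfolding real_spectrum_def
  by (intro continuous_on_of_real continuous_on_compose2[OF assms[unfolded real_spectrum_def]] continuous_intros) auto

lemma cfc_functional_calculus: "functional_calculus a (SOME \<Psi>. functional_calculus a \<Psi>)"
  using functional_calculus_exists[OF sa] by (rule someI_ex)

lemma cfc_poly_limit:
  assumes "continuous_on (real_spectrum a) f"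
  shows "poly_limit a (\<lambda>z. complex_of_real (f (Re z))) (cfc f a)"
  unfolding cfc_def
  by (rule functional_calculus_poly_limit[OF cfc_functional_calculus sa continuous_on_spectrum[OF assms]])

lemma norm_cfc_diff_le:
  assumes "continuous_on (real_spectrum a) f" "continuous_on (real_spectrum a) g"
    and "\<And>t. t \<in> real_spectrum a \<Longrightarrow> \<bar>f t - g t\<bar> \<le> K"
  shows "norm (cfc f a - cfc g a) \<le> K"
proof (rule poly_limit_norm_diff_le[OF sa cfc_poly_limit[OF assms(1)] cfc_poly_limit[OF assms(2)]])
  fix z assume "z \<in> spectrum a"
  then have "Re z \<in> real_spectrum a" by (simp add: real_spectrum_def)
  then show "cmod (complex_of_real (f (Re z)) - complex_of_real (g (Re z))) \<le> K"
    using assms(3) by (metis norm_of_real of_real_diff)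
qed

lemma cfc_eqI:
  assumes f: "continuous_on (real_spectrum a) f" and b: "poly_limit a g b"
    and eq: "\<And>t. t \<in> real_spectrum a \<Longrightarrow> g (complex_of_real t) = complex_of_real (f t)"
  shows "cfc f a = b"
proof (rule poly_limit_unique[OF sa cfc_poly_limit[OF f] b])
  fix z assume z: "z \<in> spectrum a"
  then have "Re z \<in> real_spectrum a" by (simp add: real_spectrum_def)
  then show "complex_of_real (f (Re z)) = g z"
    using eq spectrum_selfadjoint_real[OF sa z] by metis
qed

lemma cfc_cong:
  assumes "continuous_on (real_spectrum a) g" "\<And>t. t \<in> real_spectrum a \<Longrightarrow> f t = g t"
  shows "cfc f a = cfc g a"
proof -
  have "continuous_on (real_spectrum a) f"
    using assms continuous_on_cong by metis
  then show ?thesis using assms norm_cfc_diff_le[of f g 0] by simp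
qed

lemma cfc_id: "cfc (\<lambda>t. t) a = a"
  by (rule cfc_eqI[OF _ poly_limit_poly[of a "[:0, 1:]", unfolded peval_id]]) (auto intro: continuous_intros)

lemma cfc_const: "cfc (\<lambda>t. c) a = c *\<^sub>R 1"
  by (rule cfc_eqI[OF _ poly_limit_poly[of a "[:complex_of_real c:]", unfolded peval_const scaleC_of_real]])
    (auto intro: continuous_intros)

lemma cfc_add:
  assumes "continuous_on (real_spectrum a) f" "continuous_on (real_spectrum a) g"
  shows "cfc (\<lambda>t. f t + g t) a = cfc f a + cfc g a"
  using poly_limit_add[OF cfc_poly_limit cfc_poly_limit, OF assms]
  by (rule cfc_eqI[rotated]) (auto intro: continuous_on_add assms)

lemma cfc_mult:
  assumes "continuous_on (real_spectrum a) f" "continuous_on (real_spectrum a) g"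
  shows "cfc (\<lambda>t. f t * g t) a = cfc f a * cfc g a"
  using poly_limit_mult[OF cfc_poly_limit cfc_poly_limit, OF assms continuous_on_spectrum continuous_on_spectrum, OF assms]
  by (rule cfc_eqI[rotated]) (auto intro: continuous_on_mult assms)

lemma cfc_scale:
  assumes "continuous_on (real_spectrum a) f"
  shows "cfc (\<lambda>t. c * f t) a = c *\<^sub>R cfc f a"
  using cfc_mult[OF _ assms, of "\<lambda>_. c"] by (simp add: cfc_const continuous_on_const)

lemma cfc_diff:
  assumes "continuous_on (real_spectrum a) f" "continuous_on (real_spectrum a) g"
  shows "cfc (\<lambda>t. f t - g t) a = cfc f a - cfc g a"
  using cfc_add[OF assms(1), of "\<lambda>t. - 1 * g t"] cfc_scale[OF assms(2), of "- 1"] assms(2)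
  by (simp add: continuous_on_minus)

lemma cfc_selfadjoint:
  assumes f: "continuous_on (real_spectrum a) f"
  shows "selfadjoint (cfc f a)"
  using cfc_eqI[OF f poly_limit_star[OF sa cfc_poly_limit[OF f]]] by (simp add: selfadjoint_def)

lemma cfc_commute:
  assumes "continuous_on (real_spectrum a) f" "continuous_on (real_spectrum a) g"
  shows "cfc f a * cfc g a = cfc g a * cfc f a"
  using cfc_mult[OF assms] cfc_mult[OF assms(2,1)] by (simp add: mult.commute)

lemma cfc_comm:
  assumes f: "continuous_on (real_spectrum a) f" and z: "z * a = a * z"
  shows "z * cfc f a = cfc f a * z"
proof -
  obtain p where p: "(\<lambda>n. peval (p n) a) \<longlonglongrightarrow> cfc f a"
    using cfc_poly_limit[OF f] by (auto simp: poly_limit_def)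
  have "(\<lambda>n. z * peval (p n) a) \<longlonglongrightarrow> z * cfc f a" by (rule tendsto_mult_left[OF p])
  then have "(\<lambda>n. peval (p n) a * z) \<longlonglongrightarrow> z * cfc f a" by (simp only: peval_comm[OF z])
  moreover have "(\<lambda>n. peval (p n) a * z) \<longlonglongrightarrow> cfc f a * z" by (rule tendsto_mult_right[OF p])
  ultimately show ?thesis by (rule LIMSEQ_unique)
qed

lemma spectrum_cfc:
  assumes "continuous_on (real_spectrum a) f" "m \<in> spectrum (cfc f a)"
  shows "\<exists>t \<in> real_spectrum a. m = complex_of_real (f t)"
  using functional_calculus_spectrum[OF cfc_functional_calculus continuous_on_spectrum[OF assms(1)]] assms(2)
  unfolding cfc_def real_spectrum_def by blast

lemma positive_cfc:
  assumes f: "continuous_on (real_spectrum a) f" and "\<And>t. t \<in> real_spectrum a \<Longrightarrow> 0 \<le> f t"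
  shows "positive (cfc f a)"
  unfolding positive_def using spectrum_cfc[OF f] assms(2) cfc_selfadjoint[OF f] by blast

end

lemma positive_selfadjoint: "positive x \<Longrightarrow> selfadjoint x"
  by (simp add: positive_def)

lemma positive_real_spectrum: "positive x \<Longrightarrow> t \<in> real_spectrum x \<Longrightarrow> 0 \<le> t"
  by (auto simp: positive_def real_spectrum_def)

lemma positive_sqrt:
  assumes x: "positive x"
  obtains r where "selfadjoint r" "r * r = x" "\<And>z. z * x = x * z \<Longrightarrow> z * r = r * z"
proof -
  have sa: "selfadjoint x" using x by (rule positive_selfadjoint)
  have c: "continuous_on (real_spectrum x) sqrt" by (intro continuous_intros)
  show ?thesis
  proof (rule that)
    show "selfadjoint (cfc sqrt x)" using sa c by (rule cfc_selfadjoint)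
    have "cfc sqrt x * cfc sqrt x = cfc (\<lambda>t. sqrt t * sqrt t) x" using cfc_mult[OF sa c c] by simp
    also have "\<dots> = cfc (\<lambda>t. t) x"
      using positive_real_spectrum[OF x] by (intro cfc_cong[OF sa]) (auto intro: continuous_intros)
    finally show "cfc sqrt x * cfc sqrt x = x" by (simp add: cfc_id[OF sa])
  qed (rule cfc_comm[OF sa c])
qed

section \<open>Von Neumann algebras\<close>

subsection \<open>The inner product\<close>

lemma cinner_zero_left: "cinner 0 (y::'h::complex_hilbert_space) = 0"
  using cinner_add_left[of 0 0 y] by simp

lemma cinner_diff_left: "cinner (x - y) (z::'h::complex_hilbert_space) = cinner x z - cinner y z"
  using cinner_add_left[of "x - y" y z] by simp

lemma cinner_add_right: "cinner (x::'h::complex_hilbert_space) (y + z) = cinner x y + cinner x z"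
  by (subst (1 2 3) cinner_commute) (simp add: cinner_add_left)

lemma cinner_scaleC_right: "cinner (x::'h::complex_hilbert_space) (c *\<^sub>C y) = cnj c * cinner x y"
  by (subst (1 2) cinner_commute) (simp add: cinner_scaleC_left)

lemma cinner_diff_right: "cinner (x::'h::complex_hilbert_space) (y - z) = cinner x y - cinner x z"
  using cinner_add_right[of x "y - z" z] by simp

lemma cinner_polarization:
  fixes x y :: "'h::complex_hilbert_space"
  shows "4 * cinner x y = complex_of_real ((norm (x + y))\<^sup>2) - complex_of_real ((norm (x - y))\<^sup>2)
    + \<i> * complex_of_real ((norm (x + \<i> *\<^sub>C y))\<^sup>2) - \<i> * complex_of_real ((norm (x - \<i> *\<^sub>C y))\<^sup>2)"
  unfolding cinner_norm[symmetric]
  by (simp add: cinner_add_left cinner_add_right cinner_diff_left cinner_diff_right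
      cinner_scaleC_left cinner_scaleC_right algebra_simps)

text \<open>Polarization writes the inner product as a combination of squared norms, so its joint
  continuity reduces to continuity of the norm.\<close>

lemma tendsto_cinner:
  fixes f g :: "'i \<Rightarrow> 'h::complex_hilbert_space"
  assumes "(f \<longlongrightarrow> x) F" "(g \<longlongrightarrow> y) F"
  shows "((\<lambda>n. cinner (f n) (g n)) \<longlongrightarrow> cinner x y) F"
proof -
  have eq: "cinner u v = (complex_of_real ((norm (u + v))\<^sup>2) - complex_of_real ((norm (u - v))\<^sup>2)
      + \<i> * complex_of_real ((norm (u + \<i> *\<^sub>C v))\<^sup>2) - \<i> * complex_of_real ((norm (u - \<i> *\<^sub>C v))\<^sup>2)) / 4"
    for u v :: 'h
    using cinner_polarization[of u v] by (simp add: mult.commute)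
  show ?thesis
    unfolding eq by (intro tendsto_intros tendsto_scaleC assms) simp
qed

lemma Re_cinner_self: "Re (cinner x x) = (norm x)\<^sup>2"
  by (simp add: cinner_norm)

lemma cinner_eq_zeroD:
  assumes "\<And>y. cinner x y = 0"
  shows "x = 0"
  using Re_cinner_self[of x] assms by simp

subsection \<open>Quadratic forms and positivity\<close>

locale von_neumann =
  fixes \<pi> :: "'b::unital_cstar_algebra \<Rightarrow> 'h::complex_hilbert_space \<Rightarrow> 'h"
  assumes vna: "von_neumann_algebra \<pi>"
begin

lemma
  shows rep_add: "\<pi> (x + y) \<xi> = \<pi> x \<xi> + \<pi> y \<xi>"
    and rep_scaleC: "\<pi> (c *\<^sub>C x) \<xi> = c *\<^sub>C \<pi> x \<xi>"
    and rep_one: "\<pi> 1 \<xi> = \<xi>"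
    and rep_adjoint: "cinner (\<pi> x \<xi>) \<eta> = cinner \<xi> (\<pi> (star x) \<eta>)"
    and rep_inj: "inj \<pi>"
    and rep_bicommutant: "range \<pi> = commutant (commutant (range \<pi>))"
  using vna by (simp_all add: von_neumann_algebra_def)

lemma rep_mult: "\<pi> (x * y) \<xi> = \<pi> x (\<pi> y \<xi>)"
  using vna by (simp add: von_neumann_algebra_def)

lemma rep_diff: "\<pi> (x - y) \<xi> = \<pi> x \<xi> - \<pi> y \<xi>"
  using rep_add[of "x - y" y \<xi>] by simp

lemma rep_zero: "\<pi> 0 \<xi> = 0"
  using rep_diff[of 0 0] by simp

lemma rep_linear: "complex_linear (\<pi> x)" and rep_bounded_linear: "bounded_linear (\<pi> x)"
  using rep_bicommutant by (auto simp: commutant_def)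

lemma rep_add_right: "\<pi> x (\<xi> + \<eta>) = \<pi> x \<xi> + \<pi> x \<eta>"
  and rep_scaleC_right: "\<pi> x (c *\<^sub>C \<xi>) = c *\<^sub>C \<pi> x \<xi>"
  using rep_linear[of x] by (simp_all add: complex_linear_def)

lemma rep_diff_right: "\<pi> x (\<xi> - \<eta>) = \<pi> x \<xi> - \<pi> x \<eta>"
  using rep_add_right[of x "\<xi> - \<eta>" \<eta>] by simp

lemma rep_polarization:
  "4 * cinner (\<pi> x \<xi>) \<eta> = cinner (\<pi> x (\<xi> + \<eta>)) (\<xi> + \<eta>) - cinner (\<pi> x (\<xi> - \<eta>)) (\<xi> - \<eta>)
    + \<i> * cinner (\<pi> x (\<xi> + \<i> *\<^sub>C \<eta>)) (\<xi> + \<i> *\<^sub>C \<eta>) - \<i> * cinner (\<pi> x (\<xi> - \<i> *\<^sub>C \<eta>)) (\<xi> - \<i> *\<^sub>C \<eta>)"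
  by (simp add: rep_add_right rep_diff_right rep_scaleC_right cinner_add_left cinner_add_right
      cinner_diff_left cinner_diff_right cinner_scaleC_left cinner_scaleC_right algebra_simps)

lemma rep_eqI:
  assumes "\<And>\<xi>. \<pi> x \<xi> = \<pi> y \<xi>"
  shows "x = y"
proof -
  have "\<pi> x = \<pi> y" using assms by (rule ext)
  then show ?thesis using rep_inj by (simp add: inj_eq)
qed

lemma rep_eqI_quadratic:
  assumes "\<And>\<xi>. cinner (\<pi> x \<xi>) \<xi> = cinner (\<pi> y \<xi>) \<xi>"
  shows "x = y"
proof (rule rep_eqI)
  fix \<xi>
  have "4 * cinner (\<pi> x \<xi>) \<eta> = 4 * cinner (\<pi> y \<xi>) \<eta>" for \<eta>
    by (simp only: rep_polarization assms)
  then have "cinner (\<pi> x \<xi> - \<pi> y \<xi>) \<eta> = 0" for \<eta>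
    by (simp add: cinner_diff_left)
  then have "\<pi> x \<xi> - \<pi> y \<xi> = 0" by (rule cinner_eq_zeroD)
  then show "\<pi> x \<xi> = \<pi> y \<xi>" by simp
qed

definition qf :: "'b \<Rightarrow> 'h \<Rightarrow> real" where
  "qf x \<xi> = Re (cinner (\<pi> x \<xi>) \<xi>)"

lemma qf_add: "qf (x + y) \<xi> = qf x \<xi> + qf y \<xi>"
  and qf_diff: "qf (x - y) \<xi> = qf x \<xi> - qf y \<xi>"
  and qf_zero: "qf 0 \<xi> = 0"
  and qf_one: "qf 1 \<xi> = (norm \<xi>)\<^sup>2"
  by (simp_all add: qf_def rep_add rep_diff rep_zero rep_one cinner_add_left cinner_diff_left cinner_zero_left Re_cinner_self)

lemma qf_scaleR: "qf (r *\<^sub>R x) \<xi> = r * qf x \<xi>"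
  unfolding qf_def scaleC_of_real[symmetric] rep_scaleC cinner_scaleC_left by simp

lemma qf_sum: "qf (\<Sum>i\<in>A. f i) \<xi> = (\<Sum>i\<in>A. qf (f i) \<xi>)"
  by (induction A rule: infinite_finite_induct) (simp_all add: qf_zero qf_add)

lemma qf_star_mult: "qf (star x * x) \<xi> = (norm (\<pi> x \<xi>))\<^sup>2"
proof -
  have "cinner (\<pi> (star x * x) \<xi>) \<xi> = cinner (\<pi> x \<xi>) (\<pi> x \<xi>)"
    by (simp add: rep_mult rep_adjoint[of "star x"] star_star)
  then show ?thesis by (simp add: qf_def Re_cinner_self)
qed

lemma qf_square: "selfadjoint x \<Longrightarrow> qf (x * x) \<xi> = (norm (\<pi> x \<xi>))\<^sup>2"
  using qf_star_mult[of x] by (simp add: selfadjointD)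

lemma qf_sandwich: "selfadjoint r \<Longrightarrow> qf (r * x * r) \<xi> = qf x (\<pi> r \<xi>)"
  by (simp add: qf_def rep_mult rep_adjoint[of r] selfadjointD)

lemma cinner_selfadjoint:
  assumes "selfadjoint x"
  shows "cinner (\<pi> x \<xi>) \<xi> = complex_of_real (qf x \<xi>)"
proof -
  have "cinner (\<pi> x \<xi>) \<xi> = cnj (cinner (\<pi> x \<xi>) \<xi>)"
    using rep_adjoint[of x \<xi> \<xi>] cinner_commute[of \<xi> "\<pi> x \<xi>"] assms by (simp add: selfadjointD)
  then show ?thesis by (simp add: qf_def complex_eq_iff)
qed

lemma selfadjointI_quadratic:
  assumes "\<And>\<xi>. cinner (\<pi> x \<xi>) \<xi> = complex_of_real (c \<xi>)"
  shows "selfadjoint x"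
proof (intro selfadjointI rep_eqI_quadratic)
  fix \<xi>
  have "cinner (\<pi> (star x) \<xi>) \<xi> = cnj (cinner (\<pi> x \<xi>) \<xi>)"
    using rep_adjoint[of "star x" \<xi> \<xi>] cinner_commute[of \<xi> "\<pi> x \<xi>"] by (simp add: star_star)
  then show "cinner (\<pi> (star x) \<xi>) \<xi> = cinner (\<pi> x \<xi>) \<xi>" by (simp add: assms)
qed

lemma selfadjoint_eqI:
  assumes "selfadjoint x" "selfadjoint y" "\<And>\<xi>. qf x \<xi> = qf y \<xi>"
  shows "x = y"
  using assms by (intro rep_eqI_quadratic) (simp add: cinner_selfadjoint)

text \<open>Positivity is defined by the spectrum, which does not show that it is preserved by sums;
  quadratic forms do. For the converse let \<open>n\<close> be the negative part of
  \<open>x\<close>. Then \<open>n * x * n = - n * n * n\<close> is minus the square of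
  \<open>r * n\<close>, with \<open>r\<close> a square root of \<open>n\<close>, while the quadratic
  form of \<open>n * x * n\<close> is nonnegative. Hence \<open>r * n = 0\<close>, so
  \<open>n = 0\<close>.\<close>

lemma positive_iff_quadratic: "positive x \<longleftrightarrow> selfadjoint x \<and> (\<forall>\<xi>. 0 \<le> qf x \<xi>)"
proof (intro iffI conjI allI)
  assume p: "positive x"
  then show "selfadjoint x" by (rule positive_selfadjoint)
  fix \<xi>
  obtain r where "selfadjoint r" "r * r = x" using positive_sqrt[OF p] by blast
  then show "0 \<le> qf x \<xi>" using qf_square[of r \<xi>] by simp
next
  assume "selfadjoint x \<and> (\<forall>\<xi>. 0 \<le> qf x \<xi>)"
  then have sa: "selfadjoint x" and pos: "\<And>\<xi>. 0 \<le> qf x \<xi>" by auto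
  let ?m = "\<lambda>t::real. max (- t) 0"
  define n where "n = cfc ?m x"
  have c: "continuous_on (real_spectrum x) ?m" "continuous_on (real_spectrum x) (\<lambda>t. t)"
    "continuous_on (real_spectrum x) (\<lambda>t. max t 0)"
    by (intro continuous_intros)+
  have n_sa: "selfadjoint n" unfolding n_def using sa c(1) by (rule cfc_selfadjoint)
  have "n * x = cfc (\<lambda>t. ?m t * t) x"
    using cfc_mult[OF sa c(1,2)] by (simp add: n_def cfc_id[OF sa])
  also have "\<dots> = cfc (\<lambda>t. - 1 * (?m t * ?m t)) x"
    by (intro cfc_cong[OF sa] continuous_intros) (auto simp: max_def)
  also have "\<dots> = - (n * n)"
    using cfc_scale[OF sa continuous_on_mult[OF c(1) c(1)], of "- 1"] cfc_mult[OF sa c(1) c(1)] by (simp add: n_def)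
  finally have nx: "n * x = - (n * n)" .
  have n_pos: "positive n" unfolding n_def by (rule positive_cfc[OF sa c(1)]) simp
  then obtain r where r: "selfadjoint r" "r * r = n" "\<And>z. z * n = n * z \<Longrightarrow> z * r = r * z"
    using positive_sqrt by blast
  have nr: "n * r = r * n" by (rule r(3)) simp
  have nnn: "n * n * n = (r * n) * (r * n)" using nr r(2) by (metis mult.assoc)
  have rn_sa: "selfadjoint (r * n)" using r(1) n_sa nr by (metis selfadjoint_mult)
  have "\<pi> (r * n) \<xi> = 0" for \<xi>
  proof -
    have "0 \<le> qf (n * x * n) \<xi>" by (simp add: qf_sandwich[OF n_sa] pos)
    also have "n * x * n = 0 - (r * n) * (r * n)" by (simp add: nx nnn[symmetric])
    finally have "(norm (\<pi> (r * n) \<xi>))\<^sup>2 \<le> 0" by (simp only: qf_diff qf_zero qf_square[OF rn_sa])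
    then show ?thesis by simp
  qed
  then have "r * n = 0" by (intro rep_eqI) (simp add: rep_zero)
  then have "n * n = 0" by (metis mult.assoc mult_zero_right r(2))
  then have "n = 0" using norm_selfadjoint_square[OF n_sa] by simp
  moreover have "x = cfc (\<lambda>t. max t 0) x - n"
  proof -
    have "x = cfc (\<lambda>t. t) x" by (simp add: cfc_id[OF sa])
    also have "\<dots> = cfc (\<lambda>t. max t 0 - ?m t) x"
      by (intro cfc_cong[OF sa] continuous_intros) (auto simp: max_def)
    also have "\<dots> = cfc (\<lambda>t. max t 0) x - n" unfolding n_def by (rule cfc_diff[OF sa c(3) c(1)])
    finally show ?thesis .
  qed
  ultimately have "x = cfc (\<lambda>t. max t 0) x" by simp
  moreover have "positive (cfc (\<lambda>t. max t 0) x)" by (rule positive_cfc[OF sa c(3)]) simp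
  ultimately show "positive x" by simp
qed

lemma positive_qf: "positive x \<Longrightarrow> 0 \<le> qf x \<xi>"
  using positive_iff_quadratic by blast

lemma positiveI: "selfadjoint x \<Longrightarrow> (\<And>\<xi>. 0 \<le> qf x \<xi>) \<Longrightarrow> positive x"
  using positive_iff_quadratic by blast

lemma positive_diffI: "selfadjoint x \<Longrightarrow> selfadjoint y \<Longrightarrow> (\<And>\<xi>. qf x \<xi> \<le> qf y \<xi>) \<Longrightarrow> positive (y - x)"
  by (intro positiveI selfadjoint_diff) (simp_all add: qf_diff)

lemma positive_diffD: "positive (y - x) \<Longrightarrow> qf x \<xi> \<le> qf y \<xi>"
  using positive_qf[of "y - x" \<xi>] by (simp add: qf_diff)

lemma positive_sandwich: "positive (x::'b) \<Longrightarrow> selfadjoint r \<Longrightarrow> positive (r * x * r)"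
  by (intro positiveI selfadjoint_sandwich) (simp_all add: positive_selfadjoint qf_sandwich positive_qf)

text \<open>A square root \<open>r\<close> of \<open>x\<close> commutes with \<open>y\<close> too,
  so the product is \<open>r * y * r\<close>.\<close>

lemma positive_commuting_mult:
  assumes "positive (x::'b)" "positive y" "x * y = y * x"
  shows "positive (x * y)"
proof -
  obtain r where r: "selfadjoint r" "r * r = x" "\<And>z. z * x = x * z \<Longrightarrow> z * r = r * z"
    using positive_sqrt[OF assms(1)] by blast
  have "y * r = r * y" using assms(3) by (intro r(3)) simp
  then have "x * y = r * y * r" using r(2) by (metis mult.assoc)
  then show ?thesis using positive_sandwich[OF assms(2) r(1)] by simp
qed

lemma abs_qf_le:
  assumes "selfadjoint x"
  shows "\<bar>qf x \<xi>\<bar> \<le> norm x * (norm \<xi>)\<^sup>2"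
proof -
  have c: "continuous_on (real_spectrum x) (\<lambda>t. norm x)" "continuous_on (real_spectrum x) (\<lambda>t. t)"
    by (intro continuous_intros)+
  have "positive (cfc (\<lambda>t. norm x - t) x)" "positive (cfc (\<lambda>t. norm x + t) x)"
    using abs_real_spectrum_le by (intro positive_cfc[OF assms] continuous_intros; fastforce)+
  then have p: "positive (norm x *\<^sub>R 1 - x)" "positive (norm x *\<^sub>R 1 + x)"
    by (simp_all add: cfc_diff[OF assms c] cfc_add[OF assms c] cfc_const[OF assms] cfc_id[OF assms])
  then show ?thesis
    using positive_qf[OF p(1), of \<xi>] positive_qf[OF p(2), of \<xi>] by (simp add: qf_diff qf_add qf_scaleR qf_one)
qed

lemma norm_rep_le: "norm (\<pi> x \<xi>) \<le> norm x * norm \<xi>"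
proof -
  have "(norm (\<pi> x \<xi>))\<^sup>2 \<le> norm (star x * x) * (norm \<xi>)\<^sup>2"
    using abs_qf_le[OF selfadjoint_star_mult[of x], of \<xi>] by (simp add: qf_star_mult)
  also have "\<dots> = (norm x * norm \<xi>)\<^sup>2" by (simp add: cstar_identity power_mult_distrib)
  finally show ?thesis by (rule power2_le_imp_le) simp
qed

text \<open>For \<open>0 \<le> d \<le> 1\<close> one has \<open>d * d \<le> d\<close>, because
  \<open>d - d * d = r * (1 - d) * r\<close> with \<open>r\<close> a square root of
  \<open>d\<close>. It upgrades convergence of quadratic forms of monotone sequences to strong
  convergence.\<close>

lemma norm_rep_square_le_qf:
  assumes "positive d" "positive (1 - d)"
  shows "(norm (\<pi> d \<xi>))\<^sup>2 \<le> qf d \<xi>"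
proof -
  obtain r where r: "selfadjoint r" "r * r = d" using positive_sqrt[OF assms(1)] by blast
  have "qf d \<xi> - qf (d * d) \<xi> = qf (r * (1 - d) * r) \<xi>"
    unfolding qf_diff[symmetric] by (simp add: r(2)[symmetric] algebra_simps)
  also have "\<dots> \<ge> 0" by (intro positive_qf positive_sandwich assms r)
  finally show ?thesis by (simp add: qf_square[OF positive_selfadjoint[OF assms(1)]])
qed

subsection \<open>Strong limits\<close>

text \<open>A strong limit of uniformly bounded elements commutes with everything in the commutant,
  so it lies in the bicommutant, which is the range of \<open>\<pi>\<close>. This is how the algebra
  acquires elements beyond norm limits.\<close>

lemma strong_limit_exists:
  assumes lim: "\<And>\<xi>. (\<lambda>n. \<pi> (b n) \<xi>) \<longlonglongrightarrow> T \<xi>" and bd: "\<And>n \<xi>. norm (\<pi> (b n) \<xi>) \<le> K * norm \<xi>"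
  shows "\<exists>x. T = \<pi> x"
proof -
  have add: "T (\<xi> + \<eta>) = T \<xi> + T \<eta>" for \<xi> \<eta>
    using lim[of "\<xi> + \<eta>"] tendsto_add[OF lim lim] unfolding rep_add_right by (rule LIMSEQ_unique)
  have scale: "T (c *\<^sub>C \<xi>) = c *\<^sub>C T \<xi>" for c \<xi>
    using lim[of "c *\<^sub>C \<xi>"] tendsto_scaleC[OF lim] unfolding rep_scaleC_right by (rule LIMSEQ_unique)
  have "bounded_linear T"
  proof (rule bounded_linear_intro[OF add])
    show "T (r *\<^sub>R \<xi>) = r *\<^sub>R T \<xi>" for r \<xi>
      using scale[of "complex_of_real r" \<xi>] by (simp add: scaleC_of_real)
    show "norm (T \<xi>) \<le> norm \<xi> * K" for \<xi>
      using bd by (intro LIMSEQ_le_const2[OF tendsto_norm[OF lim]]) (auto simp: mult.commute)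
  qed
  moreover have "T \<circ> S = S \<circ> T" if S: "S \<in> commutant (range \<pi>)" for S
  proof
    fix \<xi>
    have bl: "bounded_linear S" and comm: "S (\<pi> y \<eta>) = \<pi> y (S \<eta>)" for y \<eta>
      using S by (auto simp: commutant_def o_def fun_eq_iff)
    have "(\<lambda>n. S (\<pi> (b n) \<xi>)) \<longlonglongrightarrow> S (T \<xi>)" by (rule bounded_linear.tendsto[OF bl lim])
    then have "(\<lambda>n. \<pi> (b n) (S \<xi>)) \<longlonglongrightarrow> S (T \<xi>)" by (simp only: comm)
    then show "(T \<circ> S) \<xi> = (S \<circ> T) \<xi>" using LIMSEQ_unique[OF lim] by simp
  qed
  ultimately have "T \<in> commutant (commutant (range \<pi>))"
    using add scale by (auto simp: commutant_def[of "commutant (range \<pi>)"] complex_linear_def)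
  then show ?thesis using rep_bicommutant by blast
qed

lemma qf_strong_limit:
  assumes "\<And>\<xi>. (\<lambda>n. \<pi> (b n) \<xi>) \<longlonglongrightarrow> \<pi> x \<xi>"
  shows "(\<lambda>n. qf (b n) \<xi>) \<longlonglongrightarrow> qf x \<xi>"
  unfolding qf_def by (intro tendsto_Re tendsto_cinner assms tendsto_const)

lemma selfadjoint_strong_limit:
  assumes lim: "\<And>\<xi>. (\<lambda>n. \<pi> (b n) \<xi>) \<longlonglongrightarrow> \<pi> x \<xi>" and sa: "\<And>n. selfadjoint (b n)"
  shows "selfadjoint x"
proof (rule selfadjointI_quadratic)
  fix \<xi>
  have "(\<lambda>n. cinner (\<pi> (b n) \<xi>) \<xi>) \<longlonglongrightarrow> cinner (\<pi> x \<xi>) \<xi>"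
    by (intro tendsto_cinner lim tendsto_const)
  moreover have "(\<lambda>n. cinner (\<pi> (b n) \<xi>) \<xi>) \<longlonglongrightarrow> complex_of_real (qf x \<xi>)"
    unfolding cinner_selfadjoint[OF sa] by (intro tendsto_of_real qf_strong_limit lim)
  ultimately show "cinner (\<pi> x \<xi>) \<xi> = complex_of_real (qf x \<xi>)" by (rule LIMSEQ_unique)
qed

text \<open>For \<open>n \<le> m\<close> the difference \<open>b m - b n\<close> lies between 0 and
  1, so the square of its norm on a vector is at most the increment of the quadratic forms. These
  increase and are bounded, hence are Cauchy.\<close>

lemma monotone_strong_limit:
  assumes pos: "\<And>n. positive (b n)" and le1: "\<And>n. positive (1 - b n)"
    and mono: "\<And>n. positive (b (Suc n) - b n)"
  obtains x where "selfadjoint x" "\<And>\<xi>. (\<lambda>n. \<pi> (b n) \<xi>) \<longlonglongrightarrow> \<pi> x \<xi>" "\<And>\<xi>. (\<lambda>n. qf (b n) \<xi>) \<longlonglongrightarrow> qf x \<xi>"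
    "\<And>n \<xi>. qf (b n) \<xi> \<le> qf x \<xi>"
proof -
  have inc: "incseq (\<lambda>n. qf (b n) \<xi>)" for \<xi>
    using positive_diffD[OF mono] by (rule incseq_SucI)
  have sa: "selfadjoint (b n)" for n by (rule positive_selfadjoint[OF pos])
  have step: "(norm (\<pi> (b m) \<xi> - \<pi> (b n) \<xi>))\<^sup>2 \<le> qf (b m) \<xi> - qf (b n) \<xi>" if "n \<le> m" for m n \<xi>
  proof -
    have "positive (b m - b n)"
      using incseqD[OF inc that] by (intro positive_diffI sa)
    moreover have "positive (1 - (b m - b n))"
    proof (intro positive_diffI selfadjoint_diff sa selfadjoint_one)
      fix \<xi>
      show "qf (b m - b n) \<xi> \<le> qf 1 \<xi>"
        using positive_diffD[OF le1[of m], of \<xi>] positive_qf[OF pos[of n], of \<xi>] by (simp add: qf_diff)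
    qed
    ultimately show ?thesis using norm_rep_square_le_qf by (metis rep_diff qf_diff)
  qed
  have "convergent (\<lambda>n. \<pi> (b n) \<xi>)" for \<xi>
  proof -
    have "convergent (\<lambda>n. qf (b n) \<xi>)"
    proof (rule Bseq_mono_convergent)
      show "Bseq (\<lambda>n. qf (b n) \<xi>)"
        using positive_qf[OF pos] positive_diffD[OF le1] by (intro BseqI'[of _ "qf 1 \<xi>"]) simp
      show "\<forall>m n. m \<le> n \<longrightarrow> qf (b m) \<xi> \<le> qf (b n) \<xi>" using inc by (auto simp: incseq_def)
    qed
    then have C: "Cauchy (\<lambda>n. qf (b n) \<xi>)" by (rule convergent_Cauchy)
    have "Cauchy (\<lambda>n. \<pi> (b n) \<xi>)"
    proof (rule metric_CauchyI)
      fix e :: real assume e: "e > 0"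
      then obtain M where M: "\<And>m n. m \<ge> M \<Longrightarrow> n \<ge> M \<Longrightarrow> dist (qf (b m) \<xi>) (qf (b n) \<xi>) < e\<^sup>2"
        using metric_CauchyD[OF C, of "e\<^sup>2"] by auto
      have "dist (\<pi> (b m) \<xi>) (\<pi> (b n) \<xi>) < e" if "n \<ge> M" "m \<ge> n" for m n
      proof -
        have "(norm (\<pi> (b m) \<xi> - \<pi> (b n) \<xi>))\<^sup>2 < e\<^sup>2"
          using step[OF that(2), of \<xi>] M[of m n] that by (simp add: dist_real_def)
        then show ?thesis using e unfolding dist_norm by (rule power2_less_imp_less[OF _ less_imp_le])
      qed
      then show "\<exists>M. \<forall>m\<ge>M. \<forall>n\<ge>M. dist (\<pi> (b m) \<xi>) (\<pi> (b n) \<xi>) < e"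
        by (metis dist_commute nle_le)
    qed
    then show ?thesis by (simp add: Cauchy_convergent_iff)
  qed
  then obtain T where T: "\<And>\<xi>. (\<lambda>n. \<pi> (b n) \<xi>) \<longlonglongrightarrow> T \<xi>"
    unfolding convergent_def by metis
  have "norm (\<pi> (b n) \<xi>) \<le> 1 * norm \<xi>" for n \<xi>
  proof -
    have "(norm (\<pi> (b n) \<xi>))\<^sup>2 \<le> (norm \<xi>)\<^sup>2"
      using norm_rep_square_le_qf[OF pos le1, of n \<xi>] positive_diffD[OF le1, of n \<xi>]
      unfolding qf_one by (rule order_trans)
    then have "norm (\<pi> (b n) \<xi>) \<le> norm \<xi>" by (rule power2_le_imp_le) simp
    then show ?thesis by simp
  qed
  then obtain x where "T = \<pi> x" using strong_limit_exists[OF T, of 1] by blast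
  then have lim: "(\<lambda>n. \<pi> (b n) \<xi>) \<longlonglongrightarrow> \<pi> x \<xi>" for \<xi> using T by simp
  show ?thesis
  proof (rule that)
    show "selfadjoint x" using lim sa by (rule selfadjoint_strong_limit)
    show "qf (b n) \<xi> \<le> qf x \<xi>" for n \<xi>
      using incseq_le[OF inc qf_strong_limit[OF lim]] .
  qed (intro lim qf_strong_limit)+
qed

end

section \<open>The spectral theorem\<close>

subsection \<open>Additive interval functions\<close>

text \<open>Both functions are squeezed between the lower and the upper Riemann sums of \<open>F\<close>.\<close>

lemma interval_function_unique:
  fixes F :: "real \<Rightarrow> real" and L M :: "real \<Rightarrow> real \<Rightarrow> real"
  assumes "A \<le> B"
    and L: "\<And>r s. r \<le> s \<Longrightarrow> (s - r) * F s \<le> L r s" "\<And>r s. r \<le> s \<Longrightarrow> L r s \<le> (s - r) * F r"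
      "\<And>r s u. r \<le> s \<Longrightarrow> s \<le> u \<Longrightarrow> L r u = L r s + L s u"
    and M: "\<And>r s. r \<le> s \<Longrightarrow> (s - r) * F s \<le> M r s" "\<And>r s. r \<le> s \<Longrightarrow> M r s \<le> (s - r) * F r"
      "\<And>r s u. r \<le> s \<Longrightarrow> s \<le> u \<Longrightarrow> M r u = M r s + M s u"
  shows "L A B = M A B"
proof -
  \<comment> \<open>On each of \<open>Suc n\<close> equal cells of width \<open>d\<close> both
    functions lie in a common interval of length \<open>d\<close> times the drop of
    \<open>F\<close>; the drops telescope to \<open>F A - F B\<close>.\<close>
  have "\<bar>L A B - M A B\<bar> \<le> (B - A) * (F A - F B) / real (Suc n)" for n
  proof -
    define d where "d = (B - A) / real (Suc n)"
    have d0: "0 \<le> d" using assms(1) by (simp add: d_def)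
    have "\<bar>L A (A + real k * d) - M A (A + real k * d)\<bar> \<le> d * (F A - F (A + real k * d))" for k
    proof (induction k)
      case 0
      then show ?case using L(1,2)[of A A] M(1,2)[of A A] by simp
    next
      case (Suc k)
      let ?s = "A + real k * d" and ?u = "A + real (Suc k) * d"
      have s: "A \<le> ?s" using d0 by simp
      have "?u = ?s + d" by (simp add: algebra_simps)
      then have "?s \<le> ?u" "?u - ?s = d" using d0 by auto
      then show ?case
        using Suc L(3)[OF s \<open>?s \<le> ?u\<close>] M(3)[OF s \<open>?s \<le> ?u\<close>]
          L(1,2)[OF \<open>?s \<le> ?u\<close>] M(1,2)[OF \<open>?s \<le> ?u\<close>]
        by (simp add: right_diff_distrib)
    qed
    from this[of "Suc n"] show ?thesis by (simp add: d_def)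
  qed
  moreover have "(\<lambda>n. (B - A) * (F A - F B) / real (Suc n)) \<longlonglongrightarrow> 0"
    by (rule LIMSEQ_Suc[OF lim_const_over_n])
  ultimately have "\<bar>L A B - M A B\<bar> \<le> 0"
    by (intro LIMSEQ_le_const) auto
  then show ?thesis by simp
qed

section \<open>Ramps and steps: continuous companions of half-line indicators\<close>

text \<open>For \<open>r \<le> s\<close> this is the integral over \<open>\<gamma>\<close> from
  \<open>r\<close> to \<open>s\<close> of the indicator of \<open>t > \<gamma>\<close>, which
  explains additivity in the interval and the two bounds by multiples of indicators.\<close>

definition ramp :: "real \<Rightarrow> real \<Rightarrow> real \<Rightarrow> real" where
  "ramp r s t = min (max (t - r) 0) (s - r)"

lemma ramp_add: "r \<le> s \<Longrightarrow> s \<le> u \<Longrightarrow> ramp r u t = ramp r s t + ramp s u t"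
  by (auto simp: ramp_def min_def max_def)

lemma ramp_nonneg: "r \<le> s \<Longrightarrow> 0 \<le> ramp r s t"
  and ramp_le: "ramp r s t \<le> s - r"
  and ramp_eq_zero: "r \<le> s \<Longrightarrow> t \<le> r \<Longrightarrow> ramp r s t = 0"
  and ramp_eq_max: "r \<le> s \<Longrightarrow> s \<le> t \<Longrightarrow> ramp r s t = s - r"
  and ramp_eq_diff: "r \<le> t \<Longrightarrow> t \<le> s \<Longrightarrow> ramp r s t = t - r"
  by (auto simp: ramp_def)

lemma ramp_mono: "t \<le> u \<Longrightarrow> ramp r s t \<le> ramp r s u"
  by (auto simp: ramp_def)

lemma continuous_on_ramp: "continuous_on S (ramp r s)"
  unfolding ramp_def by (intro continuous_intros)

text \<open>As \<open>n\<close> grows these increase pointwise to the indicator of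
  \<open>t > s\<close>; the slope is \<open>Suc n\<close>, so that it is positive from the
  start.\<close>

definition step :: "nat \<Rightarrow> real \<Rightarrow> real \<Rightarrow> real" where
  "step n s t = min (max (real (Suc n) * (t - s)) 0) 1"

lemma continuous_on_step: "continuous_on S (step n s)"
  unfolding step_def by (intro continuous_intros)

lemma step_nonneg: "0 \<le> step n s t"
  and step_le_one: "step n s t \<le> 1"
  by (auto simp: step_def)

lemma step_eq_zero: "t \<le> s \<Longrightarrow> step n s t = 0"
  by (auto simp: step_def max_def mult_le_0_iff)

lemma step_eq_one: "1 \<le> real (Suc n) * (t - s) \<Longrightarrow> step n s t = 1"
  by (auto simp: step_def)

lemma step_mono: "r \<le> s \<Longrightarrow> step n s t \<le> step n r t"
  unfolding step_def by (intro min.mono max.mono mult_left_mono) auto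

lemma step_Suc: "step n s t \<le> step (Suc n) s t"
proof (cases "t \<le> s")
  case False
  then have "real (Suc n) * (t - s) \<le> real (Suc (Suc n)) * (t - s)" by (intro mult_right_mono) auto
  then show ?thesis unfolding step_def by (intro min.mono max.mono) auto
qed (simp add: step_eq_zero)

lemma step_lipschitz: "r \<le> s \<Longrightarrow> step n r t - step n s t \<le> real (Suc n) * (s - r)"
proof -
  assume "r \<le> s"
  then have "0 \<le> real (Suc n) * (s - r)" by simp
  moreover have "real (Suc n) * (t - r) = real (Suc n) * (t - s) + real (Suc n) * (s - r)"
    by (simp add: algebra_simps)
  ultimately show ?thesis unfolding step_def by (auto simp: min_def max_def)
qed

text \<open>For indicators of half-lines the left side is zero. Here an error can occur only where
  \<open>s < t < r + 1 / Suc n\<close>, and there \<open>step m s\<close> is still at most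
  \<open>Suc m / Suc n\<close>. For fixed \<open>m\<close> the error vanishes uniformly in
  \<open>t\<close> as \<open>n\<close> grows.\<close>

lemma step_mult_complement:
  assumes "r \<le> s"
  shows "\<bar>step n r t * step m s t - step m s t\<bar> \<le> real (Suc m) / real (Suc n)"
proof (cases "t \<le> s \<or> 1 \<le> real (Suc n) * (t - r)")
  case True
  then show ?thesis
  proof
    assume "1 \<le> real (Suc n) * (t - r)"
    then show ?thesis by (simp add: step_eq_one)
  qed (simp add: step_eq_zero)
next
  case False
  then have "real (Suc n) * (t - r) < 1" "t > s" by auto
  then have "real (Suc n) * (t - s) < 1"
    using mult_left_mono[of "t - s" "t - r" "real (Suc n)"] assms by linarith
  then have "t - s \<le> 1 / real (Suc n)" by (simp add: field_simps)
  then have "real (Suc m) * (t - s) \<le> real (Suc m) * (1 / real (Suc n))" by (intro mult_left_mono) auto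
  moreover have "step m s t \<le> real (Suc m) * (t - s)" using False by (simp add: step_def)
  moreover have "\<bar>step n r t * step m s t - step m s t\<bar> \<le> step m s t"
    using mult_right_mono[OF step_le_one step_nonneg[of m s t], of n r t] step_nonneg[of n r t] step_nonneg[of m s t]
    by simp
  ultimately show ?thesis by simp
qed

lemma step_le_ramp: "r \<le> s \<Longrightarrow> (s - r) * step n s t \<le> ramp r s t"
proof (cases "t \<le> s")
  case False
  assume "r \<le> s"
  then show ?thesis using False mult_left_mono[OF step_le_one[of n s t], of "s - r"] by (simp add: ramp_eq_max)
qed (simp add: step_eq_zero ramp_nonneg)

text \<open>The second assumption makes the transition zone of \<open>step n r\<close> fit between
  \<open>r\<close> and \<open>s\<close>.\<close>

lemma ramp_le_step:
  assumes "r \<le> s" "1 \<le> real (Suc n) * (s - r)"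
  shows "ramp r s t \<le> (s - r) * step n r t"
proof (cases "t \<le> r \<or> s \<le> t")
  case True
  then show ?thesis
  proof
    assume "s \<le> t"
    then have "1 \<le> real (Suc n) * (t - r)"
      using assms mult_left_mono[of "s - r" "t - r" "real (Suc n)"] by linarith
    then show ?thesis by (simp add: step_eq_one ramp_le)
  qed (use assms(1) in \<open>simp add: ramp_eq_zero step_eq_zero\<close>)
next
  case False
  have "t - r \<le> (real (Suc n) * (s - r)) * (t - r)"
    using mult_right_mono[OF assms(2), of "t - r"] False by simp
  also have "\<dots> = (s - r) * (real (Suc n) * (t - r))" by (simp add: ac_simps)
  finally have "t - r \<le> (s - r) * (real (Suc n) * (t - r))" .
  then show ?thesis using False assms(1) by (auto simp: ramp_def step_def min_def)
qed

subsection \<open>Existence of spectral measures\<close>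

lemma borel_induct [consumes 1, case_names basic empty compl union]:
  assumes "X \<in> sets borel" and "\<And>s. P {s::real<..}" and "P {}"
    and "\<And>X. X \<in> sets borel \<Longrightarrow> P X \<Longrightarrow> P (UNIV - X)"
    and "\<And>A. disjoint_family A \<Longrightarrow> range A \<subseteq> sets borel \<Longrightarrow> (\<And>i. P (A i)) \<Longrightarrow> P (\<Union>i::nat. A i)"
  shows "P X"
proof -
  have b: "sets borel = sigma_sets UNIV (range greaterThan :: real set set)"
    by (subst borel_Ioi) simp
  have "{r<..} \<inter> {s<..} = {max r s<..}" for r s :: real by auto
  then have st: "Int_stable (range greaterThan :: real set set)"
    by (auto simp: Int_stable_def)
  have "X \<in> sigma_sets UNIV (range greaterThan)" using assms(1) b by simp
  from st _ this show ?thesis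
  proof (rule sigma_sets_induct_disjoint)
    show "range greaterThan \<subseteq> Pow (UNIV :: real set)" by simp
    show "P A" if "A \<in> range greaterThan" for A using that assms(2) by auto
  qed (use assms(3-5) in \<open>simp_all only: b\<close>)
qed

text \<open>In this extension \<open>'a\<close> is the type of the algebra and \<open>'b\<close>
  that of the Hilbert space.\<close>

locale von_neumann_selfadjoint = von_neumann +
  fixes c :: 'a
  assumes c_sa: "selfadjoint c"
begin

lemma qf_cfc_mono:
  assumes "continuous_on (real_spectrum c) f" "continuous_on (real_spectrum c) g"
    and "\<And>t. t \<in> real_spectrum c \<Longrightarrow> f t \<le> g t"
  shows "qf (cfc f c) \<xi> \<le> qf (cfc g c) \<xi>"
proof -
  have "positive (cfc (\<lambda>t. g t - f t) c)"
    using assms by (intro positive_cfc[OF c_sa] continuous_intros) auto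
  then show ?thesis
    using positive_diffD[of "cfc g c" "cfc f c"] cfc_diff[OF c_sa assms(2,1)] by simp
qed

lemma cfc_step_bounds: "0 \<le> qf (cfc (step n s) c) \<xi>" "qf (cfc (step n s) c) \<xi> \<le> (norm \<xi>)\<^sup>2"
  using qf_cfc_mono[of "\<lambda>_. 0" "step n s" \<xi>] qf_cfc_mono[of "step n s" "\<lambda>_. 1" \<xi>]
  by (simp_all add: continuous_on_const continuous_on_step step_nonneg step_le_one cfc_const[OF c_sa] qf_zero qf_one)

lemma selfadjoint_cfc_step: "selfadjoint (cfc (step n s) c)"
  by (intro cfc_selfadjoint c_sa continuous_on_step)

section \<open>Projections belonging to upper half-lines\<close>

text \<open>This is the indicator of \<open>t > s\<close> evaluated at \<open>c\<close>, obtained as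
  the strong limit of the increasing sequence of its continuous approximations.\<close>

definition upper_projection :: "real \<Rightarrow> 'a" where
  "upper_projection s = (SOME p. selfadjoint p \<and> (\<forall>\<xi>. (\<lambda>n. \<pi> (cfc (step n s) c) \<xi>) \<longlonglongrightarrow> \<pi> p \<xi>) \<and>
     (\<forall>n \<xi>. qf (cfc (step n s) c) \<xi> \<le> qf p \<xi>))"

lemma upper_projection_props:
  "selfadjoint (upper_projection s) \<and> (\<forall>\<xi>. (\<lambda>n. \<pi> (cfc (step n s) c) \<xi>) \<longlonglongrightarrow> \<pi> (upper_projection s) \<xi>) \<and>
     (\<forall>n \<xi>. qf (cfc (step n s) c) \<xi> \<le> qf (upper_projection s) \<xi>)"
  unfolding upper_projection_def
proof (rule someI_ex, rule monotone_strong_limit)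
  show "positive (cfc (step n s) c)" for n
    by (intro positive_cfc c_sa continuous_on_step step_nonneg)
  show "positive (1 - cfc (step n s) c)" for n
    by (intro positive_diffI selfadjoint_cfc_step selfadjoint_one) (simp add: cfc_step_bounds qf_one)
  show "positive (cfc (step (Suc n) s) c - cfc (step n s) c)" for n
    by (intro positive_diffI selfadjoint_cfc_step qf_cfc_mono continuous_on_step step_Suc)
qed blast

lemma selfadjoint_upper_projection: "selfadjoint (upper_projection s)"
  and upper_projection_limit: "(\<lambda>n. \<pi> (cfc (step n s) c) \<xi>) \<longlonglongrightarrow> \<pi> (upper_projection s) \<xi>"
  and qf_step_le_upper_projection: "qf (cfc (step n s) c) \<xi> \<le> qf (upper_projection s) \<xi>"
  using upper_projection_props by blast+

lemma qf_upper_projection_limit: "(\<lambda>n. qf (cfc (step n s) c) \<xi>) \<longlonglongrightarrow> qf (upper_projection s) \<xi>"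
  by (intro qf_strong_limit upper_projection_limit)

lemma qf_upper_projection_le: "qf (upper_projection s) \<xi> \<le> (norm \<xi>)\<^sup>2"
  using cfc_step_bounds by (intro LIMSEQ_le_const2[OF qf_upper_projection_limit]) auto

lemma qf_upper_projection_mono: "r \<le> s \<Longrightarrow> qf (upper_projection s) \<xi> \<le> qf (upper_projection r) \<xi>"
  by (intro LIMSEQ_le[OF qf_upper_projection_limit qf_upper_projection_limit] exI[of _ 0] allI impI
      qf_cfc_mono continuous_on_step step_mono)

text \<open>The two approximations are removed one after the other: with \<open>m\<close> fixed, the
  uniform error \<open>Suc m / Suc n\<close> disappears as \<open>n\<close> grows, and afterwards
  \<open>m\<close> is sent to infinity.\<close>

lemma upper_projection_mult:
  assumes "r \<le> s"
  shows "upper_projection r * upper_projection s = upper_projection s"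
proof (rule rep_eqI)
  fix \<xi>
  have eq: "\<pi> (upper_projection r) (\<pi> (cfc (step m s) c) \<xi>) = \<pi> (cfc (step m s) c) \<xi>" for m
  proof -
    let ?b = "cfc (step m s) c"
    have "norm (cfc (step n r) c * ?b - ?b) \<le> real (Suc m) / real (Suc n)" for n
    proof -
      have "norm (cfc (\<lambda>t. step n r t * step m s t) c - ?b) \<le> real (Suc m) / real (Suc n)"
        by (intro norm_cfc_diff_le c_sa continuous_on_step continuous_on_mult step_mult_complement assms)
      then show ?thesis by (simp add: cfc_mult[OF c_sa] continuous_on_step)
    qed
    then have le: "norm (\<pi> (cfc (step n r) c) (\<pi> ?b \<xi>) - \<pi> ?b \<xi>) \<le> real (Suc m) * norm \<xi> / real (Suc n)" for n
      using order_trans[OF norm_rep_le mult_right_mono[OF _ norm_ge_zero], of "cfc (step n r) c * ?b - ?b" "real (Suc m) / real (Suc n)" \<xi>]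
      by (simp add: rep_diff rep_mult)
    have "(\<lambda>n. \<pi> (cfc (step n r) c) (\<pi> ?b \<xi>)) \<longlonglongrightarrow> \<pi> ?b \<xi>"
    proof (rule LIM_zero_cancel, rule Lim_null_comparison)
      show "(\<lambda>n. real (Suc m) * norm \<xi> / real (Suc n)) \<longlonglongrightarrow> 0" by (rule LIMSEQ_Suc[OF lim_const_over_n])
    qed (use le in auto)
    then show ?thesis by (rule LIMSEQ_unique[OF upper_projection_limit])
  qed
  have "(\<lambda>m. \<pi> (upper_projection r) (\<pi> (cfc (step m s) c) \<xi>)) \<longlonglongrightarrow> \<pi> (upper_projection r) (\<pi> (upper_projection s) \<xi>)"
    by (intro bounded_linear.tendsto[OF rep_bounded_linear] upper_projection_limit)
  then have "(\<lambda>m. \<pi> (cfc (step m s) c) \<xi>) \<longlonglongrightarrow> \<pi> (upper_projection r) (\<pi> (upper_projection s) \<xi>)"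
    by (simp only: eq)
  then have "\<pi> (upper_projection s) \<xi> = \<pi> (upper_projection r) (\<pi> (upper_projection s) \<xi>)"
    by (rule LIMSEQ_unique[OF upper_projection_limit])
  then show "\<pi> (upper_projection r * upper_projection s) \<xi> = \<pi> (upper_projection s) \<xi>"
    by (simp add: rep_mult)
qed

lemma upper_projection_mult_max: "upper_projection r * upper_projection s = upper_projection (max r s)"
proof (cases "r \<le> s")
  case False
  then have "star (upper_projection s * upper_projection r) = upper_projection r"
    using upper_projection_mult[of s r] selfadjointD[OF selfadjoint_upper_projection] by simp
  then show ?thesis using False selfadjointD[OF selfadjoint_upper_projection] by (simp add: star_mult max_def)
qed (simp add: upper_projection_mult max_def)

lemma qf_upper_projection_low:
  assumes "s < - norm c"
  shows "qf (upper_projection s) \<xi> = (norm \<xi>)\<^sup>2"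
proof -
  \<comment> \<open>The slope is chosen so that the step has reached 1 before
    \<open>- norm c\<close>, hence on all of the spectrum.\<close>
  obtain n where "1 / (- norm c - s) < real n" using reals_Archimedean2 by blast
  then have n: "1 \<le> real (Suc n) * (- norm c - s)" using assms by (simp add: field_simps)
  have "step n s t = 1" if "t \<in> real_spectrum c" for t
  proof (rule step_eq_one)
    have "- norm c - s \<le> t - s" using abs_real_spectrum_le[OF that] by linarith
    then show "1 \<le> real (Suc n) * (t - s)" using n mult_left_mono[of "- norm c - s" "t - s" "real (Suc n)"] by linarith
  qed
  then have "cfc (step n s) c = cfc (\<lambda>t. 1) c" by (intro cfc_cong c_sa continuous_on_const)
  then have "qf (cfc (step n s) c) \<xi> = (norm \<xi>)\<^sup>2" by (simp add: cfc_const[OF c_sa] qf_one)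
  then show ?thesis using qf_step_le_upper_projection[of n s \<xi>] qf_upper_projection_le[of s \<xi>] by simp
qed

lemma qf_upper_projection_high:
  assumes "norm c \<le> s"
  shows "qf (upper_projection s) \<xi> = 0"
proof -
  have "t \<le> s" if "t \<in> real_spectrum c" for t
    using abs_real_spectrum_le[OF that] assms by linarith
  then have "cfc (step n s) c = cfc (\<lambda>t. 0) c" for n
    by (intro cfc_cong c_sa continuous_on_const step_eq_zero)
  then show ?thesis using qf_upper_projection_limit[of s \<xi>] LIMSEQ_unique[OF tendsto_const]
    by (fastforce simp: cfc_const[OF c_sa] qf_zero)
qed

section \<open>The scalar distributions\<close>

text \<open>The function inside is the mass that \<open>(-\<infinity>, s]\<close> ought to have, so
  this Stieltjes measure is the candidate for the scalar spectral measure at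
  \<open>\<xi>\<close>.\<close>

definition distribution :: "'b \<Rightarrow> real measure" where
  "distribution \<xi> = interval_measure (\<lambda>s. (norm \<xi>)\<^sup>2 - qf (upper_projection s) \<xi>)"

lemma sets_distribution: "sets (distribution \<xi>) = sets borel"
  and space_distribution: "space (distribution \<xi>) = UNIV"
  by (simp_all add: distribution_def)

text \<open>One fixed approximation \<open>step n s\<close> already comes close to the limit at
  \<open>s\<close>, and moving its jump point to a nearby \<open>r > s\<close> costs at most
  \<open>(r - s) * Suc n\<close> in norm. Monotonicity supplies the other inequality.\<close>

lemma upper_projection_right_continuous:
  "continuous (at_right s) (\<lambda>s. (norm \<xi>)\<^sup>2 - qf (upper_projection s) \<xi>)"
proof -
  have "((\<lambda>r. qf (upper_projection r) \<xi>) \<longlongrightarrow> qf (upper_projection s) \<xi>) (at_right s)"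
  proof (rule tendstoI)
    fix e :: real assume e: "e > 0"
    then obtain n where "dist (qf (cfc (step n s) c) \<xi>) (qf (upper_projection s) \<xi>) < e / 2"
      using metric_LIMSEQ_D[OF qf_upper_projection_limit, of "e / 2"] by fastforce
    then have n: "qf (upper_projection s) \<xi> < qf (cfc (step n s) c) \<xi> + e / 2"
      unfolding dist_real_def by linarith
    \<comment> \<open>The summand 1 keeps \<open>K\<close> positive also for
      \<open>\<xi> = 0\<close>.\<close>
    define K where "K = real (Suc n) * (norm \<xi>)\<^sup>2 + 1"
    have K: "K > 0" by (simp add: K_def add_nonneg_pos)
    have "eventually (\<lambda>r. r \<in> {s<..<s + e / (2 * K)}) (at_right s)"
      using e K by (intro eventually_at_right_real) simp
    then show "eventually (\<lambda>r. dist (qf (upper_projection r) \<xi>) (qf (upper_projection s) \<xi>) < e) (at_right s)"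
    proof eventually_elim
      case (elim r)
      then have sr: "s \<le> r" and rs: "(r - s) * K < e / 2" using K by (auto simp: field_simps)
      have "cfc (\<lambda>t. step n s t - real (Suc n) * (r - s)) c = cfc (step n s) c - (real (Suc n) * (r - s)) *\<^sub>R 1"
        by (simp add: cfc_diff[OF c_sa] cfc_const[OF c_sa] continuous_on_step continuous_on_const)
      moreover have "qf (cfc (\<lambda>t. step n s t - real (Suc n) * (r - s)) c) \<xi> \<le> qf (cfc (step n r) c) \<xi>"
        using step_lipschitz[OF sr, of n] by (intro qf_cfc_mono continuous_intros continuous_on_step) (simp add: algebra_simps)
      ultimately have "qf (cfc (step n s) c) \<xi> - (r - s) * (real (Suc n) * (norm \<xi>)\<^sup>2) \<le> qf (cfc (step n r) c) \<xi>"
        by (simp add: qf_diff qf_scaleR qf_one ac_simps)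
      moreover have "(r - s) * (real (Suc n) * (norm \<xi>)\<^sup>2) \<le> (r - s) * K"
        using sr by (intro mult_left_mono) (auto simp: K_def)
      ultimately have "qf (upper_projection s) \<xi> - e < qf (upper_projection r) \<xi>"
        using n rs qf_step_le_upper_projection[of n r \<xi>] by linarith
      then show ?case using qf_upper_projection_mono[OF sr, of \<xi>] by (simp add: dist_real_def)
    qed
  qed
  then show ?thesis unfolding continuous_within by (intro tendsto_intros)
qed

lemma emeasure_distribution_Ioc:
  assumes "r \<le> s"
  shows "emeasure (distribution \<xi>) {r<..s} = ennreal (qf (upper_projection r) \<xi> - qf (upper_projection s) \<xi>)"
  unfolding distribution_def
  using emeasure_interval_measure_Ioc[OF assms _ upper_projection_right_continuous, of \<xi>] qf_upper_projection_mono
  by simp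

lemma emeasure_distribution_Ioi: "emeasure (distribution \<xi>) {s<..} = ennreal (qf (upper_projection s) \<xi>)"
proof -
  have "(\<lambda>n. emeasure (distribution \<xi>) {s<..s + real n}) \<longlonglongrightarrow> emeasure (distribution \<xi>) (\<Union>n. {s<..s + real n})"
    by (rule Lim_emeasure_incseq) (auto simp: sets_distribution incseq_def)
  moreover have "(\<Union>n. {s<..s + real n}) = {s<..}"
  proof safe
    fix x assume "x > s"
    then show "x \<in> (\<Union>n. {s<..s + real n})" using real_arch_simple[of "x - s"] by (auto simp: algebra_simps)
  qed auto
  moreover have "eventually (\<lambda>n. emeasure (distribution \<xi>) {s<..s + real n} = ennreal (qf (upper_projection s) \<xi>)) sequentially"
  proof -
    obtain N where N: "norm c - s \<le> real N" using real_arch_simple by blast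
    show ?thesis using eventually_ge_at_top[of N]
    proof eventually_elim
      case (elim n)
      then have "norm c \<le> s + real n" using N by linarith
      then show ?case by (simp add: emeasure_distribution_Ioc qf_upper_projection_high)
    qed
  qed
  ultimately show ?thesis using LIMSEQ_unique tendsto_eventually by metis
qed

lemma emeasure_distribution_UNIV: "emeasure (distribution \<xi>) UNIV = ennreal ((norm \<xi>)\<^sup>2)"
proof -
  have "(\<lambda>n. emeasure (distribution \<xi>) {- real n<..}) \<longlonglongrightarrow> emeasure (distribution \<xi>) (\<Union>n. {- real n<..})"
    by (rule Lim_emeasure_incseq) (auto simp: sets_distribution incseq_def)
  moreover have "(\<Union>n. {- real n<..}) = UNIV"
    using reals_Archimedean2 by (auto simp: minus_less_iff)
  moreover have "eventually (\<lambda>n. emeasure (distribution \<xi>) {- real n<..} = ennreal ((norm \<xi>)\<^sup>2)) sequentially"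
  proof -
    obtain N where N: "norm c < real N" using reals_Archimedean2 by blast
    show ?thesis using eventually_ge_at_top[of N]
    proof eventually_elim
      case (elim n)
      then have "- real n < - norm c" using N by linarith
      then show ?case by (simp add: emeasure_distribution_Ioi qf_upper_projection_low)
    qed
  qed
  ultimately show ?thesis using LIMSEQ_unique tendsto_eventually by metis
qed

lemma finite_measure_distribution: "finite_measure (distribution \<xi>)"
  by (rule finite_measureI) (simp add: space_distribution emeasure_distribution_UNIV)

lemma measure_distribution_UNIV: "measure (distribution \<xi>) UNIV = (norm \<xi>)\<^sup>2"
  by (simp add: measure_def emeasure_distribution_UNIV)

lemma measure_distribution_Ioi: "measure (distribution \<xi>) {s<..} = qf (upper_projection s) \<xi>"
proof -
  have "0 \<le> qf (upper_projection s) \<xi>"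
    using qf_step_le_upper_projection[of 0 s \<xi>] cfc_step_bounds(1)[of 0 s \<xi>] by linarith
  then show ?thesis by (simp add: measure_def emeasure_distribution_Ioi)
qed

lemma measure_distribution_le: "measure (distribution \<xi>) X \<le> (norm \<xi>)\<^sup>2"
  using finite_measure.bounded_measure[OF finite_measure_distribution, of \<xi> X]
  by (simp add: space_distribution measure_distribution_UNIV)

lemma measure_distribution_sums:
  assumes "disjoint_family A" "range A \<subseteq> sets borel"
  shows "(\<lambda>i. measure (distribution \<xi>) (A i)) sums measure (distribution \<xi>) (\<Union>i. A i)"
  by (rule measure_UNION)
    (use assms finite_measure.emeasure_finite[OF finite_measure_distribution] in \<open>auto simp: sets_distribution\<close>)

section \<open>From half-lines to all Borel sets\<close>

text \<open>Nothing about projections is asked yet: the sets that admit such an operator form a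
  Dynkin system containing the half-lines, and the operator is determined by its quadratic
  form.\<close>

definition represents :: "'a \<Rightarrow> real set \<Rightarrow> bool" where
  "represents b X \<longleftrightarrow> selfadjoint b \<and> (\<forall>\<xi>. qf b \<xi> = measure (distribution \<xi>) X)"

text \<open>The quadratic forms of the partial sums are partial sums of a measure of total mass
  \<open>(norm \<xi>)\<^sup>2\<close>. So the partial sums increase between 0 and 1, and their
  strong limit represents the union.\<close>

lemma represents_disjoint_union:
  assumes A: "disjoint_family A" "range A \<subseteq> sets borel" and b: "\<And>i. represents (b i) (A i)"
  obtains x where "represents x (\<Union>i. A i)" "\<And>\<xi>. (\<lambda>i. \<pi> (b i) \<xi>) sums \<pi> x \<xi>"
proof -
  define B where "B n = (\<Sum>i<n. b i)" for n
  have sa: "selfadjoint (B n)" for n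
    unfolding B_def using b
    by (induction n) (auto simp: represents_def intro: selfadjoint_add selfadjoint_zero)
  have qf_B: "qf (B n) \<xi> = (\<Sum>i<n. measure (distribution \<xi>) (A i))" for n \<xi>
    using b by (simp add: B_def qf_sum represents_def)
  have le: "qf (B n) \<xi> \<le> (norm \<xi>)\<^sup>2" for n \<xi>
  proof -
    have "(\<Sum>i<n. measure (distribution \<xi>) (A i)) \<le> measure (distribution \<xi>) (\<Union>i. A i)"
      using measure_distribution_sums[OF A, of \<xi>] sum_le_suminf[of "\<lambda>i. measure (distribution \<xi>) (A i)" "{..<n}"]
      by (auto simp: sums_iff)
    then show ?thesis using measure_distribution_le qf_B by (metis order_trans)
  qed
  have pos: "positive (B n)" for n
    by (intro positiveI sa) (simp add: qf_B sum_nonneg)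
  have le1: "positive (1 - B n)" for n
    by (intro positive_diffI selfadjoint_one sa) (simp add: qf_one le)
  have inc: "positive (B (Suc n) - B n)" for n
    by (intro positive_diffI sa) (simp add: qf_B)
  have "\<exists>x. selfadjoint x \<and> (\<forall>\<xi>. (\<lambda>n. \<pi> (B n) \<xi>) \<longlonglongrightarrow> \<pi> x \<xi>) \<and> (\<forall>\<xi>. (\<lambda>n. qf (B n) \<xi>) \<longlonglongrightarrow> qf x \<xi>)"
    by (rule monotone_strong_limit[of B, OF pos le1 inc]) blast
  then obtain x where x: "selfadjoint x" "\<And>\<xi>. (\<lambda>n. \<pi> (B n) \<xi>) \<longlonglongrightarrow> \<pi> x \<xi>" "\<And>\<xi>. (\<lambda>n. qf (B n) \<xi>) \<longlonglongrightarrow> qf x \<xi>"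
    by blast
  have "qf x \<xi> = measure (distribution \<xi>) (\<Union>i. A i)" for \<xi>
    using x(3)[of \<xi>] measure_distribution_sums[OF A, of \<xi>] unfolding qf_B sums_def by (rule LIMSEQ_unique)
  then have "represents x (\<Union>i. A i)" using x(1) by (simp add: represents_def)
  moreover have "\<pi> (B n) \<xi> = (\<Sum>i<n. \<pi> (b i) \<xi>)" for n \<xi>
    by (induction n) (simp_all add: B_def rep_zero rep_add)
  ultimately show ?thesis using x(2) by (intro that) (simp_all add: sums_def)
qed

lemma represents_exists: "X \<in> sets borel \<Longrightarrow> \<exists>b. represents b X"
proof (induction rule: borel_induct)
  case (basic s)
  show ?case by (rule exI[of _ "upper_projection s"])
    (simp add: represents_def selfadjoint_upper_projection measure_distribution_Ioi)
next
  case empty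
  show ?case by (rule exI[of _ 0]) (simp add: represents_def selfadjoint_zero qf_zero)
next
  case (compl X)
  then obtain b where b: "represents b X" by blast
  have "measure (distribution \<xi>) (UNIV - X) = (norm \<xi>)\<^sup>2 - measure (distribution \<xi>) X" for \<xi>
    using finite_measure.finite_measure_compl[OF finite_measure_distribution, of X \<xi>] compl
    by (simp add: sets_distribution space_distribution measure_distribution_UNIV)
  then have "represents (1 - b) (UNIV - X)"
    using b by (simp add: represents_def selfadjoint_diff selfadjoint_one qf_diff qf_one)
  then show ?case by blast
next
  case (union A)
  then obtain b where "\<And>i. represents (b i) (A i)" by metis
  then show ?case using represents_disjoint_union[OF union(1,2)] by metis
qed

definition borel_projection :: "real set \<Rightarrow> 'a" where
  "borel_projection X = (SOME b. represents b X)"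

lemma represents_borel_projection: "X \<in> sets borel \<Longrightarrow> represents (borel_projection X) X"
  unfolding borel_projection_def using represents_exists by (rule someI_ex)

lemma represents_unique: "represents b X \<Longrightarrow> represents b' X \<Longrightarrow> b = b'"
  by (rule selfadjoint_eqI) (auto simp: represents_def)

lemma borel_projection_eqI: "X \<in> sets borel \<Longrightarrow> represents b X \<Longrightarrow> borel_projection X = b"
  using represents_unique represents_borel_projection by blast

lemma
  assumes "X \<in> sets borel"
  shows selfadjoint_borel_projection: "selfadjoint (borel_projection X)"
    and qf_borel_projection: "qf (borel_projection X) \<xi> = measure (distribution \<xi>) X"
  using represents_borel_projection[OF assms] by (simp_all add: represents_def)

lemma borel_projection_Ioi: "borel_projection {s<..} = upper_projection s"
  by (rule borel_projection_eqI)
    (simp_all add: represents_def selfadjoint_upper_projection measure_distribution_Ioi)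

lemma borel_projection_UNIV: "borel_projection UNIV = 1"
  by (rule borel_projection_eqI) (simp_all add: represents_def selfadjoint_one qf_one measure_distribution_UNIV)

lemma borel_projection_empty: "borel_projection {} = 0"
  by (rule borel_projection_eqI) (simp_all add: represents_def selfadjoint_zero qf_zero)

lemma borel_projection_Diff:
  assumes "X \<in> sets borel" "Y \<in> sets borel" "Y \<subseteq> X"
  shows "borel_projection (X - Y) = borel_projection X - borel_projection Y"
  using assms finite_measure.finite_measure_Diff[OF finite_measure_distribution]
  by (intro borel_projection_eqI)
    (simp_all add: represents_def selfadjoint_diff selfadjoint_borel_projection qf_diff qf_borel_projection sets_distribution)

lemma borel_projection_sums:
  assumes "disjoint_family A" "range A \<subseteq> sets borel"
  shows "(\<lambda>i. \<pi> (borel_projection (A i)) \<xi>) sums \<pi> (borel_projection (\<Union>i. A i)) \<xi>"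
proof -
  have "represents (borel_projection (A i)) (A i)" for i
    using assms(2) by (intro represents_borel_projection) auto
  then obtain x where x: "represents x (\<Union>i. A i)" "\<And>\<xi>. (\<lambda>i. \<pi> (borel_projection (A i)) \<xi>) sums \<pi> x \<xi>"
    using represents_disjoint_union[OF assms] by metis
  moreover have "borel_projection (\<Union>i. A i) = x"
    using assms(2) x(1) by (intro borel_projection_eqI) auto
  ultimately show ?thesis by simp
qed

lemma borel_projection_Int_induct:
  assumes Z: "Z \<in> sets borel" and X: "X \<in> sets borel"
    and base: "\<And>s. borel_projection ({s<..} \<inter> Z) = borel_projection {s<..} * borel_projection Z"
  shows "borel_projection (X \<inter> Z) = borel_projection X * borel_projection Z"
  using X
proof (induction rule: borel_induct)
  case (basic s)
  show ?case by (rule base)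
next
  case empty
  show ?case by (simp add: borel_projection_empty)
next
  case (compl X)
  have "(UNIV - X) \<inter> Z = Z - X \<inter> Z" by blast
  then have "borel_projection ((UNIV - X) \<inter> Z) = borel_projection Z - borel_projection X * borel_projection Z"
    using compl Z by (simp add: borel_projection_Diff)
  then show ?case
    using compl(1) borel_projection_Diff[of UNIV X] by (simp add: borel_projection_UNIV left_diff_distrib)
next
  case (union A)
  show ?case
  proof (rule rep_eqI)
    fix \<xi>
    have d: "disjoint_family (\<lambda>i. A i \<inter> Z)" using union(1) by (auto simp: disjoint_family_on_def)
    have s: "range (\<lambda>i. A i \<inter> Z) \<subseteq> sets borel" using union(2) Z by auto
    have "(\<lambda>i. \<pi> (borel_projection (A i \<inter> Z)) \<xi>) sums \<pi> (borel_projection (\<Union>i. A i \<inter> Z)) \<xi>"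
      by (rule borel_projection_sums[OF d s])
    then have "(\<lambda>i. \<pi> (borel_projection (A i)) (\<pi> (borel_projection Z) \<xi>)) sums \<pi> (borel_projection (\<Union>i. A i \<inter> Z)) \<xi>"
      by (simp add: union(3) rep_mult)
    moreover have "(\<Union>i. A i \<inter> Z) = (\<Union>i. A i) \<inter> Z" by blast
    ultimately show "\<pi> (borel_projection ((\<Union>i. A i) \<inter> Z)) \<xi>
        = \<pi> (borel_projection (\<Union>i. A i) * borel_projection Z) \<xi>"
      using sums_unique2 borel_projection_sums[OF union(1,2)] by (metis rep_mult)
  qed
qed

text \<open>Two half-lines multiply to the half-line at the maximum. The induction enlarges one
  factor to a Borel set, adjoints exchange the factors, and the induction enlarges the other.
  Idempotence is the case of equal sets.\<close>

lemma borel_projection_Int: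
  assumes X: "X \<in> sets borel" and Y: "Y \<in> sets borel"
  shows "borel_projection (X \<inter> Y) = borel_projection X * borel_projection Y"
proof (rule borel_projection_Int_induct[OF Y X])
  fix s
  have "borel_projection (Y \<inter> {s<..}) = borel_projection Y * borel_projection {s<..}"
  proof (rule borel_projection_Int_induct[OF _ Y])
    fix r
    have "{r<..} \<inter> {s<..} = {max r s<..}" by auto
    then show "borel_projection ({r<..} \<inter> {s<..}) = borel_projection {r<..} * borel_projection {s<..}"
      by (simp add: borel_projection_Ioi upper_projection_mult_max)
  qed simp
  then have "star (borel_projection (Y \<inter> {s<..})) = star (borel_projection {s<..}) * star (borel_projection Y)"
    by (simp add: star_mult selfadjointD selfadjoint_borel_projection Y)
  then show "borel_projection ({s<..} \<inter> Y) = borel_projection {s<..} * borel_projection Y"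
    using Y by (simp add: selfadjointD selfadjoint_borel_projection Int_commute)
qed

lemma projection_valued_measure_borel_projection: "projection_valued_measure \<pi> borel_projection"
  unfolding projection_valued_measure_def projection_def
  using selfadjointD[OF selfadjoint_borel_projection] borel_projection_Int borel_projection_UNIV borel_projection_sums
  by (metis inf.idem)

lemma scalar_measure_borel_projection: "scalar_measure \<pi> borel_projection \<xi> = distribution \<xi>"
proof -
  have "ennreal ((norm (\<pi> (borel_projection X) \<xi>))\<^sup>2) = emeasure (distribution \<xi>) X" if "X \<in> sets borel" for X
  proof -
    have "(norm (\<pi> (borel_projection X) \<xi>))\<^sup>2 = qf (borel_projection X) \<xi>"
      using qf_square[OF selfadjoint_borel_projection[OF that], of \<xi>] borel_projection_Int[OF that that] by simp
    then show ?thesis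
      using finite_measure.emeasure_eq_measure[OF finite_measure_distribution] by (simp add: qf_borel_projection[OF that])
  qed
  then have "scalar_measure \<pi> borel_projection \<xi> = measure_of UNIV (sets borel) (emeasure (distribution \<xi>))"
    unfolding scalar_measure_def
    by (intro measure_of_eq) (simp_all add: sets.sigma_sets_eq[of borel, simplified])
  also have "\<dots> = distribution \<xi>"
    using measure_of_of_measure[of "distribution \<xi>"] by (simp add: sets_distribution space_distribution)
  finally show ?thesis .
qed

section \<open>The integral representation\<close>

lemma qf_ramp_bounds:
  assumes "r \<le> s"
  shows "(s - r) * qf (upper_projection s) \<xi> \<le> qf (cfc (ramp r s) c) \<xi>"
    "qf (cfc (ramp r s) c) \<xi> \<le> (s - r) * qf (upper_projection r) \<xi>"
proof -
  have scale: "qf (cfc (\<lambda>t. (s - r) * step n q t) c) \<xi> = (s - r) * qf (cfc (step n q) c) \<xi>" for n q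
    by (simp add: cfc_scale[OF c_sa] continuous_on_step qf_scaleR)
  have cont: "continuous_on (real_spectrum c) (\<lambda>t. (s - r) * step n q t)" for n q
    by (intro continuous_intros continuous_on_step)
  have "(s - r) * qf (cfc (step n s) c) \<xi> \<le> qf (cfc (ramp r s) c) \<xi>" for n
    unfolding scale[symmetric] by (intro qf_cfc_mono cont continuous_on_ramp step_le_ramp assms)
  then show "(s - r) * qf (upper_projection s) \<xi> \<le> qf (cfc (ramp r s) c) \<xi>"
    by (intro LIMSEQ_le_const2[OF tendsto_mult_left[OF qf_upper_projection_limit]]) auto
  show "qf (cfc (ramp r s) c) \<xi> \<le> (s - r) * qf (upper_projection r) \<xi>"
  \<comment> \<open>For \<open>r = s\<close> no slope is steep enough for the comparison, but then
    the ramp is zero.\<close>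
  proof (cases "r = s")
    case True
    then have "cfc (ramp r s) c = cfc (\<lambda>t. 0) c"
      by (intro cfc_cong c_sa continuous_on_const) (simp add: ramp_def)
    then show ?thesis using True by (simp add: cfc_const[OF c_sa] qf_zero)
  next
    case False
    obtain n where "1 / (s - r) < real n" using reals_Archimedean2 by blast
    then have n: "1 \<le> real (Suc n) * (s - r)" using assms False by (simp add: field_simps)
    have "qf (cfc (ramp r s) c) \<xi> \<le> (s - r) * qf (cfc (step n r) c) \<xi>"
      unfolding scale[symmetric] by (intro qf_cfc_mono cont continuous_on_ramp ramp_le_step assms n)
    also have "\<dots> \<le> (s - r) * qf (upper_projection r) \<xi>"
      using assms by (intro mult_left_mono qf_step_le_upper_projection) auto
    finally show ?thesis .
  qed
qed

lemma integrable_ramp: "integrable (distribution \<xi>) (ramp r s)"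
proof (rule finite_measure.integrable_const_bound[OF finite_measure_distribution])
  show "AE t in distribution \<xi>. norm (ramp r s t) \<le> \<bar>s - r\<bar>"
    by (auto simp: ramp_def)
  show "ramp r s \<in> borel_measurable (distribution \<xi>)"
    using borel_measurable_continuous_onI[OF continuous_on_ramp]
    by (simp add: measurable_def sets_distribution space_distribution)
qed

lemma integral_ramp_bounds:
  assumes "r \<le> s"
  shows "(s - r) * qf (upper_projection s) \<xi> \<le> (\<integral>t. ramp r s t \<partial>distribution \<xi>)"
    "(\<integral>t. ramp r s t \<partial>distribution \<xi>) \<le> (s - r) * qf (upper_projection r) \<xi>"
proof -
  interpret finite_measure "distribution \<xi>" by (rule finite_measure_distribution)
  have int: "(\<integral>t. (s - r) * indicator {q<..} t \<partial>distribution \<xi>) = (s - r) * qf (upper_projection q) \<xi>" for q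
    by (simp add: space_distribution measure_distribution_Ioi)
  have intg: "integrable (distribution \<xi>) (\<lambda>t. (s - r) * indicator {q<..} t)" for q
    by (intro integrable_mult_right integrable_real_indicator) (auto simp: sets_distribution emeasure_distribution_Ioi)
  show "(s - r) * qf (upper_projection s) \<xi> \<le> (\<integral>t. ramp r s t \<partial>distribution \<xi>)"
    unfolding int[symmetric]
    by (intro integral_mono intg integrable_ramp) (use assms in \<open>auto simp: indicator_def ramp_eq_max ramp_nonneg\<close>)
  show "(\<integral>t. ramp r s t \<partial>distribution \<xi>) \<le> (s - r) * qf (upper_projection r) \<xi>"
    unfolding int[symmetric]
    by (intro integral_mono intg integrable_ramp) (use assms in \<open>auto simp: indicator_def ramp_eq_zero ramp_le\<close>)
qed

text \<open>For a ramp, the quadratic form of the calculus and the integral against the distribution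
  obey the same bounds and are both additive, so they agree. On a window around the spectrum the
  ramp is \<open>t - A\<close>, and the identity function follows.\<close>

lemma spectral_measure_of_borel_projection: "spectral_measure_of \<pi> c borel_projection"
  unfolding spectral_measure_of_def scalar_measure_borel_projection
proof (intro conjI allI projection_valued_measure_borel_projection)
  fix \<xi>
  interpret finite_measure "distribution \<xi>" by (rule finite_measure_distribution)
  \<comment> \<open>The margin puts \<open>A\<close> strictly below \<open>- norm c\<close>, as
    needed for the half-line above \<open>A\<close> to carry the full mass.\<close>
  define A B where "A = - norm c - 1" and "B = norm c + 1"
  have AB: "A \<le> B" by (simp add: A_def B_def add_nonneg_nonneg)
  have eq: "qf (cfc (ramp A B) c) \<xi> = (\<integral>t. ramp A B t \<partial>distribution \<xi>)"
  proof (rule interval_function_unique[OF AB qf_ramp_bounds _ integral_ramp_bounds])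
    fix r s u :: real assume rs: "r \<le> s" "s \<le> u"
    have "cfc (ramp r u) c = cfc (\<lambda>t. ramp r s t + ramp s u t) c"
      using rs by (intro cfc_cong c_sa continuous_intros continuous_on_ramp ramp_add)
    then show "qf (cfc (ramp r u) c) \<xi> = qf (cfc (ramp r s) c) \<xi> + qf (cfc (ramp s u) c) \<xi>"
      by (simp add: cfc_add[OF c_sa] continuous_on_ramp qf_add)
    show "(\<integral>t. ramp r u t \<partial>distribution \<xi>) = (\<integral>t. ramp r s t \<partial>distribution \<xi>) + (\<integral>t. ramp s u t \<partial>distribution \<xi>)"
      by (simp add: ramp_add[OF rs] integrable_ramp)
  qed
  have "cfc (ramp A B) c = cfc (\<lambda>t. t - A) c"
  proof (intro cfc_cong c_sa continuous_intros ramp_eq_diff)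
    fix t assume "t \<in> real_spectrum c"
    then show "A \<le> t" "t \<le> B" using abs_real_spectrum_le[of t c] by (auto simp: A_def B_def)
  qed
  also have "\<dots> = c - A *\<^sub>R 1"
    by (simp add: cfc_diff[OF c_sa] cfc_id[OF c_sa] cfc_const[OF c_sa] continuous_on_id continuous_on_const)
  finally have L: "qf (cfc (ramp A B) c) \<xi> = qf c \<xi> - A * (norm \<xi>)\<^sup>2" by (simp add: qf_diff qf_scaleR qf_one)
  have "{B<..} \<in> null_sets (distribution \<xi>)"
    using qf_upper_projection_high[of B \<xi>] by (intro null_setsI) (auto simp: emeasure_distribution_Ioi sets_distribution B_def)
  moreover have "UNIV - {A<..} \<in> null_sets (distribution \<xi>)"
  proof (rule null_setsI)
    have "measure (distribution \<xi>) (UNIV - {A<..}) = 0"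
      using finite_measure_compl[of "{A<..}"] qf_upper_projection_low[of A \<xi>]
      by (simp add: space_distribution sets_distribution measure_distribution_UNIV measure_distribution_Ioi A_def)
    then show "emeasure (distribution \<xi>) (UNIV - {A<..}) = 0" by (simp add: emeasure_eq_measure)
  qed (simp add: sets_distribution)
  ultimately have ae: "AE t in distribution \<xi>. ramp A B t = t - A"
    using AE_not_in[of "{B<..}" "distribution \<xi>"] AE_not_in[of "UNIV - {A<..}" "distribution \<xi>"]
    by (auto simp: ramp_eq_diff elim!: AE_mp)
  have meas: "(\<lambda>t. t) \<in> borel_measurable (distribution \<xi>)"
    by (simp add: measurable_def sets_distribution space_distribution)
  have "integrable (distribution \<xi>) (\<lambda>t. ramp A B t + A)"
    by (intro Bochner_Integration.integrable_add integrable_ramp) simp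
  then show intg: "integrable (distribution \<xi>) (\<lambda>t. t)"
    by (rule integrable_cong_AE_imp[OF _ meas]) (use ae in auto)
  have "(\<integral>t. ramp A B t \<partial>distribution \<xi>) = (\<integral>t. t - A \<partial>distribution \<xi>)"
    using ae meas integrable_ramp by (intro integral_cong_AE) auto
  also have "\<dots> = (\<integral>t. t \<partial>distribution \<xi>) - A * (norm \<xi>)\<^sup>2"
    using intg by (simp add: space_distribution measure_distribution_UNIV mult.commute)
  finally show "cinner (\<pi> c \<xi>) \<xi> = complex_of_real (\<integral>t. t \<partial>distribution \<xi>)"
    using eq L by (simp add: cinner_selfadjoint[OF c_sa])
qed

end

lemma (in von_neumann) spectral_measure_exists:
  assumes "selfadjoint c"
  shows "\<exists>E. spectral_measure_of \<pi> c E"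
proof -
  interpret von_neumann_selfadjoint \<pi> c using assms by unfold_locales
  show ?thesis using spectral_measure_of_borel_projection by blast
qed

subsection \<open>Spectral measures and the functional calculus\<close>

text \<open>Here \<open>E\<close> is an arbitrary spectral measure of \<open>c\<close> rather than
  the constructed one, since \<open>spectral_projection\<close> returns whichever measure the choice
  selects.\<close>

locale spectral_measure = von_neumann_selfadjoint +
  fixes E :: "real set \<Rightarrow> 'a"
  assumes spectral_measure: "spectral_measure_of \<pi> c E"
begin

lemma
  shows E_UNIV: "E UNIV = 1"
    and E_Int: "X \<in> sets borel \<Longrightarrow> Y \<in> sets borel \<Longrightarrow> E (X \<inter> Y) = E X * E Y"
    and E_sums: "range A \<subseteq> sets borel \<Longrightarrow> disjoint_family A \<Longrightarrow> (\<lambda>n. \<pi> (E (A n)) \<xi>) sums \<pi> (E (\<Union>n. A n)) \<xi>"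
    and E_integrable: "integrable (scalar_measure \<pi> E \<xi>) (\<lambda>s. s)"
    and E_integral: "cinner (\<pi> c \<xi>) \<xi> = complex_of_real (\<integral>s. s \<partial>scalar_measure \<pi> E \<xi>)"
  using spectral_measure by (auto simp: spectral_measure_of_def projection_valued_measure_def)

lemma
  assumes "X \<in> sets borel"
  shows selfadjoint_E: "selfadjoint (E X)" and E_idem: "E X * E X = E X"
  using assms spectral_measure
  by (auto simp: spectral_measure_of_def projection_valued_measure_def projection_def selfadjoint_def)

lemma qf_E: "X \<in> sets borel \<Longrightarrow> qf (E X) \<xi> = (norm (\<pi> (E X) \<xi>))\<^sup>2"
  using qf_square[OF selfadjoint_E] by (simp add: E_idem)

text \<open>The empty set is a disjoint union of countably many copies of itself, and a convergent
  series with constant terms has zero terms.\<close>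

lemma E_empty: "E {} = 0"
proof (rule rep_eqI)
  fix \<xi>
  have "(\<lambda>n::nat. \<pi> (E {}) \<xi>) sums \<pi> (E {}) \<xi>"
    using E_sums[of "\<lambda>_. {}" \<xi>] by (simp add: disjoint_family_on_def)
  then have "(\<lambda>n::nat. \<pi> (E {}) \<xi>) \<longlonglongrightarrow> 0" using summable_LIMSEQ_zero sums_summable by blast
  then show "\<pi> (E {}) \<xi> = \<pi> 0 \<xi>" using LIMSEQ_unique[OF tendsto_const] by (simp add: rep_zero)
qed

lemma E_compl:
  assumes X: "X \<in> sets borel"
  shows "E (UNIV - X) = 1 - E X"
proof (rule rep_eqI)
  fix \<xi>
  have "(\<lambda>n. \<pi> (E (binaryset X (UNIV - X) n)) \<xi>) sums \<pi> (E (\<Union>n. binaryset X (UNIV - X) n)) \<xi>"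
    using X by (intro E_sums) (auto simp: range_binaryset_eq disjoint_family_on_def binaryset_def)
  moreover have "(\<lambda>n. \<pi> (E (binaryset X (UNIV - X) n)) \<xi>) sums (\<pi> (E X) \<xi> + \<pi> (E (UNIV - X)) \<xi>)"
    by (rule binaryset_sums) (simp add: E_empty rep_zero)
  ultimately have "\<pi> (E (\<Union>n. binaryset X (UNIV - X) n)) \<xi> = \<pi> (E X) \<xi> + \<pi> (E (UNIV - X)) \<xi>"
    by (rule sums_unique2)
  then show "\<pi> (E (UNIV - X)) \<xi> = \<pi> (1 - E X) \<xi>"
    by (simp add: UN_binaryset_eq E_UNIV rep_one rep_diff eq_diff_eq add.commute)
qed

lemma sets_scalar_measure: "sets (scalar_measure \<pi> E \<xi>) = sets borel"
  and space_scalar_measure: "space (scalar_measure \<pi> E \<xi>) = UNIV"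
  unfolding scalar_measure_def using sets.sigma_sets_eq[of "borel :: real measure"] by simp_all

lemma emeasure_scalar_measure:
  assumes "X \<in> sets borel"
  shows "emeasure (scalar_measure \<pi> E \<xi>) X = ennreal ((norm (\<pi> (E X) \<xi>))\<^sup>2)"
  unfolding scalar_measure_def
proof (rule emeasure_measure_of_sigma[OF _ _ _ assms])
  show "sigma_algebra UNIV (sets (borel :: real measure))"
    using sets.sigma_algebra_axioms[of "borel :: real measure"] by simp
  show "Sigma_Algebra.positive (sets borel) (\<lambda>X. ennreal ((norm (\<pi> (E X) \<xi>))\<^sup>2))"
    by (simp add: Sigma_Algebra.positive_def E_empty rep_zero)
  show "countably_additive (sets borel) (\<lambda>X. ennreal ((norm (\<pi> (E X) \<xi>))\<^sup>2))"
  proof (rule countably_additiveI)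
    fix A :: "nat \<Rightarrow> real set"
    assume A: "range A \<subseteq> sets borel" "disjoint_family A" "(\<Union>i. A i) \<in> sets borel"
    have "(\<lambda>n. Re (cinner (\<Sum>i<n. \<pi> (E (A i)) \<xi>) \<xi>)) \<longlonglongrightarrow> qf (E (\<Union>i. A i)) \<xi>"
      unfolding qf_def using E_sums[OF A(1,2), of \<xi>]
      by (intro tendsto_Re tendsto_cinner tendsto_const) (simp add: sums_def)
    moreover have "Re (cinner (\<Sum>i<n. \<pi> (E (A i)) \<xi>) \<xi>) = (\<Sum>i<n. qf (E (A i)) \<xi>)" for n
      by (induction n) (simp_all add: cinner_zero_left cinner_add_left qf_def)
    ultimately have "(\<lambda>i. qf (E (A i)) \<xi>) sums qf (E (\<Union>i. A i)) \<xi>" by (simp add: sums_def)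
    moreover have "A i \<in> sets borel" for i using A(1) by auto
    ultimately have "(\<lambda>i. (norm (\<pi> (E (A i)) \<xi>))\<^sup>2) sums (norm (\<pi> (E (\<Union>i. A i)) \<xi>))\<^sup>2"
      using A(3) by (simp add: qf_E)
    then show "(\<Sum>i. ennreal ((norm (\<pi> (E (A i)) \<xi>))\<^sup>2)) = ennreal ((norm (\<pi> (E (\<Union>i. A i)) \<xi>))\<^sup>2)"
      by (intro suminf_ennreal_eq) auto
  qed
qed

lemma measure_scalar_measure: "X \<in> sets borel \<Longrightarrow> measure (scalar_measure \<pi> E \<xi>) X = (norm (\<pi> (E X) \<xi>))\<^sup>2"
  by (simp add: measure_def emeasure_scalar_measure)

lemma scalar_measure_E:
  assumes X: "X \<in> sets borel"
  shows "scalar_measure \<pi> E (\<pi> (E X) \<xi>) = density (scalar_measure \<pi> E \<xi>) (indicator X)"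
proof (rule measure_eqI)
  fix Y assume "Y \<in> sets (scalar_measure \<pi> E (\<pi> (E X) \<xi>))"
  then have Y: "Y \<in> sets borel" by (simp add: sets_scalar_measure)
  have "\<pi> (E Y) (\<pi> (E X) \<xi>) = \<pi> (E (X \<inter> Y)) \<xi>"
    using E_Int[OF Y X] by (simp add: rep_mult Int_commute)
  then show "emeasure (scalar_measure \<pi> E (\<pi> (E X) \<xi>)) Y = emeasure (density (scalar_measure \<pi> E \<xi>) (indicator X)) Y"
    using X Y by (subst emeasure_restricted) (simp_all add: sets_scalar_measure emeasure_scalar_measure)
qed (simp add: sets_scalar_measure)

lemma qf_integral: "qf c \<xi> = (\<integral>s. s \<partial>scalar_measure \<pi> E \<xi>)"
  by (simp add: qf_def E_integral)

lemma qf_E_integral: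
  assumes X: "X \<in> sets borel"
  shows "qf c (\<pi> (E X) \<xi>) = (\<integral>s. indicator X s * s \<partial>scalar_measure \<pi> E \<xi>)"
proof -
  have "(indicator X :: real \<Rightarrow> ennreal) = (\<lambda>s. ennreal (indicator X s))"
    by (auto simp: indicator_def)
  moreover have "(\<lambda>s. s) \<in> borel_measurable (scalar_measure \<pi> E \<xi>)"
    by (simp add: measurable_def sets_scalar_measure space_scalar_measure)
  moreover have "(indicator X :: real \<Rightarrow> real) \<in> borel_measurable (scalar_measure \<pi> E \<xi>)"
    using X by (intro borel_measurable_indicator) (simp add: sets_scalar_measure)
  ultimately show ?thesis
    unfolding qf_integral scalar_measure_E[OF X] by (simp add: integral_density)
qed

lemma integrable_indicator_mult:
  "X \<in> sets borel \<Longrightarrow> integrable (scalar_measure \<pi> E \<xi>) (\<lambda>s. indicator X s * s)"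
  using integrable_mult_indicator[OF _ E_integrable, of X \<xi>] by (simp add: sets_scalar_measure)

text \<open>The integral representation splits over \<open>X\<close> and its complement, so \<open>c\<close> is block diagonal.\<close>

lemma E_commute:
  assumes X: "X \<in> sets borel"
  shows "E X * c = c * E X"
proof -
  let ?q = "E X" and ?p = "E (UNIV - X)"
  have X': "UNIV - X \<in> sets borel" using X by simp
  have pq: "?q * ?p = 0" "?p * ?q = 0"
    using E_Int[OF X X'] E_Int[OF X' X] by (simp_all add: E_empty Int_commute[of "UNIV - X" X])
  have "c = ?q * c * ?q + ?p * c * ?p"
  proof (rule selfadjoint_eqI)
    fix \<xi>
    have "(\<lambda>s. s) = (\<lambda>s. indicator X s * s + indicator (UNIV - X) s * s)"
      by (auto simp: indicator_def)
    then have "qf c \<xi> = (\<integral>s. indicator X s * s + indicator (UNIV - X) s * s \<partial>scalar_measure \<pi> E \<xi>)"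
      using qf_integral by simp
    also have "\<dots> = qf c (\<pi> ?q \<xi>) + qf c (\<pi> ?p \<xi>)"
      by (simp add: qf_E_integral X X' integrable_indicator_mult)
    finally show "qf c \<xi> = qf (?q * c * ?q + ?p * c * ?p) \<xi>"
      by (simp add: qf_add qf_sandwich selfadjoint_E X X')
  qed (intro c_sa selfadjoint_add selfadjoint_sandwich selfadjoint_E X X')+
  then have "?q * c = ?q * (?q * c * ?q + ?p * c * ?p)" "c * ?q = (?q * c * ?q + ?p * c * ?p) * ?q"
    by simp_all
  moreover have "?q * (?q * c * ?q + ?p * c * ?p) = ?q * c * ?q"
  proof -
    have "?q * (?q * c * ?q + ?p * c * ?p) = (?q * ?q) * c * ?q + (?q * ?p) * c * ?p"
      by (simp only: distrib_left mult.assoc)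
    then show ?thesis by (simp add: pq E_idem X)
  qed
  moreover have "(?q * c * ?q + ?p * c * ?p) * ?q = ?q * c * ?q"
  proof -
    have "(?q * c * ?q + ?p * c * ?p) * ?q = ?q * c * (?q * ?q) + ?p * c * (?p * ?q)"
      by (simp only: distrib_right mult.assoc)
    then show ?thesis by (simp add: pq E_idem X)
  qed
  ultimately show ?thesis by simp
qed

lemma qf_E_lower: "s * (norm (\<pi> (E {s<..}) \<xi>))\<^sup>2 \<le> qf c (\<pi> (E {s<..}) \<xi>)"
  and qf_E_upper: "qf c (\<pi> (E (UNIV - {s<..})) \<xi>) \<le> s * (norm (\<pi> (E (UNIV - {s<..})) \<xi>))\<^sup>2"
proof -
  have int: "(\<integral>t. s * indicator X t \<partial>scalar_measure \<pi> E \<xi>) = s * (norm (\<pi> (E X) \<xi>))\<^sup>2" if "X \<in> sets borel" for X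
    using that by (simp add: space_scalar_measure measure_scalar_measure)
  have intg: "integrable (scalar_measure \<pi> E \<xi>) (\<lambda>t. s * indicator X t)" if "X \<in> sets borel" for X
    using that by (intro integrable_mult_right integrable_real_indicator) (auto simp: sets_scalar_measure emeasure_scalar_measure)
  show "s * (norm (\<pi> (E {s<..}) \<xi>))\<^sup>2 \<le> qf c (\<pi> (E {s<..}) \<xi>)"
    by (subst int[symmetric], simp, subst qf_E_integral, simp, intro integral_mono intg integrable_indicator_mult)
      (auto simp: indicator_def)
  show "qf c (\<pi> (E (UNIV - {s<..})) \<xi>) \<le> s * (norm (\<pi> (E (UNIV - {s<..})) \<xi>))\<^sup>2"
    by (subst int[symmetric], simp, subst qf_E_integral, simp, intro integral_mono intg integrable_indicator_mult)
      (auto simp: indicator_def)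
qed

text \<open>With \<open>d = \<plusminus>(c - s)\<close>, compressed to a spectral projection \<open>q\<close> on which it is positive, the
  negative part of \<open>d\<close> vanishes on the range of \<open>q\<close>.\<close>

lemma negative_part_vanishes:
  assumes q: "selfadjoint q" "q * q = q" "q * c = c * q"
    and u: "continuous_on (real_spectrum c) u" and d: "continuous_on (real_spectrum c) d"
    and ud: "\<And>t. t \<in> real_spectrum c \<Longrightarrow> 0 \<le> u t \<and> u t * d t = - (u t * u t)"
    and pos: "\<And>\<xi>. 0 \<le> qf (cfc d c) (\<pi> q \<xi>)"
  shows "\<pi> (cfc u c) (\<pi> q \<xi>) = 0"
proof -
  let ?u = "cfc u c" and ?d = "cfc d c"
  have comm: "q * ?u = ?u * q" "q * ?d = ?d * q" using cfc_comm[OF c_sa _ q(3)] u d by auto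
  have qdq: "q * ?d * q = q * ?d" using comm(2) q(2) by (metis mult.assoc)
  have "positive (q * ?d * q)"
    using pos by (intro positiveI selfadjoint_sandwich q cfc_selfadjoint c_sa d) (simp add: qf_sandwich q)
  then have p1: "positive (q * ?d)" by (simp only: qdq)
  have p2: "positive ?u" using ud by (intro positive_cfc c_sa u) auto
  have du: "?d * ?u = ?u * ?d" by (rule cfc_commute[OF c_sa d u])
  \<comment> \<open>As a product of commuting positive elements \<open>q * d * u\<close> is
    positive; it also equals minus the square of \<open>u * q\<close>, which must therefore
    vanish.\<close>
  have "q * ?d * ?u = ?u * (q * ?d)" using comm du by (metis mult.assoc)
  then have qdu: "positive (q * ?d * ?u)" by (rule positive_commuting_mult[OF p1 p2])
  have udu: "?u * ?d = - (?u * ?u)"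
  proof -
    have "?u * ?d = cfc (\<lambda>t. u t * d t) c" by (simp add: cfc_mult[OF c_sa u d])
    also have "\<dots> = cfc (\<lambda>t. - 1 * (u t * u t)) c"
      using ud by (intro cfc_cong c_sa continuous_intros u) auto
    also have "\<dots> = - (?u * ?u)"
      using cfc_scale[OF c_sa continuous_on_mult[OF u u], of "- 1"] cfc_mult[OF c_sa u u] by simp
    finally show ?thesis .
  qed
  have "q * ?d * ?u = 0 - (?u * q) * (?u * q)"
  proof -
    have "q * ?d * ?u = q * (?u * ?d)" by (simp only: du mult.assoc)
    also have "\<dots> = 0 - (q * q) * ?u * ?u" by (simp only: udu q(2) mult_minus_right diff_0 mult.assoc)
    also have "(q * q) * ?u * ?u = (?u * q) * (?u * q)" using comm(1) by (metis mult.assoc)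
    finally show ?thesis .
  qed
  then have "0 \<le> qf (0 - (?u * q) * (?u * q)) \<xi>" using positive_qf[OF qdu] by simp
  moreover have "selfadjoint (?u * q)"
    by (rule selfadjoint_mult[OF cfc_selfadjoint[OF c_sa u] q(1) comm(1)[symmetric]])
  ultimately have "(norm (\<pi> (?u * q) \<xi>))\<^sup>2 \<le> 0" by (simp only: qf_diff qf_zero qf_square)
  then show ?thesis by (simp add: rep_mult)
qed

lemma upper_part_vanishes: "\<pi> (cfc (\<lambda>t. max (t - r) 0) c) (\<pi> (E (UNIV - {r<..})) \<xi>) = 0"
proof (rule negative_part_vanishes[where d = "\<lambda>t. r - t"])
  show "0 \<le> qf (cfc (\<lambda>t. r - t) c) (\<pi> (E (UNIV - {r<..})) \<xi>)" for \<xi>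
    using qf_E_upper[of r \<xi>]
    by (simp add: cfc_diff[OF c_sa] cfc_const[OF c_sa] cfc_id[OF c_sa] continuous_on_const continuous_on_id
        qf_diff qf_scaleR qf_one)
  show "0 \<le> max (t - r) 0 \<and> max (t - r) 0 * (r - t) = - (max (t - r) 0 * max (t - r) 0)" for t
    by (simp add: max_def algebra_simps)
qed (auto intro!: selfadjoint_E E_idem E_commute continuous_intros)

lemma lower_part_vanishes: "\<pi> (cfc (\<lambda>t. max (s - t) 0) c) (\<pi> (E {s<..}) \<xi>) = 0"
proof (rule negative_part_vanishes[where d = "\<lambda>t. t - s"])
  show "0 \<le> qf (cfc (\<lambda>t. t - s) c) (\<pi> (E {s<..}) \<xi>)" for \<xi>
    using qf_E_lower[of s \<xi>]
    by (simp add: cfc_diff[OF c_sa] cfc_const[OF c_sa] cfc_id[OF c_sa] continuous_on_const continuous_on_id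
        qf_diff qf_scaleR qf_one)
  show "0 \<le> max (s - t) 0 \<and> max (s - t) 0 * (t - s) = - (max (s - t) 0 * max (s - t) 0)" for t
    by (simp add: max_def algebra_simps)
qed (auto intro!: selfadjoint_E E_idem E_commute continuous_intros)

lemma qf_cfc_split:
  assumes X: "X \<in> sets borel" and g: "continuous_on (real_spectrum c) g"
  shows "qf (cfc g c) \<xi> = qf (cfc g c) (\<pi> (E X) \<xi>) + qf (cfc g c) (\<pi> (E (UNIV - X)) \<xi>)"
proof -
  let ?q = "E X" and ?p = "E (UNIV - X)" and ?x = "cfc g c"
  have X': "UNIV - X \<in> sets borel" using X by simp
  have qx: "?q * ?x = ?x * ?q" and px: "?p * ?x = ?x * ?p"
    by (intro cfc_comm c_sa g E_commute X X')+
  have "?q * ?x * ?q = ?x * ?q" "?p * ?x * ?p = ?x * ?p"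
    using qx px E_idem[OF X] E_idem[OF X'] by (metis mult.assoc)+
  then have "?q * ?x * ?q + ?p * ?x * ?p = ?x"
    by (simp add: E_compl[OF X] right_diff_distrib)
  then have "qf ?x \<xi> = qf (?q * ?x * ?q) \<xi> + qf (?p * ?x * ?p) \<xi>" by (metis qf_add)
  then show ?thesis by (simp add: qf_sandwich selfadjoint_E X X')
qed

section \<open>Comparison of ramps with spectral projections\<close>

text \<open>On the range of \<open>E {r<..}\<close> the ramp is at most \<open>s - r\<close>. On the
  complementary range it is dominated by the positive part of \<open>t - r\<close>, which vanishes
  there.\<close>

lemma ramp_upper:
  assumes "r \<le> s"
  shows "positive ((s - r) *\<^sub>R E {r<..} - cfc (ramp r s) c)"
proof (intro positive_diffI selfadjoint_scaleR selfadjoint_E cfc_selfadjoint c_sa continuous_on_ramp)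
  fix \<xi>
  let ?q = "E {r<..}" and ?p = "E (UNIV - {r<..})"
  have "qf (cfc (ramp r s) c) (\<pi> ?p \<xi>) \<le> qf (cfc (\<lambda>t. max (t - r) 0) c) (\<pi> ?p \<xi>)"
    by (intro qf_cfc_mono continuous_on_ramp continuous_intros) (auto simp: ramp_def)
  also have "\<dots> = 0" by (simp add: qf_def upper_part_vanishes cinner_zero_left)
  finally have "qf (cfc (ramp r s) c) \<xi> \<le> qf (cfc (ramp r s) c) (\<pi> ?q \<xi>)"
    using qf_cfc_split[of "{r<..}" "ramp r s" \<xi>] by (simp add: continuous_on_ramp)
  also have "\<dots> \<le> qf (cfc (\<lambda>t. s - r) c) (\<pi> ?q \<xi>)"
    by (intro qf_cfc_mono continuous_on_ramp continuous_intros ramp_le)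
  also have "\<dots> = qf ((s - r) *\<^sub>R ?q) \<xi>"
    by (simp add: cfc_const[OF c_sa] qf_scaleR qf_one qf_E)
  finally show "qf (cfc (ramp r s) c) \<xi> \<le> qf ((s - r) *\<^sub>R ?q) \<xi>" .
qed simp

text \<open>On the range of \<open>E {s<..}\<close> the constant \<open>s - r\<close> is at most the
  ramp plus the positive part of \<open>s - t\<close>, and the latter vanishes there. On the
  complementary range the ramp is nonnegative.\<close>

lemma ramp_lower:
  assumes "r \<le> s"
  shows "positive (cfc (ramp r s) c - (s - r) *\<^sub>R E {s<..})"
proof (intro positive_diffI selfadjoint_scaleR selfadjoint_E cfc_selfadjoint c_sa continuous_on_ramp)
  fix \<xi>
  let ?q = "E {s<..}" and ?p = "E (UNIV - {s<..})"
  have c1: "continuous_on (real_spectrum c) (\<lambda>t. max (s - t) 0)" "continuous_on (real_spectrum c) (\<lambda>t. s - r)"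
    by (intro continuous_intros)+
  have "qf ((s - r) *\<^sub>R ?q) \<xi> = qf (cfc (\<lambda>t. s - r) c) (\<pi> ?q \<xi>)"
    by (simp add: cfc_const[OF c_sa] qf_scaleR qf_one qf_E)
  also have "\<dots> \<le> qf (cfc (\<lambda>t. ramp r s t + max (s - t) 0) c) (\<pi> ?q \<xi>)"
    using assms by (intro qf_cfc_mono continuous_intros continuous_on_ramp) (auto simp: ramp_def min_def max_def)
  also have "\<dots> = qf (cfc (ramp r s) c) (\<pi> ?q \<xi>)"
    unfolding cfc_add[OF c_sa continuous_on_ramp c1(1)] qf_add
    by (simp add: qf_def[of "cfc (\<lambda>t. max (s - t) 0) c"] lower_part_vanishes cinner_zero_left)
  also have "\<dots> \<le> qf (cfc (ramp r s) c) \<xi>"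
  proof -
    have "qf (cfc (\<lambda>t. 0) c) (\<pi> ?p \<xi>) \<le> qf (cfc (ramp r s) c) (\<pi> ?p \<xi>)"
      using assms by (intro qf_cfc_mono continuous_on_ramp continuous_intros ramp_nonneg)
    then show ?thesis
      using qf_cfc_split[of "{s<..}" "ramp r s" \<xi>] by (simp add: continuous_on_ramp cfc_const[OF c_sa] qf_zero)
  qed
  finally show "qf ((s - r) *\<^sub>R ?q) \<xi> \<le> qf (cfc (ramp r s) c) \<xi>" .
qed simp

lemma E_high:
  assumes "norm c < s"
  shows "E {s<..} = 0"
proof (rule selfadjoint_eqI)
  fix \<xi>
  have "cfc (ramp (norm c) s) c = cfc (\<lambda>t. 0) c"
  proof (intro cfc_cong c_sa continuous_on_const ramp_eq_zero)
    fix t assume "t \<in> real_spectrum c"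
    then show "t \<le> norm c" using abs_real_spectrum_le[of t c] by linarith
  qed (use assms in simp)
  then have "(s - norm c) * qf (E {s<..}) \<xi> \<le> 0"
    using positive_diffD[OF ramp_lower[of "norm c" s], of \<xi>] assms
    by (simp add: cfc_const[OF c_sa] qf_zero qf_scaleR)
  then have "qf (E {s<..}) \<xi> \<le> 0" using assms by (simp add: mult_le_0_iff)
  moreover have "0 \<le> qf (E {s<..}) \<xi>" by (simp add: qf_E)
  ultimately show "qf (E {s<..}) \<xi> = qf 0 \<xi>" by (simp add: qf_zero)
qed (simp_all add: selfadjoint_E selfadjoint_zero)

lemma E_low:
  assumes "r < - norm c"
  shows "E {r<..} = 1"
proof (rule selfadjoint_eqI)
  fix \<xi>
  let ?s = "- norm c"
  have "cfc (ramp r ?s) c = cfc (\<lambda>t. ?s - r) c"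
  proof (intro cfc_cong c_sa continuous_on_const ramp_eq_max)
    fix t assume "t \<in> real_spectrum c"
    then show "- norm c \<le> t" using abs_real_spectrum_le[of t c] by linarith
  qed (use assms in simp)
  then have "(?s - r) * (norm \<xi>)\<^sup>2 \<le> (?s - r) * qf (E {r<..}) \<xi>"
    using positive_diffD[OF ramp_upper[of r ?s], of \<xi>] assms
    by (simp add: cfc_const[OF c_sa] qf_one qf_scaleR)
  then have "(norm \<xi>)\<^sup>2 \<le> qf (E {r<..}) \<xi>" using assms by (simp add: mult_le_cancel_left)
  moreover have "0 \<le> qf (E (UNIV - {r<..})) \<xi>" by (simp add: qf_E)
  ultimately show "qf (E {r<..}) \<xi> = qf 1 \<xi>" by (simp add: E_compl qf_diff qf_one)
qed (simp_all add: selfadjoint_E selfadjoint_one)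

end

section \<open>The spectral scale\<close>

lemma step_has_integral:
  fixes k \<phi> :: real
  assumes "0 \<le> \<phi>" "\<phi> \<le> 1"
  shows "((\<lambda>t. if t < \<phi> then k else 0) has_integral k * \<phi>) {0..1}"
proof -
  have "((\<lambda>t. k) has_integral k * \<phi>) {0..\<phi>}"
    using has_integral_const_real[of k 0 \<phi>] assms(1) by (simp add: mult.commute)
  then have "((\<lambda>t. if t < \<phi> then k else 0) has_integral k * \<phi>) {0..\<phi>}"
    by (rule has_integral_spike_finite[of "{\<phi>}", rotated 2]) auto
  moreover have "((\<lambda>t. if t < \<phi> then k else 0) has_integral 0) {\<phi>..1}"
    by (rule has_integral_is_0) auto
  ultimately have "((\<lambda>t. if t < \<phi> then k else 0) has_integral k * \<phi> + 0) {0..1}"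
    by (rule has_integral_combine[OF assms])
  then show ?thesis by simp
qed

lemma antimono_integrable:
  fixes g :: "real \<Rightarrow> real"
  assumes "\<And>s t. 0 \<le> s \<Longrightarrow> s \<le> t \<Longrightarrow> t \<le> 1 \<Longrightarrow> g t \<le> g s"
  shows "g integrable_on {0..1}"
proof -
  have "mono_on {0..1} (\<lambda>t. - g t)" using assms by (auto simp: mono_on_def)
  then have "(\<lambda>t. - g t) integrable_on {0..1}" by (rule integrable_on_mono_on)
  then show ?thesis using integrable_neg_iff by blast
qed

section \<open>Traces\<close>

locale tracial_von_neumann = von_neumann +
  fixes tr :: "'a \<Rightarrow> complex"
  assumes trace: "normalized_trace tr"
begin

definition \<tau> :: "'a \<Rightarrow> real" where
  "\<tau> x = Re (tr x)"

lemma trace_add: "\<tau> (x + y) = \<tau> x + \<tau> y"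
  and trace_mult_commute: "\<tau> (x * y) = \<tau> (y * x)"
  and trace_one: "\<tau> 1 = 1"
  and trace_positive: "positive x \<Longrightarrow> 0 \<le> \<tau> x"
  using trace by (auto simp: normalized_trace_def \<tau>_def)

lemma trace_scaleR: "\<tau> (r *\<^sub>R x) = r * \<tau> x"
proof -
  have "tr (complex_of_real r *\<^sub>C x) = complex_of_real r * tr x"
    using trace by (simp add: normalized_trace_def)
  then show ?thesis by (simp add: \<tau>_def scaleC_of_real)
qed

lemma trace_diff: "\<tau> (x - y) = \<tau> x - \<tau> y"
  using trace_add[of "x - y" y] by simp

lemma trace_zero: "\<tau> 0 = 0"
  using trace_diff[of 0 0] by simp

lemma trace_sum: "\<tau> (\<Sum>i\<in>A. g i) = (\<Sum>i\<in>A. \<tau> (g i))"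
  by (induction A rule: infinite_finite_induct) (simp_all add: trace_zero trace_add)

lemma trace_mono: "positive (y - x) \<Longrightarrow> \<tau> x \<le> \<tau> y"
  using trace_positive[of "y - x"] by (simp add: trace_diff)

text \<open>Traciality moves a square root \<open>r\<close> of \<open>x\<close> to the other side,
  giving the trace of the positive element \<open>r * y * r\<close>; in this way noncommuting
  factors are handled.\<close>

lemma trace_mult_positive:
  assumes "positive x" "positive y"
  shows "0 \<le> \<tau> (x * y)"
proof -
  obtain r where r: "selfadjoint r" "r * r = x" using positive_sqrt[OF assms(1)] by blast
  have "\<tau> (x * y) = \<tau> (r * (r * y))" by (simp add: r(2)[symmetric] mult.assoc)
  also have "\<dots> = \<tau> (r * y * r)" by (rule trace_mult_commute)
  finally have "\<tau> (x * y) = \<tau> (r * y * r)" .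
  then show ?thesis using positive_sandwich[OF assms(2) r(1)] trace_positive by simp
qed

lemma trace_mult_mono:
  assumes "positive (y - x)" "positive h"
  shows "\<tau> (x * h) \<le> \<tau> (y * h)"
  using trace_mult_positive[OF assms] by (simp add: left_diff_distrib trace_diff)

section \<open>Distribution function and spectral scale of one element\<close>

context
  fixes c :: 'a
  assumes c: "selfadjoint c"
begin

definition upper_trace :: "real \<Rightarrow> real" where
  "upper_trace s = \<tau> (spectral_projection \<pi> c {s<..})"

lemma spectral_projection_measure: "spectral_measure \<pi> c (spectral_projection \<pi> c)"
proof
  show "selfadjoint c" by (rule c)
  show "spectral_measure_of \<pi> c (spectral_projection \<pi> c)"
    unfolding spectral_projection_def using spectral_measure_exists[OF c] by (rule someI_ex)
qed

lemma
  assumes "r \<le> s"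
  shows trace_ramp_lower: "(s - r) * upper_trace s \<le> \<tau> (cfc (ramp r s) c)"
    and trace_ramp_upper: "\<tau> (cfc (ramp r s) c) \<le> (s - r) * upper_trace r"
  using trace_mono[OF spectral_measure.ramp_lower[OF spectral_projection_measure assms]]
    trace_mono[OF spectral_measure.ramp_upper[OF spectral_projection_measure assms]]
  by (simp_all add: upper_trace_def trace_scaleR)

lemma upper_trace_mono:
  assumes "r \<le> s"
  shows "upper_trace s \<le> upper_trace r"
proof (cases "r = s")
  case False
  have "(s - r) * upper_trace s \<le> (s - r) * upper_trace r"
    using trace_ramp_lower[OF assms] trace_ramp_upper[OF assms] by (rule order_trans)
  then show ?thesis using False assms by (simp add: mult_le_cancel_left)
qed simp

lemma upper_trace_low: "s < - norm c \<Longrightarrow> upper_trace s = 1"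
  using spectral_measure.E_low[OF spectral_projection_measure] by (simp add: upper_trace_def trace_one)

lemma upper_trace_high: "norm c < s \<Longrightarrow> upper_trace s = 0"
  using spectral_measure.E_high[OF spectral_projection_measure] by (simp add: upper_trace_def trace_zero)

lemma upper_trace_bounds: "0 \<le> upper_trace s" "upper_trace s \<le> 1"
proof -
  have "upper_trace (max s (norm c + 1)) \<le> upper_trace s" "upper_trace s \<le> upper_trace (min s (- norm c - 1))"
    by (intro upper_trace_mono; simp)+
  then show "0 \<le> upper_trace s" "upper_trace s \<le> 1"
    using upper_trace_high[of "max s (norm c + 1)"] upper_trace_low[of "min s (- norm c - 1)"] by auto
qed

definition scale_set :: "real \<Rightarrow> real set" where
  "scale_set t = {\<gamma>. upper_trace \<gamma> \<le> t}"

lemma spectral_scale_eq: "spectral_scale \<pi> tr c t = Inf (scale_set t)"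
  by (simp add: spectral_scale_def scale_set_def upper_trace_def \<tau>_def)

lemma scale_set_mem: "0 \<le> t \<Longrightarrow> norm c < s \<Longrightarrow> s \<in> scale_set t"
  by (simp add: scale_set_def upper_trace_high)

lemma scale_set_lower: "t < 1 \<Longrightarrow> s \<in> scale_set t \<Longrightarrow> - norm c \<le> s"
  using upper_trace_low[of s] by (fastforce simp: scale_set_def)

lemma scale_set_bdd_below: "t < 1 \<Longrightarrow> bdd_below (scale_set t)"
  using scale_set_lower by (auto intro!: bdd_belowI)

text \<open>Together with the converse bound below, this expresses that the spectral scale and
  \<open>upper_trace\<close> are generalized inverses of each other.\<close>

lemma spectral_scale_ge: "0 \<le> t \<Longrightarrow> t < upper_trace s \<Longrightarrow> s \<le> spectral_scale \<pi> tr c t"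
  unfolding spectral_scale_eq
proof (rule cInf_greatest)
  assume "0 \<le> t" "t < upper_trace s"
  show "scale_set t \<noteq> {}" using scale_set_mem[OF \<open>0 \<le> t\<close>, of "norm c + 1"] by auto
  fix x assume "x \<in> scale_set t"
  then show "s \<le> x"
    using \<open>t < upper_trace s\<close> upper_trace_mono[of x s] by (fastforce simp: scale_set_def)
qed

lemma spectral_scale_le: "t < 1 \<Longrightarrow> upper_trace s \<le> t \<Longrightarrow> spectral_scale \<pi> tr c t \<le> s"
  unfolding spectral_scale_eq by (intro cInf_lower scale_set_bdd_below) (simp_all add: scale_set_def)

lemma abs_spectral_scale_le:
  assumes "0 \<le> t" "t < 1"
  shows "\<bar>spectral_scale \<pi> tr c t\<bar> \<le> norm c"
proof -
  have "- norm c \<le> spectral_scale \<pi> tr c t"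
  proof (rule dense_le)
    fix w assume "w < - norm c"
    then show "w \<le> spectral_scale \<pi> tr c t"
      using assms upper_trace_low[of w] by (intro spectral_scale_ge) auto
  qed
  moreover have "spectral_scale \<pi> tr c t \<le> norm c"
  proof (rule dense_ge)
    fix w assume "norm c < w"
    then show "spectral_scale \<pi> tr c t \<le> w"
      using assms upper_trace_high[of w] by (intro spectral_scale_le) auto
  qed
  ultimately show ?thesis by linarith
qed

lemma spectral_scale_antimono:
  assumes "0 \<le> s" "s \<le> t" "t < 1"
  shows "spectral_scale \<pi> tr c t \<le> spectral_scale \<pi> tr c s"
  unfolding spectral_scale_eq
proof (rule cInf_superset_mono)
  show "scale_set s \<noteq> {}" using scale_set_mem[OF assms(1), of "norm c + 1"] by auto
  show "bdd_below (scale_set t)" using assms by (intro scale_set_bdd_below)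
  show "scale_set s \<subseteq> scale_set t" using assms by (auto simp: scale_set_def)
qed

text \<open>The spectral scale on \<open>[0,1)\<close>, extended by a lower bound to replace its junk values.\<close>

definition scale :: "real \<Rightarrow> real" where
  "scale t = (if t < 1 then spectral_scale \<pi> tr c t else - norm c)"

lemma abs_scale_le: "0 \<le> t \<Longrightarrow> \<bar>scale t\<bar> \<le> norm c"
  by (simp add: scale_def abs_spectral_scale_le)

lemma scale_antimono: "0 \<le> s \<Longrightarrow> s \<le> t \<Longrightarrow> scale t \<le> scale s"
  using spectral_scale_antimono[of s t] abs_spectral_scale_le[of s] by (auto simp: scale_def)

lemma integral_spectral_scale:
  assumes "0 \<le> \<alpha>" "\<alpha> \<le> 1"
  shows "integral {0..<\<alpha>} (spectral_scale \<pi> tr c) = integral {0..\<alpha>} scale"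
proof -
  have "integral {0..<\<alpha>} (spectral_scale \<pi> tr c) = integral {0..<\<alpha>} scale"
    using assms(2) by (intro integral_cong) (auto simp: scale_def)
  also have "\<dots> = integral {0..\<alpha>} scale"
  proof (rule integral_subset_negligible)
    show "negligible ({0..\<alpha>} - {0..<\<alpha>})" by (rule negligible_subset[of "{\<alpha>}"]) auto
  qed auto
  finally show ?thesis .
qed

lemma integrable_scale: "scale integrable_on {0..1}"
  by (rule antimono_integrable) (simp add: scale_antimono)

lemma integrable_ramp_scale: "r \<le> s \<Longrightarrow> (\<lambda>t. ramp r s (scale t)) integrable_on {0..1}"
  by (rule antimono_integrable) (simp add: ramp_mono scale_antimono)

text \<open>For \<open>t\<close> below \<open>upper_trace s\<close> the scale is at least
  \<open>s\<close> and the ramp has its full height; for \<open>t\<close> from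
  \<open>upper_trace r\<close> on the scale is at most \<open>r\<close> and the ramp vanishes. The
  bounds are the integrals of the two resulting step functions.\<close>

lemma integral_ramp_scale_bounds:
  assumes rs: "r \<le> s"
  shows "(s - r) * upper_trace s \<le> integral {0..1} (\<lambda>t. ramp r s (scale t))"
    and "integral {0..1} (\<lambda>t. ramp r s (scale t)) \<le> (s - r) * upper_trace r"
proof -
  have int: "((\<lambda>t. if t < upper_trace q then s - r else 0) has_integral (s - r) * upper_trace q) {0..1}" for q
    by (rule step_has_integral[OF upper_trace_bounds])
  have "(if t < upper_trace s then s - r else 0) \<le> ramp r s (scale t)" if "t \<in> {0..1}" for t
    using rs that spectral_scale_ge[of t s] upper_trace_bounds(2)[of s]
    by (auto simp: scale_def ramp_eq_max ramp_nonneg)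
  then show "(s - r) * upper_trace s \<le> integral {0..1} (\<lambda>t. ramp r s (scale t))"
    by (intro has_integral_le[OF int integrable_integral[OF integrable_ramp_scale[OF rs]]])
  \<comment> \<open>At \<open>t = 1\<close> the scale has the artificial value
    \<open>- norm c\<close>, which may exceed \<open>r\<close>, so that point is exempted from the
    comparison.\<close>
  have int': "((\<lambda>t. if t < upper_trace r \<or> t = 1 then s - r else 0) has_integral (s - r) * upper_trace r) {0..1}"
    by (rule has_integral_spike_finite[of "{1}", OF _ _ int]) auto
  have "ramp r s (scale t) \<le> (if t < upper_trace r \<or> t = 1 then s - r else 0)" if "t \<in> {0..1}" for t
  proof (cases "t < upper_trace r \<or> t = 1")
    case False
    then have "scale t \<le> r" using that spectral_scale_le[of t r] by (simp add: scale_def)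
    then show ?thesis using False rs by (simp add: ramp_eq_zero)
  qed (simp add: ramp_le)
  then show "integral {0..1} (\<lambda>t. ramp r s (scale t)) \<le> (s - r) * upper_trace r"
    by (intro has_integral_le[OF integrable_integral[OF integrable_ramp_scale[OF rs]] int'])
qed

lemma integral_ramp_scale:
  assumes "r \<le> s"
  shows "integral {0..1} (\<lambda>t. ramp r s (scale t)) = \<tau> (cfc (ramp r s) c)"
proof (rule interval_function_unique[OF assms integral_ramp_scale_bounds _ trace_ramp_lower trace_ramp_upper])
  fix r s u :: real assume rs: "r \<le> s" "s \<le> u"
  show "integral {0..1} (\<lambda>t. ramp r u (scale t))
      = integral {0..1} (\<lambda>t. ramp r s (scale t)) + integral {0..1} (\<lambda>t. ramp s u (scale t))"
    unfolding ramp_add[OF rs] by (intro integral_add integrable_ramp_scale rs)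
  have "cfc (ramp r u) c = cfc (\<lambda>t. ramp r s t + ramp s u t) c"
    using rs by (intro cfc_cong c continuous_intros continuous_on_ramp ramp_add)
  then show "\<tau> (cfc (ramp r u) c) = \<tau> (cfc (ramp r s) c) + \<tau> (cfc (ramp s u) c)"
    by (simp add: cfc_add[OF c] continuous_on_ramp trace_add)
qed

end

text \<open>Submajorization is a statement about the traces of \<open>(c - \<gamma>)\<^sub>+\<close>: for the optimal \<open>\<gamma> = e\<^sub>y(\<alpha>)\<close>
  one has \<open>\<integral>\<^sub>0\<^sup>\<alpha> e\<^sub>y = \<alpha> \<gamma> + tr (y - \<gamma>)\<^sub>+\<close>, and \<open>\<le>\<close> holds for every \<open>\<gamma>\<close>.\<close>

lemma submajorizedI:
  assumes x: "selfadjoint x" and y: "selfadjoint y" and N: "norm x \<le> N" "norm y \<le> N"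
    and le: "\<And>\<gamma>. \<gamma> \<le> N \<Longrightarrow> \<tau> (cfc (ramp \<gamma> N) x) \<le> \<tau> (cfc (ramp \<gamma> N) y)"
  shows "submajorized \<pi> tr x y"
  unfolding submajorized_def
proof
  fix \<alpha> :: real assume \<alpha>: "\<alpha> \<in> {0..1}"
  \<comment> \<open>At \<open>\<alpha> = 1\<close> this is the artificial value
    \<open>- norm y\<close>; it lies below the whole scale of \<open>y\<close>, so the argument
    covers that endpoint too.\<close>
  define \<gamma> where "\<gamma> = scale y \<alpha>"
  have \<gamma>N: "\<gamma> \<le> N" using abs_scale_le[OF y, of \<alpha>] \<alpha> N by (auto simp: \<gamma>_def)
  let ?g = "\<lambda>c t. ramp \<gamma> N (scale c t)"
  have sub: "h integrable_on {0..\<alpha>}" "h integrable_on {\<alpha>..1}" if "h integrable_on {0..1}" for h :: "real \<Rightarrow> real"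
    using that \<alpha> by (auto intro: integrable_on_subinterval)
  have g_int: "?g x integrable_on {0..1}" "?g y integrable_on {0..1}"
    by (intro integrable_ramp_scale x y \<gamma>N)+
  have s_int: "scale x integrable_on {0..1}" "scale y integrable_on {0..1}"
    by (intro integrable_scale x y)+
  have const: "integral {0..\<alpha>} (\<lambda>t. \<gamma> + h t) = \<alpha> * \<gamma> + integral {0..\<alpha>} h" if "h integrable_on {0..\<alpha>}" for h :: "real \<Rightarrow> real"
    using that \<alpha> by (subst integral_add) auto
  have "integral {0..\<alpha>} (scale x) \<le> integral {0..\<alpha>} (\<lambda>t. \<gamma> + ?g x t)"
  proof (rule integral_le[OF sub(1)[OF s_int(1)]])
    show "(\<lambda>t. \<gamma> + ?g x t) integrable_on {0..\<alpha>}" by (intro integrable_add sub(1)[OF g_int(1)]) auto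
    fix t assume "t \<in> {0..\<alpha>}"
    then have "scale x t \<le> N" using abs_scale_le[OF x, of t] N by auto
    then show "scale x t \<le> \<gamma> + ?g x t" by (simp add: ramp_def min_def max_def)
  qed
  also have "\<dots> = \<alpha> * \<gamma> + integral {0..\<alpha>} (?g x)" by (rule const[OF sub(1)[OF g_int(1)]])
  also have "\<dots> \<le> \<alpha> * \<gamma> + integral {0..1} (?g x)"
    using \<alpha> \<gamma>N by (intro add_left_mono integral_subset_le sub g_int) (auto simp: ramp_nonneg)
  also have "\<dots> \<le> \<alpha> * \<gamma> + integral {0..1} (?g y)"
    using le[OF \<gamma>N] by (simp add: integral_ramp_scale[OF x \<gamma>N] integral_ramp_scale[OF y \<gamma>N])
  also have "integral {0..1} (?g y) = integral {0..\<alpha>} (?g y) + integral {\<alpha>..1} (?g y)"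
    using \<alpha> Henstock_Kurzweil_Integration.integral_combine[OF _ _ g_int(2), of \<alpha>] by simp
  \<comment> \<open>For \<open>y\<close> no loss occurs: past \<open>\<alpha>\<close> the scale is
    at most \<open>\<gamma>\<close> and the ramp vanishes, and before \<open>\<alpha>\<close> the
    scale is exactly \<open>\<gamma>\<close> plus the ramp.\<close>
  also have "integral {\<alpha>..1} (?g y) = integral {\<alpha>..1} (\<lambda>t. 0)"
  proof (rule integral_cong)
    fix t assume "t \<in> {\<alpha>..1}"
    then have "scale y t \<le> \<gamma>" using scale_antimono[OF y, of \<alpha> t] \<alpha> by (simp add: \<gamma>_def)
    then show "?g y t = 0" using \<gamma>N by (simp add: ramp_eq_zero)
  qed
  also have "\<alpha> * \<gamma> + (integral {0..\<alpha>} (?g y) + integral {\<alpha>..1} (\<lambda>t. 0)) = integral {0..\<alpha>} (\<lambda>t. \<gamma> + ?g y t)"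
    using const[OF sub(1)[OF g_int(2)]] by simp
  also have "\<dots> = integral {0..\<alpha>} (scale y)"
  proof (rule integral_cong)
    fix t assume t: "t \<in> {0..\<alpha>}"
    then have "\<gamma> \<le> scale y t" using scale_antimono[OF y, of t \<alpha>] by (simp add: \<gamma>_def)
    moreover have "scale y t \<le> N" using abs_scale_le[OF y, of t] N t by auto
    ultimately show "\<gamma> + ?g y t = scale y t" by (simp add: ramp_eq_diff)
  qed
  finally show "integral {0..<\<alpha>} (spectral_scale \<pi> tr x) \<le> integral {0..<\<alpha>} (spectral_scale \<pi> tr y)"
    using \<alpha> by (simp add: integral_spectral_scale[OF x] integral_spectral_scale[OF y])
qed

end

section \<open>The trace inequality for positive maps\<close>

lemma cfc_sum:
  assumes "selfadjoint (a::'a::unital_cstar_algebra)" "\<And>i. i \<in> A \<Longrightarrow> continuous_on (real_spectrum a) (g i)"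
  shows "cfc (\<lambda>t. \<Sum>i\<in>A. g i t) a = (\<Sum>i\<in>A. cfc (g i) a)"
  using assms(2)
proof (induction A rule: infinite_finite_induct)
  case (insert i A)
  then have "continuous_on (real_spectrum a) (g i)" "continuous_on (real_spectrum a) (\<lambda>t. \<Sum>i\<in>A. g i t)"
    by (auto intro!: continuous_intros)
  from cfc_add[OF assms(1) this] insert show ?case by simp
qed (simp_all add: cfc_const[OF assms(1)])

text \<open>Convexity is condensed into \<open>tangent\<close>: for each \<open>s\<close> in the
  spectrum of \<open>b\<close>, \<open>y\<close> dominates an affine function of \<open>b\<close>
  that touches \<open>f\<close> at \<open>s\<close>. Cutting with \<open>F V\<close> at
  \<open>b\<close> times \<open>h\<close>, which is positive because the factors commute, preserves
  each such inequality under the trace, and the pieces add up.\<close>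

lemma (in tracial_von_neumann) trace_jensen:
  fixes f :: "real \<Rightarrow> real"
  assumes b: "selfadjoint b" and f: "continuous_on (real_spectrum b) f"
    and h: "positive h" "h * b = b * h"
    and tangent: "\<And>s. s \<in> real_spectrum b \<Longrightarrow> \<exists>k. positive (y - cfc (\<lambda>t. f s + k * (t - s)) b)"
  shows "\<tau> (cfc f b * h) \<le> \<tau> (y * h)"
proof (rule field_le_epsilon)
  fix e :: real assume e: "e > 0"
  \<comment> \<open>The cells contribute \<open>\<delta>\<close> times the trace of \<open>h\<close>
    in total; the summand 1 guards against trace zero.\<close>
  define \<delta> where "\<delta> = e / (\<tau> h + 1)"
  have h0: "0 \<le> \<tau> h" using h(1) by (rule trace_positive)
  have \<delta>: "\<delta> > 0" "\<delta> * \<tau> h \<le> e" using e h0 by (auto simp: \<delta>_def field_simps)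
  let ?S = "real_spectrum b"
  obtain k where k: "\<And>s. s \<in> ?S \<Longrightarrow> positive (y - cfc (\<lambda>t. f s + k s * (t - s)) b)"
    using tangent by metis
  let ?l = "\<lambda>s t. f s + k s * (t - s)"
  have l: "continuous_on ?S (?l s)" for s by (intro continuous_intros)
  have "\<exists>U. open U \<and> s \<in> U \<and> (\<forall>t \<in> ?S \<inter> U. f t < ?l s t + \<delta>)" if s: "s \<in> ?S" for s
  proof -
    have "continuous_on ?S (\<lambda>t. f t - ?l s t)" by (intro continuous_intros f)
    then obtain d where d: "d > 0" "\<And>t. t \<in> ?S \<Longrightarrow> dist t s < d \<Longrightarrow> dist (f t - ?l s t) (f s - ?l s s) < \<delta>"
      using s \<delta>(1) unfolding continuous_on_iff by metis
    have "f t < ?l s t + \<delta>" if "t \<in> ?S \<inter> ball s d" for t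
      using d(2)[of t] that by (simp add: dist_real_def dist_commute abs_less_iff)
    then show ?thesis using d(1) by (intro exI[of _ "ball s d"]) auto
  qed
  then obtain U :: "real \<Rightarrow> real set" where U: "\<And>s. s \<in> ?S \<Longrightarrow> open (U s)" "\<And>s. s \<in> ?S \<Longrightarrow> s \<in> U s"
    "\<And>s t. s \<in> ?S \<Longrightarrow> t \<in> ?S \<Longrightarrow> t \<in> U s \<Longrightarrow> f t < ?l s t + \<delta>"
    by (metis IntI)
  have cover: "?S \<subseteq> (\<Union>s\<in>?S. U s)" using U(2) by blast
  obtain D where D: "D \<subseteq> ?S" "finite D" "?S \<subseteq> (\<Union>s\<in>D. U s)"
    using compactE_image[OF real_spectrum_compact[of b] U(1) cover] by blast
  define \<C> where "\<C> = U ` D"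
  have fin: "finite \<C>" using D(2) by (simp add: \<C>_def)
  have "\<exists>F :: real set \<Rightarrow> real \<Rightarrow> real. (\<forall>V\<in>\<C>. continuous_on ?S (F V) \<and> (\<forall>t\<in>?S. 0 \<le> F V t)) \<and>
      (\<forall>V\<in>\<C>. \<forall>t\<in>?S. t \<notin> V \<longrightarrow> F V t = 0) \<and> (\<forall>t\<in>?S. supp_sum (\<lambda>V. F V t) \<C> = 1)"
  proof (rule subordinate_partition_of_unity[of ?S \<C>])
    show "?S \<subseteq> \<Union>\<C>" using D(3) by (simp add: \<C>_def)
    show "open T" if "T \<in> \<C>" for T using that U(1) D(1) by (auto simp: \<C>_def)
    show "\<exists>V. open V \<and> x \<in> V \<and> finite {U \<in> \<C>. U \<inter> V \<noteq> {}}" for x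
      using fin by (intro exI[of _ UNIV]) simp
    fix F :: "real set \<Rightarrow> real \<Rightarrow> real"
    assume "\<And>V. V \<in> \<C> \<Longrightarrow> continuous_on ?S (F V) \<and> (\<forall>t\<in>?S. 0 \<le> F V t)"
      and "\<And>t V. V \<in> \<C> \<Longrightarrow> t \<in> ?S \<Longrightarrow> t \<notin> V \<Longrightarrow> F V t = 0"
      and "\<And>t. t \<in> ?S \<Longrightarrow> supp_sum (\<lambda>V. F V t) \<C> = 1"
    then show ?thesis by (intro exI[of _ F] conjI ballI impI) blast+
  qed
  then obtain F :: "real set \<Rightarrow> real \<Rightarrow> real" where
    F': "\<forall>V\<in>\<C>. continuous_on ?S (F V) \<and> (\<forall>t\<in>?S. 0 \<le> F V t)"
      "\<forall>V\<in>\<C>. \<forall>t\<in>?S. t \<notin> V \<longrightarrow> F V t = 0" "\<forall>t\<in>?S. supp_sum (\<lambda>V. F V t) \<C> = 1"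
    by (elim exE conjE) (rule that)
  note F = F'(1)[rule_format] F'(2)[rule_format] F'(3)[rule_format]
  have F_sum: "(\<Sum>V\<in>\<C>. F V t) = 1" if "t \<in> ?S" for t
  proof -
    have "(\<Sum>V\<in>\<C>. F V t) = supp_sum (\<lambda>V. F V t) \<C>"
      unfolding supp_sum_def support_on_def using fin by (intro sum.mono_neutral_right) auto
    then show ?thesis using F(3)[OF that] by simp
  qed
  \<comment> \<open>The partition is indexed by the open sets of the cover, so each set is assigned
    a tangent point that produced it.\<close>
  have "\<forall>V\<in>\<C>. \<exists>s. s \<in> ?S \<and> V = U s" using D(1) by (auto simp: \<C>_def)
  then obtain \<sigma> where \<sigma>: "\<And>V. V \<in> \<C> \<Longrightarrow> \<sigma> V \<in> ?S \<and> V = U (\<sigma> V)" by metis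
  have Fc: "continuous_on ?S (F V)" if "V \<in> \<C>" for V using F(1)[OF that] by blast
  have cell: "\<tau> (cfc f b * (cfc (F V) b * h)) \<le> \<tau> (y * (cfc (F V) b * h)) + \<delta> * \<tau> (cfc (F V) b * h)" if V: "V \<in> \<C>" for V
  proof -
    let ?s = "\<sigma> V" and ?Q = "cfc (F V) b * h"
    have s: "?s \<in> ?S" "V = U ?s" using \<sigma>[OF V] by auto
    have FV: "positive (cfc (F V) b)" using F(1)[OF V] by (intro positive_cfc b) auto
    have "h * cfc (F V) b = cfc (F V) b * h" by (rule cfc_comm[OF b Fc[OF V] h(2)])
    then have Q: "positive ?Q" using FV h(1) by (intro positive_commuting_mult) auto
    have ld: "continuous_on ?S (\<lambda>t. ?l ?s t + \<delta>)" by (intro continuous_intros)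
    \<comment> \<open>On \<open>V\<close> the tangent line raised by \<open>\<delta>\<close> lies
      above \<open>f\<close>; off \<open>V\<close> the factor \<open>F V\<close> is zero.\<close>
    have "positive (cfc (\<lambda>t. (?l ?s t + \<delta> - f t) * F V t) b)"
    proof (intro positive_cfc b continuous_on_mult continuous_on_diff ld f Fc[OF V])
      fix t assume t: "t \<in> ?S"
      show "0 \<le> (?l ?s t + \<delta> - f t) * F V t"
      proof (cases "t \<in> V")
        case True
        then have "f t < ?l ?s t + \<delta>" using U(3)[OF s(1) t] s(2) by simp
        then show ?thesis using F(1)[OF V] t by (intro mult_nonneg_nonneg) auto
      next
        case False
        then show ?thesis using F(2)[OF V t] by simp
      qed
    qed
    also have "cfc (\<lambda>t. (?l ?s t + \<delta> - f t) * F V t) b = (cfc (?l ?s) b + \<delta> *\<^sub>R 1 - cfc f b) * cfc (F V) b"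
    proof -
      have "cfc (\<lambda>t. (?l ?s t + \<delta> - f t) * F V t) b = cfc (\<lambda>t. ?l ?s t + \<delta> - f t) b * cfc (F V) b"
        by (intro cfc_mult b continuous_on_diff ld f Fc[OF V])
      also have "cfc (\<lambda>t. ?l ?s t + \<delta> - f t) b = cfc (\<lambda>t. ?l ?s t + \<delta>) b - cfc f b"
        by (intro cfc_diff b ld f)
      also have "cfc (\<lambda>t. ?l ?s t + \<delta>) b = cfc (?l ?s) b + cfc (\<lambda>t. \<delta>) b"
        by (intro cfc_add b l continuous_on_const)
      finally show ?thesis by (simp only: cfc_const[OF b])
    qed
    finally have "0 \<le> \<tau> ((cfc (?l ?s) b + \<delta> *\<^sub>R 1 - cfc f b) * cfc (F V) b * h)"
      using h(1) by (rule trace_mult_positive)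
    then have "\<tau> (cfc f b * ?Q) \<le> \<tau> (cfc (?l ?s) b * ?Q) + \<delta> * \<tau> ?Q"
      by (simp add: left_diff_distrib distrib_right trace_diff trace_add trace_scaleR mult.assoc)
    also have "\<tau> (cfc (?l ?s) b * ?Q) \<le> \<tau> (y * ?Q)" using k[OF s(1)] Q by (rule trace_mult_mono)
    finally show ?thesis by simp
  qed
  have "cfc (\<lambda>t. \<Sum>V\<in>\<C>. F V t) b = cfc (\<lambda>t. 1) b"
    using F_sum by (intro cfc_cong b continuous_on_const)
  then have one: "(\<Sum>V\<in>\<C>. cfc (F V) b) = 1"
    using cfc_sum[OF b Fc, of \<C> "\<lambda>V. V"] by (simp add: cfc_const[OF b])
  have expand: "\<tau> (z * h) = (\<Sum>V\<in>\<C>. \<tau> (z * (cfc (F V) b * h)))" for z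
  proof -
    have "z * h = z * ((\<Sum>V\<in>\<C>. cfc (F V) b) * h)" by (simp add: one)
    then show ?thesis by (simp add: sum_distrib_left sum_distrib_right trace_sum)
  qed
  have "\<tau> (cfc f b * h) \<le> (\<Sum>V\<in>\<C>. \<tau> (y * (cfc (F V) b * h)) + \<delta> * \<tau> (cfc (F V) b * h))"
    unfolding expand[of "cfc f b"] by (intro sum_mono cell)
  also have "\<dots> = \<tau> (y * h) + \<delta> * \<tau> h"
    \<comment> \<open>Expanding at \<open>z = 1\<close> collects the error terms into the trace of
      \<open>h\<close>.\<close>
    using expand[of 1] by (simp add: sum.distrib sum_distrib_left[symmetric] expand[of y])
  finally show "\<tau> (cfc f b * h) \<le> \<tau> (y * h) + e" using \<delta>(2) by linarith
qed

text \<open>Test against \<open>h = m/(m + \<epsilon>)\<close> with \<open>m = (x - \<gamma>)\<^sub>+\<close>, a continuous substitute for the spectral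
  projection of \<open>x\<close> on \<open>(\<gamma>, \<infinity>)\<close>.\<close>

lemma (in tracial_von_neumann) trace_ramp_mono:
  assumes x: "selfadjoint x" and y: "selfadjoint y" and N: "norm x \<le> N" "norm y \<le> N" "\<gamma> \<le> N"
    and le: "\<And>g. continuous_on (real_spectrum x) g \<Longrightarrow> positive (cfc g x) \<Longrightarrow> \<tau> (x * cfc g x) \<le> \<tau> (y * cfc g x)"
  shows "\<tau> (cfc (ramp \<gamma> N) x) \<le> \<tau> (cfc (ramp \<gamma> N) y)"
proof (rule field_le_epsilon)
  fix e :: real assume e: "e > 0"
  let ?r = "ramp \<gamma> N"
  let ?H = "\<lambda>t. ?r t / (?r t + e)"
  define h where "h = cfc ?H x"
  have r0: "0 \<le> ?r t" for t using N(3) by (rule ramp_nonneg)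
  have re: "?r t + e > 0" for t using r0[of t] e by linarith
  have Hc: "continuous_on S ?H" for S
    using re by (intro continuous_intros continuous_on_ramp) (metis less_irrefl)
  have H1: "0 \<le> ?H t" "?H t \<le> 1" for t using r0[of t] re[of t] e by auto
  have h: "positive h" unfolding h_def by (intro positive_cfc x Hc H1)
  have "positive (cfc (\<lambda>t. 1 - ?H t) x)"
    using H1 by (intro positive_cfc x continuous_on_diff continuous_on_const Hc) auto
  then have h1: "positive (1 - h)"
    by (simp add: cfc_diff[OF x continuous_on_const Hc] cfc_const[OF x] h_def)
  have yp: "positive (cfc ?r y)" by (intro positive_cfc y continuous_on_ramp r0)
  have "positive (cfc (\<lambda>t. ?r t - (t - \<gamma>)) y)"
  proof (intro positive_cfc y continuous_on_diff continuous_on_ramp continuous_on_id continuous_on_const)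
    fix t assume "t \<in> real_spectrum y"
    then have "t \<le> N" using abs_real_spectrum_le[of t y] N by linarith
    then show "0 \<le> ?r t - (t - \<gamma>)" by (auto simp: ramp_def)
  qed
  then have yg: "positive (cfc ?r y - (y - \<gamma> *\<^sub>R 1))"
    by (simp add: cfc_diff[OF y] cfc_const[OF y] cfc_id[OF y] continuous_on_ramp continuous_on_diff
        continuous_on_const continuous_on_id)
  have "positive (cfc (\<lambda>t. (t - \<gamma>) * ?H t - (?r t - e)) x)"
  proof (intro positive_cfc x continuous_on_diff continuous_on_mult continuous_on_ramp continuous_on_id continuous_on_const Hc)
    fix t assume "t \<in> real_spectrum x"
    then have "t \<le> N" using abs_real_spectrum_le[of t x] N by linarith
    \<comment> \<open>On the spectrum the product is \<open>r * r / (r + e)\<close> with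
      \<open>r\<close> the ramp, and it falls short of \<open>r\<close> by less than
      \<open>e\<close>: adding \<open>e\<close> to the difference leaves
      \<open>e * e / (r + e)\<close>. Below \<open>\<gamma>\<close> both sides vanish.\<close>
    then have "(t - \<gamma>) * ?H t = ?r t * ?H t"
      using N(3) by (cases "t \<le> \<gamma>") (simp_all add: ramp_eq_zero ramp_eq_diff)
    moreover have "?r t * ?H t - (?r t - e) = e * e / (?r t + e)"
      using re[of t] by (simp add: field_simps)
    moreover have "0 \<le> e * e / (?r t + e)" using re[of t] e by simp
    ultimately show "0 \<le> (t - \<gamma>) * ?H t - (?r t - e)" by (simp only:)
  qed
  also have "cfc (\<lambda>t. (t - \<gamma>) * ?H t - (?r t - e)) x = (x - \<gamma> *\<^sub>R 1) * h - (cfc ?r x - e *\<^sub>R 1)"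
  proof -
    have c: "continuous_on (real_spectrum x) (\<lambda>t. t - \<gamma>)" "continuous_on (real_spectrum x) (\<lambda>t. (t - \<gamma>) * ?H t)"
      "continuous_on (real_spectrum x) (\<lambda>t. ?r t - e)"
      by (intro continuous_on_diff continuous_on_mult continuous_on_ramp continuous_on_id continuous_on_const Hc)+
    show ?thesis
      unfolding cfc_diff[OF x c(2,3)] cfc_mult[OF x c(1) Hc] h_def[symmetric]
        cfc_diff[OF x continuous_on_ramp continuous_on_const] cfc_diff[OF x continuous_on_id continuous_on_const]
        cfc_const[OF x] cfc_id[OF x] ..
  qed
  finally have "\<tau> (cfc ?r x - e *\<^sub>R 1) \<le> \<tau> ((x - \<gamma> *\<^sub>R 1) * h)" by (rule trace_mono)
  also have "\<dots> \<le> \<tau> ((y - \<gamma> *\<^sub>R 1) * h)"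
    using le[OF Hc] h by (simp add: h_def left_diff_distrib trace_diff)
  also have "\<dots> \<le> \<tau> (cfc ?r y * h)" using yg h by (rule trace_mult_mono)
  \<comment> \<open>The bound \<open>h \<le> 1\<close> is tested against the positive element
    \<open>ramp \<gamma> N\<close> at \<open>y\<close>.\<close>
  also have "\<dots> \<le> \<tau> (cfc ?r y)"
    using trace_mult_positive[OF yp h1] by (simp add: right_diff_distrib trace_diff)
  finally show "\<tau> (cfc ?r x) \<le> \<tau> (cfc ?r y) + e" by (simp add: trace_diff trace_scaleR trace_one)
qed

section \<open>Positive unital maps\<close>

lemma
  assumes "complex_linear \<phi>"
  shows complex_linear_diff: "\<phi> (x - y) = \<phi> x - \<phi> y"
    and complex_linear_add: "\<phi> (x + y) = \<phi> x + \<phi> y"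
    and complex_linear_scaleR: "\<phi> (r *\<^sub>R x) = r *\<^sub>R \<phi> x"
proof -
  show add: "\<phi> (x + y) = \<phi> x + \<phi> y" for x y using assms by (simp add: complex_linear_def)
  show "\<phi> (x - y) = \<phi> x - \<phi> y" using add[of "x - y" y] by simp
  show "\<phi> (r *\<^sub>R x) = r *\<^sub>R \<phi> x"
    using assms unfolding complex_linear_def by (metis scaleC_of_real)
qed

text \<open>A self-adjoint element is the difference of its positive and negative parts, and each of
  them has a positive, hence self-adjoint, image.\<close>

lemma positive_map_selfadjoint:
  assumes "complex_linear \<phi>" "positive_map \<phi>" and x: "selfadjoint x"
  shows "selfadjoint (\<phi> x)"
proof -
  let ?p = "cfc (\<lambda>t. max t 0) x" and ?n = "cfc (\<lambda>t. max (- t) 0) x"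
  have c: "continuous_on (real_spectrum x) (\<lambda>t. max t 0)" "continuous_on (real_spectrum x) (\<lambda>t. max (- t) 0)"
    by (intro continuous_intros)+
  have "x = cfc (\<lambda>t. t) x" by (simp add: cfc_id[OF x])
  also have "\<dots> = cfc (\<lambda>t. max t 0 - max (- t) 0) x"
    by (intro cfc_cong x continuous_on_diff c) (auto simp: max_def)
  also have "\<dots> = ?p - ?n" by (rule cfc_diff[OF x c])
  finally have "\<phi> x = \<phi> ?p - \<phi> ?n" using complex_linear_diff[OF assms(1)] by metis
  moreover have "positive ?p" "positive ?n" by (intro positive_cfc x c; simp)+
  ultimately show ?thesis
    using assms(2) by (simp add: positive_map_def positive_selfadjoint selfadjoint_diff)
qed

lemma real_spectrum_shift:
  assumes "selfadjoint x" "t \<in> real_spectrum x"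
  shows "t - m \<in> real_spectrum (x - m *\<^sub>R 1)" "m - t \<in> real_spectrum (m *\<^sub>R 1 - x)"
proof -
  have sa: "selfadjoint (x - m *\<^sub>R 1)" "selfadjoint (m *\<^sub>R 1 - x)"
    by (intro selfadjoint_diff selfadjoint_scaleR selfadjoint_one assms(1))+
  have n: "\<not> ring_inv (x - complex_of_real t *\<^sub>C 1)"
    using assms real_spectrum_iff not_in_spectrum_iff by blast
  have "x - m *\<^sub>R 1 - complex_of_real (t - m) *\<^sub>C 1 = x - complex_of_real t *\<^sub>C 1"
    by (simp add: scaleC_of_real scaleC_diff_left)
  then show "t - m \<in> real_spectrum (x - m *\<^sub>R 1)"
    using n not_in_spectrum_iff real_spectrum_iff[OF sa(1)] by metis
  have "(- 1) *\<^sub>C (m *\<^sub>R 1 - x - complex_of_real (m - t) *\<^sub>C 1) = x - complex_of_real t *\<^sub>C 1"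
    by (simp add: scaleC_of_real scaleC_diff_left scaleC_minus_left scaleC_one)
  then have "\<not> ring_inv (m *\<^sub>R 1 - x - complex_of_real (m - t) *\<^sub>C 1)"
    using n ring_inv_scaleC[of _ "- 1"] by (metis neg_equal_0_iff_equal zero_neq_one)
  then show "m - t \<in> real_spectrum (m *\<^sub>R 1 - x)"
    using not_in_spectrum_iff real_spectrum_iff[OF sa(2)] by metis
qed

text \<open>Let \<open>m\<close> and \<open>M\<close> be the extreme spectral values of
  \<open>a\<close>; both lie in \<open>I\<close>. The inequalities \<open>m \<le> a \<le> M\<close>
  survive a positive unital map, and an interval contains everything between two of its
  points.\<close>

lemma real_spectrum_positive_map:
  assumes \<phi>: "complex_linear \<phi>" "positive_map \<phi>" "\<phi> 1 = 1" and a: "selfadjoint a"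
    and I: "is_interval I" "real_spectrum a \<subseteq> I"
  shows "real_spectrum (\<phi> a) \<subseteq> I"
proof
  fix t assume t: "t \<in> real_spectrum (\<phi> a)"
  have b: "selfadjoint (\<phi> a)" using \<phi>(1,2) a by (rule positive_map_selfadjoint)
  have "spectrum a \<noteq> {}" using spectral_radius_selfadjoint[OF a] by blast
  then have ne: "real_spectrum a \<noteq> {}" by (simp add: real_spectrum_def)
  obtain m where m: "m \<in> real_spectrum a" "\<And>s. s \<in> real_spectrum a \<Longrightarrow> m \<le> s"
    using compact_attains_inf[OF real_spectrum_compact ne] by blast
  obtain M where M: "M \<in> real_spectrum a" "\<And>s. s \<in> real_spectrum a \<Longrightarrow> s \<le> M"
    using compact_attains_sup[OF real_spectrum_compact ne] by blast
  have c: "continuous_on (real_spectrum a) (\<lambda>t. t)" "continuous_on (real_spectrum a) (\<lambda>t. k)" for k :: real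
    by (intro continuous_intros)+
  have "positive (cfc (\<lambda>t. t - m) a)" "positive (cfc (\<lambda>t. M - t) a)"
    using m(2) M(2) by (intro positive_cfc a continuous_on_diff c; simp)+
  then have "positive (\<phi> (a - m *\<^sub>R 1))" "positive (\<phi> (M *\<^sub>R 1 - a))"
    using \<phi>(2) by (simp_all add: cfc_diff[OF a c(1) c(2)] cfc_diff[OF a c(2) c(1)] cfc_id[OF a] cfc_const[OF a] positive_map_def)
  then have "positive (\<phi> a - m *\<^sub>R 1)" "positive (M *\<^sub>R 1 - \<phi> a)"
    by (simp_all add: complex_linear_diff[OF \<phi>(1)] complex_linear_scaleR[OF \<phi>(1)] \<phi>(3))
  then have "m \<le> t" "t \<le> M"
    using positive_real_spectrum real_spectrum_shift[OF b t] by force+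
  then show "t \<in> I" using I m(1) M(1) by (auto simp: is_interval_1)
qed

theorem theorem3p10:
  fixes \<phi> :: "'a::unital_cstar_algebra \<Rightarrow> 'b::unital_cstar_algebra"
    and \<pi> :: "'b \<Rightarrow> 'h::complex_hilbert_space \<Rightarrow> 'h"
    and tr :: "'b \<Rightarrow> complex"
    and f :: "real \<Rightarrow> real" and I :: "real set" and a :: 'a
  assumes "finite_factor \<pi>" and "normalized_trace tr"
    and "complex_linear \<phi>" and "positive_map \<phi>" and "\<phi> 1 = 1"
    and "open I" and "is_interval I" and "convex_on I f"
    and "selfadjoint a" and "spectrum a \<subseteq> complex_of_real ` I"
  shows "submajorized \<pi> tr (cfc f (\<phi> a)) (\<phi> (cfc f a))"
proof -
  interpret tracial_von_neumann \<pi> tr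
    using assms(1,2) by unfold_locales (simp_all add: finite_factor_def)
  note \<phi> = assms(3-5) and a = assms(9)
  let ?b = "\<phi> a" and ?y = "\<phi> (cfc f a)"
  let ?x = "cfc f ?b"
  have b: "selfadjoint ?b" using \<phi>(1,2) a by (rule positive_map_selfadjoint)
  have aI: "real_spectrum a \<subseteq> I" using assms(10) by (auto simp: real_spectrum_def)
  then have bI: "real_spectrum ?b \<subseteq> I" by (rule real_spectrum_positive_map[OF \<phi> a assms(7)])
  have f: "continuous_on I f" using assms(6,8) by (rule convex_on_continuous)
  have fa: "continuous_on (real_spectrum a) f" and fb: "continuous_on (real_spectrum ?b) f"
    using f aI bI by (auto intro: continuous_on_subset)
  have x: "selfadjoint ?x" by (rule cfc_selfadjoint[OF b fb])
  have y: "selfadjoint ?y"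
    by (rule positive_map_selfadjoint[OF \<phi>(1,2) cfc_selfadjoint[OF a fa]])
  have tangent: "\<exists>k. positive (?y - cfc (\<lambda>t. f s + k * (t - s)) ?b)" if s: "s \<in> real_spectrum ?b" for s
  proof -
    \<comment> \<open>The slope \<open>k\<close> is a subgradient at \<open>s\<close>; it exists
      because \<open>s\<close> is an interior point of the open interval.\<close>
    obtain k where k: "\<And>t. t \<in> I \<Longrightarrow> f s + k * (t - s) \<le> f t"
      using convex_le_Inf_differential[OF assms(8), of s] s bI interior_open[OF assms(6)] by blast
    let ?l = "\<lambda>t. f s + k * (t - s)"
    \<comment> \<open>On affine functions the calculus is a combination of the unit and the element,
      which is precisely what a unital linear map respects.\<close>
    have affine: "cfc ?l z = (f s - k * s) *\<^sub>R 1 + k *\<^sub>R z" if z: "selfadjoint z" for z :: "'z::unital_cstar_algebra"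
    proof -
      have c: "continuous_on (real_spectrum z) (\<lambda>t. f s - k * s)" "continuous_on (real_spectrum z) (\<lambda>t. k * t)"
        "continuous_on (real_spectrum z) (\<lambda>t. t)"
        by (intro continuous_intros)+
      have "cfc ?l z = cfc (\<lambda>t. (f s - k * s) + k * t) z"
        by (intro cfc_cong z continuous_on_add c) (simp add: algebra_simps)
      then show ?thesis by (simp add: cfc_add[OF z c(1,2)] cfc_const[OF z] cfc_scale[OF z c(3)] cfc_id[OF z])
    qed
    have l: "continuous_on (real_spectrum a) ?l" by (intro continuous_intros)
    have "positive (cfc (\<lambda>t. f t - ?l t) a)"
      using k aI by (intro positive_cfc a continuous_on_diff fa l) auto
    then have "positive (\<phi> (cfc f a - cfc ?l a))"
      using \<phi>(2) by (simp add: cfc_diff[OF a fa l] positive_map_def)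
    also have "\<phi> (cfc f a - cfc ?l a) = ?y - cfc ?l ?b"
      by (simp add: affine[OF a] affine[OF b] complex_linear_diff[OF \<phi>(1)] complex_linear_add[OF \<phi>(1)]
          complex_linear_scaleR[OF \<phi>(1)] \<phi>(3))
    finally show ?thesis by blast
  qed
  show ?thesis
  proof (rule submajorizedI[OF x y max.cobounded1 max.cobounded2])
    fix \<gamma> assume \<gamma>: "\<gamma> \<le> max (norm ?x) (norm ?y)"
    show "\<tau> (cfc (ramp \<gamma> (max (norm ?x) (norm ?y))) ?x) \<le> \<tau> (cfc (ramp \<gamma> (max (norm ?x) (norm ?y))) ?y)"
    proof (rule trace_ramp_mono[OF x y max.cobounded1 max.cobounded2 \<gamma>])
      fix g assume g: "continuous_on (real_spectrum ?x) g" "positive (cfc g ?x)"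
      \<comment> \<open>Commutation passes from \<open>b\<close> to \<open>x = f(b)\<close> and from
        there to every continuous function of \<open>x\<close>, so these are admissible test
        elements.\<close>
      have "?b * ?x = ?x * ?b" by (rule cfc_comm[OF b fb]) simp
      then have "cfc g ?x * ?b = ?b * cfc g ?x" using cfc_comm[OF x g(1)] by metis
      then show "\<tau> (?x * cfc g ?x) \<le> \<tau> (?y * cfc g ?x)"
        by (rule trace_jensen[OF b fb g(2) _ tangent])
    qed
  qed
qed

end
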